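(* (i) Let $\alpha>0$ and let $\mathcal{G}\in\mathcal{K}(\alpha)$ be such that $\hat{\mathcal{G}}$ does not vanish (identically) on any set $\mathbb{Z}+b$, $0\le b<1$. If a separated set $\Lambda\subset\mathbb{R}$ satisfies $D^-(\Lambda)>q(\mathcal{G})/k(\mathcal{G})$, then the system $G(\mathcal{G},\Lambda\times\mathbb{Z})$ is a frame in $L^2(\mathbb{R})$. (ii) There exist $\alpha>0$, a generator $\mathcal{G}\in\mathcal{K}(\alpha)$ such that $\hat{\mathcal{G}}$ does not vanish (identically) on any set $\mathbb{Z}+b$, $0\le b<1$, and a separated set $\Lambda\subset\mathbb{R}$ with $D^-(\Lambda)=q(\mathcal{G})/k(\mathcal{G})$, such that $G(\mathcal{G},\Lambda\times\mathbb{Z})$ is not a frame in $L^2(\mathbb{R})$. (iii) Let $\alpha>0$ and let $\mathcal{G}\in\mathcal{C}(\alpha)$ be such that $\hat{\mathcal{G}}$ does not vanish (identically) on any set $\mathbb{Z}+b$, $0\le b<1$. If a separated set $\Lambda\subset\mathbb{R}$ satisfies $D^-(\Lambda)>q(\mathcal{G})+1$, then the system $G(\mathcal{G},\Lambda\times\mathbb{Z})$ is a frame in $L^2(\mathbb{R})$. (iv) There exist $\alpha>0$, a generator $\mathcal{G}\in\mathcal{C}(\alpha)$ such that $\hat{\mathcal{G}}$ does not vanish (identically) on any set $\mathbb{Z}+b$, $0\le b<1$, and a separated set $\Lambda\subset\mathbb{R}$ with $D^-(\Lambda)=q(\mathcal{G})+1$, such that $G(\mathcal{G},\Lambda\times\mathbb{Z})$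 is not a frame in $L^2(\mathbb{R})$.
   Context: A countable set $\Lambda\subset\mathbb{R}$ is separated if $\inf_{\lambda\ne\lambda'}|\lambda-\lambda'|>0$; $D^-(\Lambda)=\lim_{R\to\infty}\inf_{x\in\mathbb{R}}\frac{\#(\Lambda\cap[x-R,x+R])}{2R}$. Class $\mathcal{K}(\alpha)$: all functions $\mathcal{G}(z)=\mathcal{R}(e^{\alpha z})$, $\mathcal{R}=P/Q$, where $P,Q$ are non-trivial complex polynomials without common zeros such that (A) $1\le\deg P<\deg Q$; (B) $P(0)=0$; (C) $Q(x)\ne0$ for all real $x\ge0$. For such $\mathcal{G}$, $q(\mathcal{G}):=\deg Q$, and $k(\mathcal{G})$ is the greatest integer $k$ such that $\mathcal{G}(z+2\pi i/(k\alpha))=c\,\mathcal{G}(z)$, $z\in\mathbb{C}$, for some constant $c\in\mathbb{C}$. Class $\mathcal{C}(\alpha)$: all functions $\mathcal{G}(z)=e^{-\alpha z^2/2}\frac{P(e^{\alpha z})}{Q(e^{\alpha z})}$, where $P,Q$ are non-trivial complex polynomials without common zeros and $Q(x)\ne0$ for all real $x\ge0$. For such $\mathcal{G}$, $q(\mathcal{G}):=\deg Q$. Fourier transform: $\hat{\mathcal{G}}(t)=\int_{\mathbb{R}}e^{-2\pi ixt}\mathcal{G}(x)\,dx$. That $\hat{\mathcal{G}}$ does not vanish on $\mathbb{Z}+b$ means that there is $n\in\mathbb{Z}$ with $\hat{\mathcal{G}}(n+b)\ne0$. With $M_\xi f(x)=e^{2\pi i\xi x}f(x)$ and $T_\lambda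 f(x)=f(x-\lambda)$, the Gabor system is $G(\mathcal{G},\Lambda\times\mathbb{Z})=\{M_\xi T_\lambda\mathcal{G}:(\lambda,\xi)\in\Lambda\times\mathbb{Z}\}$. It is a frame in $L^2(\mathbb{R})$ if there are finite constants $A,B>0$ such that $A\|f\|_2^2\le\sum_{(\lambda,\xi)\in\Lambda\times\mathbb{Z}}|\langle f,M_\xi T_\lambda\mathcal{G}\rangle|^2\le B\|f\|_2^2$ for every $f\in L^2(\mathbb{R})$. *)

theory Defs
  imports
    "HOL-Analysis.Analysis"
    "HOL-Computational_Algebra.Fundamental_Theorem_Algebra"
    "HOL-Computational_Algebra.Polynomial_Factorial"
    "HOL-Computational_Algebra.Field_as_Ring"
begin

(* The infimum is taken in the extended reals, so that sets with at most one element count as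
   separated (the infimum of the empty set is infinity). *)
definition separated_set :: "real set \<Rightarrow> bool" where
  "separated_set \<Lambda> \<longleftrightarrow>
     countable \<Lambda> \<and>
     0 < (INF p\<in>{(x, y). x \<in> \<Lambda> \<and> y \<in> \<Lambda> \<and> x \<noteq> y}. ereal \<bar>fst p - snd p\<bar>)"

(* Only meaningful for separated sets: then all the cardinalities are those of finite sets and the
   limit exists by superadditivity. *)
definition lower_density :: "real set \<Rightarrow> real" where
  "lower_density \<Lambda> =
     Lim at_top (\<lambda>R::real. INF x::real. real (card (\<Lambda> \<inter> {x - R..x + R})) / (2 * R))"


(* Generators are total functions on the complex plane; at the zeros of Q (exp (\<alpha> z)), where the
   meromorphic function has its poles, the value is 0 by the convention x / 0 = 0. *)
definition K_repr :: "real \<Rightarrow> (complex \<Rightarrow> complex) \<Rightarrow> complex poly \<Rightarrow> complex poly \<Rightarrow> bool" where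
  "K_repr \<alpha> G P Q \<longleftrightarrow>
     P \<noteq> 0 \<and> Q \<noteq> 0 \<and> (\<forall>z. \<not> (poly P z = 0 \<and> poly Q z = 0)) \<and>
     1 \<le> degree P \<and> degree P < degree Q \<and>
     poly P 0 = 0 \<and>
     (\<forall>x::real. x \<ge> 0 \<longrightarrow> poly Q (of_real x) \<noteq> 0) \<and>
     G = (\<lambda>z. poly P (exp (of_real \<alpha> * z)) / poly Q (exp (of_real \<alpha> * z)))"

definition class_K :: "real \<Rightarrow> (complex \<Rightarrow> complex) set" where
  "class_K \<alpha> = {G. \<exists>P Q. K_repr \<alpha> G P Q}"

(* The degree does not depend on the representation, see K_degree_eq below. *)
definition K_degree :: "real \<Rightarrow> (complex \<Rightarrow> complex) \<Rightarrow> nat" where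
  "K_degree \<alpha> G = (THE q. \<exists>P Q. K_repr \<alpha> G P Q \<and> degree Q = q)"

(* The requirement k \<ge> 1 excludes the spurious solution k = 0 coming from x / 0 = 0. Since c = 0 is
   impossible for a nonzero G, a valid shift permutes the poles, so the value 0 assigned to G at its
   poles does not affect the identity. *)
definition K_symmetry :: "real \<Rightarrow> (complex \<Rightarrow> complex) \<Rightarrow> nat" where
  "K_symmetry \<alpha> G =
     (GREATEST k. k \<ge> 1 \<and>
        (\<exists>c. \<forall>z. G (z + 2 * of_real pi * \<i> / (of_nat k * of_real \<alpha>)) = c * G z))"


definition C_repr :: "real \<Rightarrow> (complex \<Rightarrow> complex) \<Rightarrow> complex poly \<Rightarrow> complex poly \<Rightarrow> bool" where
  "C_repr \<alpha> G P Q \<longleftrightarrow>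
     P \<noteq> 0 \<and> Q \<noteq> 0 \<and> (\<forall>z. \<not> (poly P z = 0 \<and> poly Q z = 0)) \<and>
     (\<forall>x::real. x \<ge> 0 \<longrightarrow> poly Q (of_real x) \<noteq> 0) \<and>
     G = (\<lambda>z. exp (- of_real \<alpha> * z\<^sup>2 / 2) *
               (poly P (exp (of_real \<alpha> * z)) / poly Q (exp (of_real \<alpha> * z))))"

definition class_C :: "real \<Rightarrow> (complex \<Rightarrow> complex) set" where
  "class_C \<alpha> = {G. \<exists>P Q. C_repr \<alpha> G P Q}"

(* Independent of the representation, see C_degree_eq below. *)
definition C_degree :: "real \<Rightarrow> (complex \<Rightarrow> complex) \<Rightarrow> nat" where
  "C_degree \<alpha> G = (THE q. \<exists>P Q. C_repr \<alpha> G P Q \<and> degree Q = q)"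


definition on_reals :: "(complex \<Rightarrow> complex) \<Rightarrow> real \<Rightarrow> complex" where
  "on_reals G x = G (of_real x)"

definition fourier :: "(real \<Rightarrow> complex) \<Rightarrow> real \<Rightarrow> complex" where
  "fourier g t = (LINT x|lborel. exp (- 2 * of_real pi * \<i> * of_real x * of_real t) * g x)"

definition fourier_nonvanishing :: "(real \<Rightarrow> complex) \<Rightarrow> bool" where
  "fourier_nonvanishing g \<longleftrightarrow>
     (\<forall>b. 0 \<le> b \<and> b < 1 \<longrightarrow> (\<exists>n::int. fourier g (of_int n + b) \<noteq> 0))"


(* Borel functions suffice: every element of L^2 has a Borel representative, and the quantities below
   depend only on the function up to null sets. *)
definition L2_functions :: "(real \<Rightarrow> complex) set" where
  "L2_functions = {f. f \<in> borel_measurable lborel \<and> integrable lborel (\<lambda>x. (cmod (f x))\<^sup>2)}"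

definition L2_inner :: "(real \<Rightarrow> complex) \<Rightarrow> (real \<Rightarrow> complex) \<Rightarrow> complex" where
  "L2_inner f g = (LINT x|lborel. f x * cnj (g x))"

definition L2_norm :: "(real \<Rightarrow> complex) \<Rightarrow> real" where
  "L2_norm f = sqrt (LINT x|lborel. (cmod (f x))\<^sup>2)"

definition modulation :: "real \<Rightarrow> (real \<Rightarrow> complex) \<Rightarrow> real \<Rightarrow> complex" where
  "modulation \<xi> f x = exp (2 * of_real pi * \<i> * of_real \<xi> * of_real x) * f x"

definition translation :: "real \<Rightarrow> (real \<Rightarrow> complex) \<Rightarrow> real \<Rightarrow> complex" where
  "translation l f x = f (x - l)"

(* Summability is required explicitly because a divergent infinite sum of reals has value 0. *)
definition gabor_frame :: "(real \<Rightarrow> complex) \<Rightarrow> (real \<times> real) set \<Rightarrow> bool" where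
  "gabor_frame g S \<longleftrightarrow>
     (\<exists>A B::real. 0 < A \<and> 0 < B \<and>
       (\<forall>f\<in>L2_functions.
          (\<lambda>(l, \<xi>). (cmod (L2_inner f (modulation \<xi> (translation l g))))\<^sup>2) summable_on S \<and>
          A * (L2_norm f)\<^sup>2
            \<le> (\<Sum>\<^sub>\<infinity>(l, \<xi>)\<in>S. (cmod (L2_inner f (modulation \<xi> (translation l g))))\<^sup>2) \<and>
          (\<Sum>\<^sub>\<infinity>(l, \<xi>)\<in>S. (cmod (L2_inner f (modulation \<xi> (translation l g))))\<^sup>2)
            \<le> B * (L2_norm f)\<^sup>2))"


lemma reduced_fraction_degree_eq:
  fixes P Q P' Q' :: "complex poly"
  assumes Q: "Q \<noteq> 0" and Q': "Q' \<noteq> 0"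
    and cop: "\<And>z. \<not> (poly P z = 0 \<and> poly Q z = 0)"
    and cop': "\<And>z. \<not> (poly P' z = 0 \<and> poly Q' z = 0)"
    and eq: "\<And>w. w \<noteq> 0 \<Longrightarrow> poly P w / poly Q w = poly P' w / poly Q' w"
  shows "degree Q = degree Q'"
proof -
  have "poly ((P * Q' - P' * Q) * (Q * Q' * [:0, 1:])) w = 0" for w
  proof (cases "w = 0 \<or> poly Q w = 0 \<or> poly Q' w = 0")
    case False
    then have "poly P w * poly Q' w = poly P' w * poly Q w"
      using eq[of w] by (simp add: frac_eq_eq)
    then show ?thesis by simp
  qed auto
  then have "(P * Q' - P' * Q) * (Q * Q' * [:0, 1:]) = 0"
    using poly_all_0_iff_0 by blast
  moreover have "Q * Q' * [:0, 1:] \<noteq> 0"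
    using Q Q' by (simp del: mult_pCons_right)
  ultimately have D: "P * Q' = P' * Q"
    by (metis mult_eq_0_iff right_minus_eq)
  have unit: "is_unit c" if "c dvd p" "c dvd q" "q \<noteq> 0" "\<And>z. \<not> (poly p z = 0 \<and> poly q z = 0)"
    for c p q :: "complex poly"
  proof -
    have "poly c z \<noteq> 0" for z
      using that(1,2,4) by (auto simp: dvd_def)
    then have "degree c = 0"
      using fundamental_theorem_of_algebra constant_degree by blast
    moreover have "c \<noteq> 0"
      using that by auto
    ultimately show ?thesis
      using is_unit_iff_degree by blast
  qed
  have cQ: "coprime Q P" and cQ': "coprime Q' P'"
    using unit[OF _ _ Q cop] unit[OF _ _ Q' cop'] by (auto intro!: coprimeI)
  have d: "Q dvd P * Q'" and d': "Q' dvd P' * Q"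
    using D dvd_triv_right[of Q P'] dvd_triv_right[of Q' P] by simp_all
  have "Q dvd Q'" "Q' dvd Q"
    by (rule iffD1[OF coprime_dvd_mult_right_iff[OF cQ] d],
        rule iffD1[OF coprime_dvd_mult_right_iff[OF cQ'] d'])
  then show ?thesis
    using Q Q' by (meson dvd_imp_degree_le le_antisym)
qed

lemma exp_scaled_surj:
  fixes w :: complex
  assumes "\<alpha> > 0" "w \<noteq> 0"
  obtains z where "exp (of_real \<alpha> * z) = w"
proof
  show "exp (of_real \<alpha> * (Ln w / of_real \<alpha>)) = w"
    using assms by simp
qed

lemma K_repr_eval:
  assumes "K_repr \<alpha> G P Q"
  shows "G z = poly P (exp (of_real \<alpha> * z)) / poly Q (exp (of_real \<alpha> * z))"
  using assms by (simp add: K_repr_def)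

lemma K_degree_eq:
  assumes "\<alpha> > 0" "K_repr \<alpha> G P Q"
  shows "K_degree \<alpha> G = degree Q"
  unfolding K_degree_def
proof (rule the_equality)
  show "\<exists>P' Q'. K_repr \<alpha> G P' Q' \<and> degree Q' = degree Q"
    using assms by blast
next
  fix q assume "\<exists>P' Q'. K_repr \<alpha> G P' Q' \<and> degree Q' = q"
  then obtain P' Q' where r: "K_repr \<alpha> G P' Q'" and q: "degree Q' = q"
    by blast
  have eq: "poly P' w / poly Q' w = poly P w / poly Q w" if w: "w \<noteq> 0" for w
  proof -
    obtain z where z: "exp (of_real \<alpha> * z) = w"
      by (rule exp_scaled_surj[OF assms(1) w])
    have "G z = poly P w / poly Q w"
      using K_repr_eval[OF assms(2), of z] unfolding z .
    moreover have "G z = poly P' w / poly Q' w"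
      using K_repr_eval[OF r, of z] unfolding z .
    ultimately show ?thesis by simp
  qed
  have cop: "Q' \<noteq> 0" "Q \<noteq> 0" "\<not> (poly P' z = 0 \<and> poly Q' z = 0)"
    "\<not> (poly P z = 0 \<and> poly Q z = 0)" for z
    using assms(2) r by (simp_all add: K_repr_def)
  have "degree Q' = degree Q"
    by (rule reduced_fraction_degree_eq[OF cop eq])
  then show "q = degree Q" using q by simp
qed

lemma C_repr_eval:
  assumes "C_repr \<alpha> G P Q"
  shows "G z = exp (- of_real \<alpha> * z\<^sup>2 / 2) *
    (poly P (exp (of_real \<alpha> * z)) / poly Q (exp (of_real \<alpha> * z)))"
  using assms by (simp add: C_repr_def)

lemma C_degree_eq:
  assumes "\<alpha> > 0" "C_repr \<alpha> G P Q"
  shows "C_degree \<alpha> G = degree Q"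
  unfolding C_degree_def
proof (rule the_equality)
  show "\<exists>P' Q'. C_repr \<alpha> G P' Q' \<and> degree Q' = degree Q"
    using assms by blast
next
  fix q assume "\<exists>P' Q'. C_repr \<alpha> G P' Q' \<and> degree Q' = q"
  then obtain P' Q' where r: "C_repr \<alpha> G P' Q'" and q: "degree Q' = q"
    by blast
  have eq: "poly P' w / poly Q' w = poly P w / poly Q w" if w: "w \<noteq> 0" for w
  proof -
    obtain z where z: "exp (of_real \<alpha> * z) = w"
      by (rule exp_scaled_surj[OF assms(1) w])
    have "G z = exp (- of_real \<alpha> * z\<^sup>2 / 2) * (poly P w / poly Q w)"
      using C_repr_eval[OF assms(2), of z] unfolding z .
    moreover have "G z = exp (- of_real \<alpha> * z\<^sup>2 / 2) * (poly P' w / poly Q' w)"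
      using C_repr_eval[OF r, of z] unfolding z .
    ultimately show ?thesis by (metis exp_not_eq_zero mult_left_cancel)
  qed
  have cop: "Q' \<noteq> 0" "Q \<noteq> 0" "\<not> (poly P' z = 0 \<and> poly Q' z = 0)"
    "\<not> (poly P z = 0 \<and> poly Q z = 0)" for z
    using assms(2) r by (simp_all add: C_repr_def)
  have "degree Q' = degree Q"
    by (rule reduced_fraction_degree_eq[OF cop eq])
  then show "q = degree Q" using q by simp
qed

end

theory Submission
  imports Defs "HOL-Complex_Analysis.Complex_Analysis"
begin

text \<open>A Gabor system over \<Lambda> \<times> \<int> is controlled by a sampling problem. Write T, M for translation and
modulation. For compactly supported f, Parseval's identity in the modulation variable gives
\<Sum>n |<f, M n (T \<lambda> g)>|^2 = \<integral>_[0,1) |\<Sum>k f(x+k) cnj (g(x+k-\<lambda>))|^2 dx. Hence there is a lower frame bound as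
soon as, uniformly in x, the l2-norm of a finite sequence c is dominated by the samples on x - \<Lambda> of the
shift sum \<Sum>k c(k) g(\<cdot> - k). The upper bound follows from exponential decay of g and Schur's test, and
general f are reached by truncation (gabor_frame_of_sampling).

Both classes consist of functions g(x) = exp(\<beta>x - \<gamma>\<alpha>x^2/2) P(e^(\<alpha>x))/Q(e^(\<alpha>x)) with \<gamma> = 0 for K and
\<gamma> = 1 for C. If a generator of class K has symmetry order k, then P(u) = u^s P0(u^k) and Q(u) = Q0(u^k), so
it is also such a function with k\<alpha> in place of \<alpha> and with Q0, whose degree is q/k, in place of Q. In all
cases the critical density is therefore deg Q + \<gamma> (locale exp_rational).

The core is a local inequality (local_sampling): the value of a shift sum at a point is at most K times the
sum of its absolute values on the sampling points in a bounded window, plus \<epsilon> times an exponentially weighted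
l1-norm of c, with \<epsilon> as small as desired. In the variable w = e^(\<alpha>z), multiplication by the product of all
Q(w e^(-\<alpha>m)) with |m| \<le> V turns a shift sum, up to its elementary factor, into a function that is holomorphic
in an annulus of logarithmic width about 2\<alpha>nL. Its growth towards the boundary is that of a function with
deg Q zeros per unit length, plus the contribution of the Gaussian factor. Subtracting the Lagrange
interpolant at more than deg Q + \<gamma> nodes per unit length and dividing by the node polynomial, the maximum
principle gains a factor exp(-\<alpha>Ln^2/2 + O(n)).

The hypothesis on the Fourier transform says that for no \<theta> is the Zak transform Z(x,\<theta>) identically zero in
x. By compactness finitely many x suffice for all \<theta>, and Parseval's identity in \<theta> bounds the l2-norm of c by
the values of its shift sum on finitely many translates of \<int> (riesz_lower_bound). Inserting the local
inequality there, Schur's test lets the \<epsilon>-term be absorbed (sampling_inequality).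

For sharpness take \<Lambda> = \<int> and g even. Then \<Sum>k (-1)^k g(x+k) vanishes at x = 1/2, so long alternating trains
of bumps supported near 1/2 + \<int> have energy that is small compared with their norm
(even_generator_not_frame). The hyperbolic secant u/(1+u^2), with q = k = 2, and the Gaussian, with q = 0,
are even and critical at density one; when \<alpha> is large their Fourier transforms have no zero in [0,1).\<close>

section \<open>Parseval's identity on the unit interval\<close>

abbreviation unit_interval_measure :: "real measure" ("\<U>") where
  "\<U> \<equiv> restrict_space lborel {0..<1::real}"

definition character :: "int \<Rightarrow> real \<Rightarrow> complex" where
  "character n t = cis (2 * pi * of_int n * t)"

lemma norm_character [simp]: "norm (character n t) = 1"
  by (simp add: character_def)

lemma character_add: "character (m + n) t = character m t * character n t"
  by (simp add: character_def cis_mult ring_distribs)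

lemma character_0 [simp]: "character 0 t = 1"
  by (simp add: character_def)

lemma cnj_character: "cnj (character n t) = character (- n) t"
  by (simp add: character_def cis_cnj)

lemma continuous_character [continuous_intros]:
  "continuous_on S f \<Longrightarrow> continuous_on S (\<lambda>x. character n (f x))"
  unfolding character_def by (intro continuous_intros)

lemma character_measurable [measurable]: "character n \<in> borel_measurable borel"
  by (intro borel_measurable_continuous_onI continuous_intros)

lemma finite_measure_U: "finite_measure \<U>"
  by (rule finite_measureI) (simp add: space_restrict_space emeasure_restrict_space)

interpretation U: finite_measure \<U> by (rule finite_measure_U)

lemma U_space [simp]: "space \<U> = {0..<1}"
  by (simp add: space_restrict_space)

lemma measurable_U [measurable_dest]: "f \<in> borel_measurable borel \<Longrightarrow> f \<in> borel_measurable \<U>"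
  by (simp add: measurable_restrict_space1)

lemma measurable_U_id [measurable]: "(\<lambda>x. x) \<in> borel_measurable \<U>"
  by (rule measurable_U) simp

lemma measure_U_1: "measure \<U> {0..<1} = 1"
  by (subst measure_restrict_space) auto

lemma integrable_bounded_U:
  fixes f :: "real \<Rightarrow> 'a :: {banach, second_countable_topology}"
  assumes "f \<in> borel_measurable \<U>" "\<And>x. x \<in> {0..<1} \<Longrightarrow> norm (f x) \<le> B"
  shows "integrable \<U> f"
  by (rule U.integrable_const_bound[where B = B]) (use assms in auto)

lemma integral_character:
  "(LINT t|\<U>. character n t) = (if n = 0 then 1 else 0)"
proof (cases "n = 0")
  case True
  then show ?thesis by (simp add: measure_U_1)
next
  case False
  define a where "a = (2 * of_real pi * \<i> * of_int n :: complex)"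
  have a: "a \<noteq> 0" using False by (simp add: a_def)
  let ?F = "\<lambda>t::real. exp (a * of_real t) / a"
  have "((\<lambda>t::real. exp (a * of_real t)) has_integral (?F 1 - ?F 0)) {0..1}"
  proof (rule fundamental_theorem_of_calculus)
    show "(?F has_vector_derivative exp (a * of_real x)) (at x within {0..1})" for x
    proof -
      have "((\<lambda>z. exp (a * z) / a) has_field_derivative exp (a * of_real x)) (at (of_real x))"
        using a by (auto intro!: derivative_eq_intros)
      then show ?thesis
        by (rule has_vector_derivative_real_field)
    qed
  qed simp
  moreover have "?F 1 - ?F 0 = 0"
    using exp_integer_2pi[of "of_int n"] by (simp add: a_def mult_ac)
  ultimately have hi: "((\<lambda>t. character n t) has_integral 0) {0..1}"
    by (simp add: character_def cis_conv_exp a_def mult_ac)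
  have "set_integrable lborel {0..1} (character n)"
    by (intro borel_integrable_atLeastAtMost' continuous_intros)
  then have "(LINT t:{0..1}|lborel. character n t) = 0"
    using hi has_integral_unique set_borel_integral_eq_integral(2) integral_unique by metis
  moreover have "(LINT t:{0..1}|lborel. character n t) = (LINT t:{0..<1}|lborel. character n t)"
    unfolding set_lebesgue_integral_def
  proof (rule integral_cong_AE)
    show "AE x in lborel. indicat_real {0..1} x *\<^sub>R character n x = indicat_real {0..<1} x *\<^sub>R character n x"
      using AE_lborel_singleton[of "1::real"] by eventually_elim (auto simp: indicator_def)
  qed auto
  ultimately show ?thesis using False
    by (simp add: integral_restrict_space set_lebesgue_integral_def)
qed

definition trig_poly :: "(int \<Rightarrow> complex) \<Rightarrow> int set \<Rightarrow> real \<Rightarrow> complex" where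
  "trig_poly a J t = (\<Sum>n\<in>J. a n * character n t)"

definition trig_polys :: "(real \<Rightarrow> complex) set" where
  "trig_polys = {trig_poly a J | a J. finite J}"

lemma trig_polysI: "finite J \<Longrightarrow> (\<And>t. p t = (\<Sum>n\<in>J. a n * character n t)) \<Longrightarrow> p \<in> trig_polys"
  unfolding trig_polys_def trig_poly_def by blast

lemma trig_polysE:
  assumes "p \<in> trig_polys"
  obtains J a where "finite J" "p = trig_poly a J"
  using assms unfolding trig_polys_def by blast

lemma trig_poly_extend:
  assumes "finite K" "J \<subseteq> K"
  shows "trig_poly a J = trig_poly (\<lambda>n. if n \<in> J then a n else 0) K"
proof
  fix t
  show "trig_poly a J t = trig_poly (\<lambda>n. if n \<in> J then a n else 0) K t"
    unfolding trig_poly_def using assms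
    by (intro sum.mono_neutral_cong_left) auto
qed

lemma trig_polys_add: "p \<in> trig_polys \<Longrightarrow> q \<in> trig_polys \<Longrightarrow> (\<lambda>t. p t + q t) \<in> trig_polys"
proof -
  assume "p \<in> trig_polys" "q \<in> trig_polys"
  then obtain J a K b where J: "finite J" "p = trig_poly a J" and K: "finite K" "q = trig_poly b K"
    by (auto elim!: trig_polysE)
  let ?a = "\<lambda>n. if n \<in> J then a n else 0" and ?b = "\<lambda>n. if n \<in> K then b n else 0"
  have "p = trig_poly ?a (J \<union> K)" "q = trig_poly ?b (J \<union> K)"
    using J K trig_poly_extend[of "J \<union> K" J a] trig_poly_extend[of "J \<union> K" K b] by auto
  then show ?thesis
    using J K by (intro trig_polysI[of "J \<union> K" _ "\<lambda>n. ?a n + ?b n"])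
      (auto simp: trig_poly_def sum.distrib ring_distribs)
qed

lemma trig_polys_cmult: "p \<in> trig_polys \<Longrightarrow> (\<lambda>t. c * p t) \<in> trig_polys"
proof (erule trig_polysE)
  fix J a assume "finite J" "p = trig_poly a J"
  then show "(\<lambda>t. c * p t) \<in> trig_polys"
    by (intro trig_polysI[of J _ "\<lambda>n. c * a n"]) (auto simp: trig_poly_def sum_distrib_left mult_ac)
qed

lemma trig_polys_character: "character n \<in> trig_polys"
  by (rule trig_polysI[of "{n}" _ "\<lambda>_. 1"]) auto

lemma trig_polys_const: "(\<lambda>t. c) \<in> trig_polys"
  using trig_polys_cmult[OF trig_polys_character[of 0], of c] by simp

lemma trig_polys_sum:
  assumes "finite I" "\<And>i. i \<in> I \<Longrightarrow> p i \<in> trig_polys"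
  shows "(\<lambda>t. \<Sum>i\<in>I. p i t) \<in> trig_polys"
  using assms by (induction I rule: finite_induct) (auto intro: trig_polys_const trig_polys_add)

lemma trig_polys_mult:
  assumes "p \<in> trig_polys" "q \<in> trig_polys" shows "(\<lambda>t. p t * q t) \<in> trig_polys"
proof -
  obtain J a K b where J: "finite J" "p = trig_poly a J" and K: "finite K" "q = trig_poly b K"
    using assms by (auto elim!: trig_polysE)
  have *: "(\<lambda>t. \<Sum>m\<in>J. \<Sum>n\<in>K. (a m * b n) * character (m + n) t) \<in> trig_polys"
    by (intro trig_polys_sum trig_polys_cmult trig_polys_character J K)
  have "p t * q t = (\<Sum>m\<in>J. \<Sum>n\<in>K. (a m * b n) * character (m + n) t)" for t
    using J K by (simp add: trig_poly_def sum_product character_add mult_ac)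
  then show ?thesis using * by simp
qed

lemma trig_polys_continuous: "p \<in> trig_polys \<Longrightarrow> continuous_on S p"
proof (erule trig_polysE)
  fix J a assume "p = trig_poly a J"
  then have "p = (\<lambda>t. \<Sum>n\<in>J. a n * character n t)" by (auto simp: trig_poly_def)
  then show "continuous_on S p" by (auto intro!: continuous_intros)
qed

lemma trig_polys_measurable [measurable_dest]: "p \<in> trig_polys \<Longrightarrow> p \<in> borel_measurable borel"
  by (intro borel_measurable_continuous_onI trig_polys_continuous)

text \<open>On the unit circle Re z and Im z are trigonometric polynomials of degree one, and trigonometric
polynomials form an algebra.\<close>

lemma trig_polys_real_polynomial:
  fixes r :: "complex \<Rightarrow> real"
  assumes "real_polynomial_function r"
  shows "(\<lambda>t. of_real (r (character 1 t))) \<in> trig_polys"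
  using assms
proof induction
  case (linear f)
  have f: "f z = Re z * f 1 + Im z * f \<i>" for z
  proof -
    have "f z = f (Re z *\<^sub>R 1 + Im z *\<^sub>R \<i>)"
      by (rule arg_cong[of _ _ f]) (simp add: complex_eq_iff)
    also have "\<dots> = Re z * f 1 + Im z * f \<i>"
      using linear by (simp add: bounded_linear.linear linear_add linear_scale)
    finally show ?thesis .
  qed
  have re: "complex_of_real (Re z) = (z + cnj z) / 2" "complex_of_real (Im z) = - \<i> * (z - cnj z) / 2" for z
    by (simp_all add: complex_eq_iff)
  have "(\<lambda>t. (of_real (f 1) / 2 - \<i> * of_real (f \<i>) / 2) * character 1 t +
             (of_real (f 1) / 2 + \<i> * of_real (f \<i>) / 2) * character (-1) t) \<in> trig_polys"
    by (intro trig_polys_add trig_polys_cmult trig_polys_character)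
  moreover have "(of_real (f 1) / 2 - \<i> * of_real (f \<i>) / 2) * character 1 t +
             (of_real (f 1) / 2 + \<i> * of_real (f \<i>) / 2) * character (-1) t = complex_of_real (f (character 1 t))" for t
    by (subst f, simp only: of_real_add of_real_mult re cnj_character) (simp add: field_simps)
  ultimately show ?case by simp
qed (auto intro: trig_polys_const trig_polys_add trig_polys_mult)

lemma trig_polys_dense_continuous:
  fixes F :: "complex \<Rightarrow> complex"
  assumes "continuous_on UNIV F" "e > 0"
  obtains p where "p \<in> trig_polys" "\<And>t. norm (F (character 1 t) - p t) < e"
proof -
  obtain g where g: "polynomial_function g" "\<And>z. z \<in> sphere 0 1 \<Longrightarrow> norm (F z - g z) < e"
    using Stone_Weierstrass_polynomial_function[of "sphere (0::complex) 1" F e] assms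
    by (meson compact_sphere continuous_on_subset subset_UNIV)
  have "real_polynomial_function (Re \<circ> g)" "real_polynomial_function (Im \<circ> g)"
    using g(1) bounded_linear_Re bounded_linear_Im unfolding polynomial_function_def by blast+
  then have "(\<lambda>t. of_real ((Re \<circ> g) (character 1 t)) + \<i> * of_real ((Im \<circ> g) (character 1 t))) \<in> trig_polys"
    by (intro trig_polys_add trig_polys_cmult trig_polys_real_polynomial)
  moreover have "of_real ((Re \<circ> g) z) + \<i> * of_real ((Im \<circ> g) z) = g z" for z
    by (simp add: complex_eq[symmetric])
  ultimately have "(\<lambda>t. g (character 1 t)) \<in> trig_polys" by simp
  then show ?thesis using that g(2) by (metis norm_character mem_sphere_0)
qed

text \<open>Membership in the L2-closure of the trigonometric polynomials. The distance is a nonnegative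
integral, so that no integrability conditions have to be carried along.\<close>

definition L2_approximable :: "(real \<Rightarrow> complex) \<Rightarrow> bool" where
  "L2_approximable f \<longleftrightarrow> f \<in> borel_measurable \<U> \<and>
     (\<forall>e>0. \<exists>p\<in>trig_polys. (\<integral>\<^sup>+t. ennreal ((norm (f t - p t))\<^sup>2) \<partial>\<U>) \<le> ennreal e)"

lemma norm_add_sq_le: "(norm (a + b :: complex))\<^sup>2 \<le> 2 * (norm a)\<^sup>2 + 2 * (norm b)\<^sup>2"
proof -
  have "(norm (a + b))\<^sup>2 \<le> (norm a + norm b)\<^sup>2"
    by (intro power_mono norm_triangle_ineq) auto
  also have "\<dots> \<le> 2 * (norm a)\<^sup>2 + 2 * (norm b)\<^sup>2"
    using sum_squares_bound[of "norm a" "norm b"] by (simp add: power2_sum)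
  finally show ?thesis .
qed

lemma L2_dist_triangle:
  assumes [measurable]: "f \<in> borel_measurable \<U>" "g \<in> borel_measurable \<U>" "h \<in> borel_measurable \<U>"
    and "0 \<le> x" "0 \<le> y"
    and 1: "(\<integral>\<^sup>+t. ennreal ((norm (f t - g t))\<^sup>2) \<partial>\<U>) \<le> ennreal x"
    and 2: "(\<integral>\<^sup>+t. ennreal ((norm (g t - h t :: complex))\<^sup>2) \<partial>\<U>) \<le> ennreal y"
  shows "(\<integral>\<^sup>+t. ennreal ((norm (f t - h t))\<^sup>2) \<partial>\<U>) \<le> ennreal (2 * x + 2 * y)"
proof -
  have "(\<integral>\<^sup>+t. ennreal ((norm (f t - h t))\<^sup>2) \<partial>\<U>)
     \<le> (\<integral>\<^sup>+t. 2 * ennreal ((norm (f t - g t))\<^sup>2) + 2 * ennreal ((norm (g t - h t))\<^sup>2) \<partial>\<U>)"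
  proof (rule nn_integral_mono)
    fix t
    have "ennreal ((norm (f t - h t))\<^sup>2) \<le> ennreal (2 * (norm (f t - g t))\<^sup>2 + 2 * (norm (g t - h t))\<^sup>2)"
      using norm_add_sq_le[of "f t - g t" "g t - h t"] by (intro ennreal_leI) simp
    then show "ennreal ((norm (f t - h t))\<^sup>2) \<le> 2 * ennreal ((norm (f t - g t))\<^sup>2) + 2 * ennreal ((norm (g t - h t))\<^sup>2)"
      by (simp add: ennreal_plus ennreal_mult)
  qed
  also have "\<dots> = 2 * (\<integral>\<^sup>+t. ennreal ((norm (f t - g t))\<^sup>2) \<partial>\<U>) + 2 * (\<integral>\<^sup>+t. ennreal ((norm (g t - h t))\<^sup>2) \<partial>\<U>)"
    by (simp add: nn_integral_add nn_integral_cmult)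
  also have "\<dots> \<le> 2 * ennreal x + 2 * ennreal y"
    by (intro add_mono mult_left_mono 1 2) auto
  also have "\<dots> = ennreal (2 * x + 2 * y)"
    using assms by (simp add: ennreal_plus ennreal_mult)
  finally show ?thesis .
qed

lemma L2_approximable_measurable: "L2_approximable f \<Longrightarrow> f \<in> borel_measurable \<U>"
  by (simp add: L2_approximable_def)

lemma L2_approximable_trig: "p \<in> trig_polys \<Longrightarrow> L2_approximable p"
  unfolding L2_approximable_def
proof (intro conjI allI impI)
  assume p: "p \<in> trig_polys"
  show "p \<in> borel_measurable \<U>" using p by (intro measurable_U trig_polys_measurable)
  fix e :: real
  show "\<exists>q\<in>trig_polys. (\<integral>\<^sup>+t. ennreal ((norm (p t - q t))\<^sup>2) \<partial>\<U>) \<le> ennreal e"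
    by (rule bexI[OF _ p]) simp
qed

lemma L2_approximable_close:
  assumes f: "f \<in> borel_measurable \<U>"
    and ex: "\<And>e. e > 0 \<Longrightarrow> \<exists>g. L2_approximable g \<and> (\<integral>\<^sup>+t. ennreal ((norm (f t - g t))\<^sup>2) \<partial>\<U>) \<le> ennreal e"
  shows "L2_approximable f"
  unfolding L2_approximable_def
proof (intro conjI f allI impI)
  fix e :: real assume e: "e > 0"
  obtain g where g: "L2_approximable g" "(\<integral>\<^sup>+t. ennreal ((norm (f t - g t))\<^sup>2) \<partial>\<U>) \<le> ennreal (e/4)"
    using ex[of "e/4"] e by auto
  obtain p where p: "p \<in> trig_polys" "(\<integral>\<^sup>+t. ennreal ((norm (g t - p t))\<^sup>2) \<partial>\<U>) \<le> ennreal (e/4)"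
    using g(1) e unfolding L2_approximable_def by (meson divide_pos_pos zero_less_numeral)
  have "(\<integral>\<^sup>+t. ennreal ((norm (f t - p t))\<^sup>2) \<partial>\<U>) \<le> ennreal (2 * (e/4) + 2 * (e/4))"
    using e f g p trig_polys_measurable[OF p(1)]
    by (intro L2_dist_triangle[of f g p]) (auto simp: L2_approximable_measurable measurable_U)
  then show "\<exists>p\<in>trig_polys. (\<integral>\<^sup>+t. ennreal ((norm (f t - p t))\<^sup>2) \<partial>\<U>) \<le> ennreal e"
    using p(1) by (intro bexI[of _ p]) auto
qed

lemma L2_approximable_add:
  assumes "L2_approximable f" "L2_approximable g"
  shows "L2_approximable (\<lambda>t. f t + g t)"
  unfolding L2_approximable_def
proof (intro conjI allI impI)
  note [measurable] = assms[THEN L2_approximable_measurable]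
  show "(\<lambda>t. f t + g t) \<in> borel_measurable \<U>" by measurable
  fix e :: real assume e: "e > 0"
  obtain p where p: "p \<in> trig_polys" "(\<integral>\<^sup>+t. ennreal ((norm (f t - p t))\<^sup>2) \<partial>\<U>) \<le> ennreal (e/4)"
    using assms e unfolding L2_approximable_def by (meson divide_pos_pos zero_less_numeral)
  obtain q where q: "q \<in> trig_polys" "(\<integral>\<^sup>+t. ennreal ((norm (g t - q t))\<^sup>2) \<partial>\<U>) \<le> ennreal (e/4)"
    using assms e unfolding L2_approximable_def by (meson divide_pos_pos zero_less_numeral)
  note [measurable] = p(1) q(1)
  have [measurable]: "p \<in> borel_measurable \<U>" "q \<in> borel_measurable \<U>"
    by (auto intro: measurable_U trig_polys_measurable p q)
  have "(\<integral>\<^sup>+t. ennreal ((norm ((f t + g t) - (p t + q t)))\<^sup>2) \<partial>\<U>) \<le> ennreal (2 * (e/4) + 2 * (e/4))"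
    using p q e by (intro L2_dist_triangle[where g="\<lambda>t. p t + g t"]) (auto simp: algebra_simps)
  then show "\<exists>p\<in>trig_polys. (\<integral>\<^sup>+t. ennreal ((norm ((f t + g t) - p t))\<^sup>2) \<partial>\<U>) \<le> ennreal e"
    using p(1) q(1) by (intro bexI[of _ "\<lambda>t. p t + q t"] trig_polys_add) auto
qed

lemma L2_approximable_cmult:
  assumes "L2_approximable f"
  shows "L2_approximable (\<lambda>t. c * f t)"
  unfolding L2_approximable_def
proof (intro conjI allI impI)
  note [measurable] = assms[THEN L2_approximable_measurable]
  show "(\<lambda>t. c * f t) \<in> borel_measurable \<U>" by measurable
  fix e :: real assume e: "e > 0"
  \<comment> \<open>The distance scales with |c|^2; adding 1 covers c = 0.\<close>
  define d where "d = e / ((norm c)\<^sup>2 + 1)"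
  have d: "d > 0" using e by (auto simp: d_def intro!: divide_pos_pos add_nonneg_pos)
  obtain p where p: "p \<in> trig_polys" "(\<integral>\<^sup>+t. ennreal ((norm (f t - p t))\<^sup>2) \<partial>\<U>) \<le> ennreal d"
    using assms d unfolding L2_approximable_def by meson
  have [measurable]: "p \<in> borel_measurable \<U>"
    by (auto intro: measurable_U trig_polys_measurable p)
  have "(\<integral>\<^sup>+t. ennreal ((norm (c * f t - c * p t))\<^sup>2) \<partial>\<U>) = (\<integral>\<^sup>+t. ennreal ((norm c)\<^sup>2) * ennreal ((norm (f t - p t))\<^sup>2) \<partial>\<U>)"
    by (intro nn_integral_cong) (simp add: ennreal_mult[symmetric] norm_mult power_mult_distrib flip: right_diff_distrib)
  also have "\<dots> = ennreal ((norm c)\<^sup>2) * (\<integral>\<^sup>+t. ennreal ((norm (f t - p t))\<^sup>2) \<partial>\<U>)"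
    by (simp add: nn_integral_cmult)
  also have "\<dots> \<le> ennreal ((norm c)\<^sup>2) * ennreal d"
    by (intro mult_left_mono p) auto
  also have "\<dots> = ennreal ((norm c)\<^sup>2 * d)"
    using d by (simp add: ennreal_mult)
  also have "\<dots> \<le> ennreal e"
    using e by (intro ennreal_leI) (simp add: d_def field_simps add_pos_nonneg)
  finally show "\<exists>p\<in>trig_polys. (\<integral>\<^sup>+t. ennreal ((norm (c * f t - p t))\<^sup>2) \<partial>\<U>) \<le> ennreal e"
    using p(1) by (intro bexI[of _ "\<lambda>t. c * p t"] trig_polys_cmult) auto
qed

lemma L2_approximable_sum:
  assumes "finite I" "\<And>i. i \<in> I \<Longrightarrow> L2_approximable (p i)"
  shows "L2_approximable (\<lambda>t. \<Sum>i\<in>I. p i t)"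
  using assms
  by (induction I rule: finite_induct)
     (auto intro: L2_approximable_add L2_approximable_trig[OF trig_polys_const])

text \<open>Closure under dominated pointwise limits is what makes the monotone class argument below work.\<close>

lemma L2_approximable_limit:
  fixes f :: "real \<Rightarrow> complex" and s :: "nat \<Rightarrow> real \<Rightarrow> complex"
  assumes s: "\<And>i. L2_approximable (s i)" and f[measurable]: "f \<in> borel_measurable \<U>"
    and lim: "\<And>t. t \<in> {0..<1} \<Longrightarrow> (\<lambda>i. s i t) \<longlonglongrightarrow> f t"
    and dom: "\<And>i t. t \<in> {0..<1} \<Longrightarrow> norm (s i t) \<le> w t"
    and w[measurable]: "w \<in> borel_measurable \<U>"
    and fin: "(\<integral>\<^sup>+t. ennreal ((w t)\<^sup>2) \<partial>\<U>) < \<infinity>"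
  shows "L2_approximable f"
proof (rule L2_approximable_close[OF f])
  fix e :: real assume e: "e > 0"
  have [measurable]: "s i \<in> borel_measurable \<U>" for i using s by (simp add: L2_approximable_measurable)
  have "(\<lambda>i. \<integral>\<^sup>+t. ennreal ((norm (f t - s i t))\<^sup>2) \<partial>\<U>) \<longlonglongrightarrow> (\<integral>\<^sup>+t. 0 \<partial>\<U>)"
  proof (rule nn_integral_dominated_convergence[where w = "\<lambda>t. 4 * ennreal ((w t)\<^sup>2)"])
    have "(\<integral>\<^sup>+t. 4 * ennreal ((w t)\<^sup>2) \<partial>\<U>) = 4 * (\<integral>\<^sup>+t. ennreal ((w t)\<^sup>2) \<partial>\<U>)"
      by (simp add: nn_integral_cmult)
    also have "\<dots> < \<infinity>" using fin by (simp add: ennreal_mult_less_top)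
    finally show "(\<integral>\<^sup>+t. 4 * ennreal ((w t)\<^sup>2) \<partial>\<U>) < \<infinity>" .
    fix j
    show "AE t in \<U>. ennreal ((norm (f t - s j t))\<^sup>2) \<le> 4 * ennreal ((w t)\<^sup>2)"
    proof (rule AE_I2)
      fix t assume "t \<in> space \<U>"
      then have t: "t \<in> {0..<1}" by simp
      have fw: "norm (f t) \<le> w t"
        by (rule LIMSEQ_le_const2[OF tendsto_norm[OF lim[OF t]]]) (use dom t in auto)
      have "norm (f t - s j t) \<le> 2 * w t"
        using fw dom[OF t, of j] norm_triangle_ineq4[of "f t" "s j t"] by linarith
      then have "(norm (f t - s j t))\<^sup>2 \<le> (2 * w t)\<^sup>2" by (intro power_mono) auto
      then have "ennreal ((norm (f t - s j t))\<^sup>2) \<le> ennreal (4 * (w t)\<^sup>2)"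
        by (intro ennreal_leI) (simp add: power_mult_distrib)
      then show "ennreal ((norm (f t - s j t))\<^sup>2) \<le> 4 * ennreal ((w t)\<^sup>2)"
        by (simp add: ennreal_mult)
    qed
  next
    show "AE t in \<U>. (\<lambda>i. ennreal ((norm (f t - s i t))\<^sup>2)) \<longlonglongrightarrow> 0"
    proof (rule AE_I2)
      fix t assume "t \<in> space \<U>"
      then have "(\<lambda>i. s i t) \<longlonglongrightarrow> f t" using lim by simp
      then have "(\<lambda>i. (norm (f t - s i t))\<^sup>2) \<longlonglongrightarrow> (norm (f t - f t))\<^sup>2"
        by (intro tendsto_intros)
      then show "(\<lambda>i. ennreal ((norm (f t - s i t))\<^sup>2)) \<longlonglongrightarrow> 0"
        using tendsto_ennrealI by fastforce
    qed
  qed auto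
  then have "\<forall>\<^sub>F i in sequentially. (\<integral>\<^sup>+t. ennreal ((norm (f t - s i t))\<^sup>2) \<partial>\<U>) < ennreal e"
    using e by (intro order_tendstoD(2)) auto
  then obtain i where "(\<integral>\<^sup>+t. ennreal ((norm (f t - s i t))\<^sup>2) \<partial>\<U>) < ennreal e"
    using eventually_happens by fastforce
  then show "\<exists>g. L2_approximable g \<and> (\<integral>\<^sup>+t. ennreal ((norm (f t - g t))\<^sup>2) \<partial>\<U>) \<le> ennreal e"
    using s by (intro exI[of _ "s i"]) auto
qed

lemma L2_approximable_continuous:
  fixes F :: "complex \<Rightarrow> complex"
  assumes "continuous_on UNIV F"
  shows "L2_approximable (\<lambda>t. F (character 1 t))"
  unfolding L2_approximable_def
proof (intro conjI allI impI)
  have "F \<in> borel_measurable borel" using assms by (rule borel_measurable_continuous_onI)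
  then show "(\<lambda>t. F (character 1 t)) \<in> borel_measurable \<U>"
    by (intro measurable_U measurable_compose[OF character_measurable])
  fix e :: real assume e: "e > 0"
  then obtain p where p: "p \<in> trig_polys" "\<And>t. norm (F (character 1 t) - p t) < sqrt e"
    using trig_polys_dense_continuous[OF assms, of "sqrt e"] by auto
  have "(\<integral>\<^sup>+t. ennreal ((norm (F (character 1 t) - p t))\<^sup>2) \<partial>\<U>) \<le> (\<integral>\<^sup>+t. ennreal e \<partial>\<U>)"
  proof (rule nn_integral_mono)
    fix t
    have "(norm (F (character 1 t) - p t))\<^sup>2 \<le> (sqrt e)\<^sup>2"
      using p(2)[of t] by (intro power_mono) auto
    then show "ennreal ((norm (F (character 1 t) - p t))\<^sup>2) \<le> ennreal e"
      using e by (intro ennreal_leI) simp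
  qed
  also have "\<dots> = ennreal e" 
    by (simp add: emeasure_restrict_space)
  finally show "\<exists>p\<in>trig_polys. (\<integral>\<^sup>+t. ennreal ((norm (F (character 1 t) - p t))\<^sup>2) \<partial>\<U>) \<le> ennreal e"
    using p(1) by blast
qed

text \<open>The indicator of an open set is the pointwise limit of the continuous functions min(1, m dist(z, -V)).
If V is the whole plane this distance is 0 by convention, hence the separate case.\<close>

lemma L2_approximable_open:
  fixes V :: "complex set"
  assumes "open V"
  shows "L2_approximable (\<lambda>t. indicator V (character 1 t))"
proof (cases "V = UNIV")
  case True
  then show ?thesis using L2_approximable_trig[OF trig_polys_const[of 1]] by simp
next
  case False
  define s where "s = (\<lambda>(m::nat) z. of_real (min 1 (real m * infdist z (- V))) :: complex)"
  show ?thesis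
  proof (rule L2_approximable_limit[where s = "\<lambda>m t. s m (character 1 t)" and w = "\<lambda>t. 1"])
    show "L2_approximable (\<lambda>t. s m (character 1 t))" for m
      unfolding s_def by (intro L2_approximable_continuous continuous_intros)
    have "(\<lambda>t. indicator V (character 1 t) :: complex) \<in> borel_measurable borel"
      using assms by (intro measurable_compose[OF character_measurable] borel_measurable_indicator) simp
    then show "(\<lambda>t. indicator V (character 1 t) :: complex) \<in> borel_measurable \<U>"
      by (rule measurable_U)
    fix t :: real
    let ?z = "character 1 t"
    show "(\<lambda>m. s m ?z) \<longlonglongrightarrow> indicator V ?z"
    proof (cases "?z \<in> V")
      case True
      have "infdist ?z (- V) \<noteq> 0"
        using True False assms in_closed_iff_infdist_zero[of "- V" ?z] by auto
      then have pos: "infdist ?z (- V) > 0" using infdist_nonneg[of ?z "- V"] by linarith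
      obtain N :: nat where N: "1 / infdist ?z (- V) < N" using reals_Archimedean2 by blast
      have "s m ?z = 1" if "m \<ge> N" for m
      proof -
        have "1 / infdist ?z (- V) \<le> m" using N that by linarith
        then have "1 \<le> real m * infdist ?z (- V)" using pos by (simp add: field_simps)
        then show ?thesis by (simp add: s_def)
      qed
      then have "\<forall>\<^sub>F m in sequentially. s m ?z = 1"
        using eventually_sequentially by blast
      then show ?thesis using True by (simp add: tendsto_eventually)
    next
      case z: False
      then have "infdist ?z (- V) = 0" by simp
      then show ?thesis using z by (simp add: s_def)
    qed
    show "norm (s m ?z) \<le> 1" for m
      by (simp add: s_def infdist_nonneg)
  qed (auto simp: emeasure_restrict_space)
qed

text \<open>The sets with approximable indicator form a Dynkin system containing the open sets.\<close>

lemma L2_approximable_borel_circle: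
  fixes A :: "complex set"
  assumes "A \<in> sets borel"
  shows "L2_approximable (\<lambda>t. indicator A (character 1 t))"
proof -
  have "Int_stable {S::complex set. open S}"
    by (auto simp: Int_stable_def)
  moreover have "{S::complex set. open S} \<subseteq> Pow UNIV" by simp
  moreover have "A \<in> sigma_sets UNIV {S. open S}"
    using assms by (simp add: sets_borel)
  ultimately show ?thesis
  proof (induction rule: sigma_sets_induct_disjoint)
    case (basic A)
    then show ?case using L2_approximable_open by blast
  next
    case empty
    then show ?case using L2_approximable_trig[OF trig_polys_const[of 0]] by simp
  next
    case (compl A)
    have "L2_approximable (\<lambda>t. 1 + (-1) * indicator A (character 1 t))"
      by (intro L2_approximable_add L2_approximable_cmult compl L2_approximable_trig trig_polys_const)
    moreover have "1 + (-1) * indicator A z = (indicator (UNIV - A) z :: complex)" for z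
      by (auto simp: indicator_def)
    ultimately show ?case by simp
  next
    case (union A)
    have A: "A i \<in> sets borel" for i using union by (auto simp: sets_borel)
    show ?case
    proof (rule L2_approximable_limit[where s = "\<lambda>n t. \<Sum>i<n. indicator (A i) (character 1 t)" and w = "\<lambda>t. 1"])
      show "L2_approximable (\<lambda>t. \<Sum>i<n. indicator (A i) (character 1 t))" for n
        by (intro L2_approximable_sum union) auto
      have "(\<lambda>t. indicator (\<Union>i. A i) (character 1 t) :: complex) \<in> borel_measurable borel"
        using A by (intro measurable_compose[OF character_measurable] borel_measurable_indicator) simp
      then show "(\<lambda>t. indicator (\<Union>i. A i) (character 1 t) :: complex) \<in> borel_measurable \<U>"
        by (rule measurable_U)
      fix t :: real
      let ?z = "character 1 t"
      have eq: "(\<Sum>i<n. indicator (A i) ?z) = (indicator (\<Union>i<n. A i) ?z :: complex)" for n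
        using union by (intro indicator_UN_disjoint[symmetric]) (auto simp: disjoint_family_on_def)
      show "norm (\<Sum>i<n. indicator (A i) ?z :: complex) \<le> 1" for n
        unfolding eq by (simp add: indicator_def)
      show "(\<lambda>n. \<Sum>i<n. indicator (A i) ?z :: complex) \<longlonglongrightarrow> indicator (\<Union>i. A i) ?z"
        unfolding eq by (rule LIMSEQ_indicator_UN)
    qed (auto simp: emeasure_restrict_space)
  qed
qed

lemma Arg2pi_measurable: "Arg2pi \<in> borel_measurable borel"
proof -
  have "closed (\<real>\<^sub>\<ge>\<^sub>0 :: complex set)" by (rule closed_nonneg_Reals_complex)
  then have "(\<lambda>z. indicator (- \<real>\<^sub>\<ge>\<^sub>0) z *\<^sub>R Arg2pi z) \<in> borel_measurable borel"
    by (intro borel_measurable_continuous_on_indicator continuous_at_imp_continuous_on)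
       (auto intro: continuous_at_Arg2pi)
  moreover have "(\<lambda>z. indicator (- \<real>\<^sub>\<ge>\<^sub>0) z *\<^sub>R Arg2pi z) = Arg2pi"
    by (auto simp: indicator_def fun_eq_iff Arg2pi_eq_0 complex_nonneg_Reals_iff complex_is_Real_iff)
  ultimately show ?thesis by simp
qed

lemma Arg2pi_character:
  assumes "t \<in> {0..<1}"
  shows "Arg2pi (character 1 t) = 2 * pi * t"
  by (rule Arg2pi_unique[of 1]) (use assms in \<open>auto simp: character_def cis_conv_exp mult_ac\<close>)

lemma L2_approximable_cong:
  assumes "L2_approximable f" "\<And>t. t \<in> {0..<1} \<Longrightarrow> f t = g t"
  shows "L2_approximable g"
proof -
  have "g \<in> borel_measurable \<U> \<longleftrightarrow> f \<in> borel_measurable \<U>"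
    by (intro measurable_cong) (use assms in auto)
  moreover have "(\<integral>\<^sup>+t. ennreal ((norm (f t - p t))\<^sup>2) \<partial>\<U>) = (\<integral>\<^sup>+t. ennreal ((norm (g t - p t))\<^sup>2) \<partial>\<U>)" for p
    by (intro nn_integral_cong) (use assms in auto)
  ultimately show ?thesis using assms(1) by (simp add: L2_approximable_def)
qed

text \<open>Away from its jump at the point 1 the argument identifies the circle with [0,1), and it is a Borel
function, so Borel subsets of [0,1) are pulled back from Borel subsets of the circle.\<close>

lemma L2_approximable_indicator:
  fixes B :: "real set"
  assumes "B \<in> sets borel"
  shows "L2_approximable (indicator B)"
proof -
  have "(\<lambda>z. Arg2pi z / (2 * pi)) \<in> borel_measurable borel"
    using Arg2pi_measurable by measurable
  then have "(\<lambda>z. Arg2pi z / (2 * pi)) -` B \<in> sets borel"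
    using assms by (metis measurable_sets_borel)
  then show ?thesis
    by (intro L2_approximable_cong[OF L2_approximable_borel_circle])
       (auto simp: indicator_def Arg2pi_character)
qed

proposition L2_approximable_square_integrable:
  assumes f: "f \<in> borel_measurable \<U>" and fin: "(\<integral>\<^sup>+t. ennreal ((norm (f t))\<^sup>2) \<partial>\<U>) < \<infinity>"
  shows "L2_approximable f"
proof -
  obtain F :: "nat \<Rightarrow> real \<Rightarrow> complex" where F: "\<And>i. simple_function \<U> (F i)"
     "\<And>x. x \<in> {0..<1} \<Longrightarrow> (\<lambda>i. F i x) \<longlonglongrightarrow> f x"
     "\<And>i x. x \<in> {0..<1} \<Longrightarrow> dist (F i x) 0 \<le> 2 * dist (f x) 0"
  proof -
    obtain F where "\<forall>i. simple_function \<U> (F i)" "\<forall>x\<in>space \<U>. (\<lambda>i. F i x) \<longlonglongrightarrow> f x"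
      "\<forall>i. \<forall>x\<in>space \<U>. dist (F i x) 0 \<le> 2 * dist (f x) 0"
      using borel_measurable_implies_sequence_metric[OF f, of 0] by blast
    then show ?thesis by (intro that[of F]) (simp_all only: U_space)
  qed
  note [measurable] = f
  show ?thesis
  proof (rule L2_approximable_limit[OF _ f F(2), where w = "\<lambda>t. 2 * norm (f t)"])
    fix i
    let ?I = "F i ` {0..<1}"
    have fin: "finite ?I" using simple_functionD(1)[OF F(1)[of i]] by simp
    have "F i -` {y} \<inter> {0..<1} \<in> sets borel" for y
      using simple_functionD(2)[OF F(1)[of i], of "{y}"] by (auto simp: sets_restrict_space)
    then have "L2_approximable (\<lambda>t. \<Sum>y\<in>?I. y * indicator (F i -` {y} \<inter> {0..<1}) t)"
      by (intro L2_approximable_sum L2_approximable_cmult L2_approximable_indicator fin)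
    moreover have "(\<Sum>y\<in>?I. y * indicator (F i -` {y} \<inter> {0..<1}) t) = F i t" if "t \<in> {0..<1}" for t
    proof -
      have "(\<Sum>y\<in>?I. y * indicator (F i -` {y} \<inter> {0..<1}) t) = (\<Sum>y\<in>?I. if y = F i t then F i t else 0)"
        using that by (intro sum.cong) (auto simp: indicator_def)
      then show ?thesis using fin that by (simp add: sum.delta)
    qed
    ultimately show "L2_approximable (F i)" by (rule L2_approximable_cong) auto
  next
    have "(\<integral>\<^sup>+t. ennreal ((2 * norm (f t))\<^sup>2) \<partial>\<U>) = (\<integral>\<^sup>+t. 4 * ennreal ((norm (f t))\<^sup>2) \<partial>\<U>)"
      by (intro nn_integral_cong) (simp add: power_mult_distrib ennreal_mult)
    also have "\<dots> = 4 * (\<integral>\<^sup>+t. ennreal ((norm (f t))\<^sup>2) \<partial>\<U>)" by (simp add: nn_integral_cmult)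
    also have "\<dots> < \<infinity>" using fin by (simp add: ennreal_mult_less_top)
    finally show "(\<integral>\<^sup>+t. ennreal ((2 * norm (f t))\<^sup>2) \<partial>\<U>) < \<infinity>" .
  qed (use F(3) in \<open>auto simp: dist_norm\<close>)
qed

definition fourier_coeff :: "(real \<Rightarrow> complex) \<Rightarrow> int \<Rightarrow> complex" where
  "fourier_coeff f n = (LINT t|\<U>. f t * character (- n) t)"

lemma square_integrable_U_imp_integrable:
  fixes f :: "real \<Rightarrow> complex"
  assumes [measurable]: "f \<in> borel_measurable \<U>" and "integrable \<U> (\<lambda>t. (norm (f t))\<^sup>2)"
  shows "integrable \<U> f"
proof (rule Bochner_Integration.integrable_bound)
  show "integrable \<U> (\<lambda>t. 1 + (norm (f t))\<^sup>2)"
    using assms by (intro Bochner_Integration.integrable_add U.integrable_const)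
  have "x \<le> 1 + x\<^sup>2" for x :: real
    using sum_squares_bound[of x 1] by (smt (verit) power2_eq_square mult_1 power_one zero_le_power2)
  then show "AE t in \<U>. norm (f t) \<le> norm (1 + (norm (f t))\<^sup>2)"
    by (intro AE_I2) (smt (verit) real_norm_def zero_le_power2)
qed simp

lemma integrable_mult_character:
  fixes f :: "real \<Rightarrow> complex"
  assumes f: "integrable \<U> f"
  shows "integrable \<U> (\<lambda>t. f t * character n t)"
proof (rule Bochner_Integration.integrable_bound[OF f])
  have [measurable]: "character n \<in> borel_measurable \<U>" by (rule measurable_U) simp
  show "(\<lambda>t. f t * character n t) \<in> borel_measurable \<U>"
    using borel_measurable_integrable[OF f] by measurable
qed (auto simp: norm_mult)

text \<open>Expanding the square, completed around the Fourier coefficients. With a equal to the coefficients this is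
Bessel's inequality; with an approximating polynomial it gives completeness.\<close>

lemma L2_dist_trig_poly:
  assumes fm[measurable]: "f \<in> borel_measurable \<U>" and f2: "integrable \<U> (\<lambda>t. (norm (f t))\<^sup>2)"
    and J: "finite J"
  shows "integrable \<U> (\<lambda>t. (norm (f t - trig_poly a J t))\<^sup>2)"
    and "(LINT t|\<U>. (norm (f t - trig_poly a J t))\<^sup>2) =
      (LINT t|\<U>. (norm (f t))\<^sup>2) - (\<Sum>n\<in>J. (norm (fourier_coeff f n))\<^sup>2) + (\<Sum>n\<in>J. (norm (fourier_coeff f n - a n))\<^sup>2)"
proof -
  let ?p = "trig_poly a J" and ?c = "fourier_coeff f"
  have fi: "integrable \<U> f" by (rule square_integrable_U_imp_integrable[OF fm f2])
  have expand: "of_real ((norm (f t - ?p t))\<^sup>2) =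
      of_real ((norm (f t))\<^sup>2) - (\<Sum>n\<in>J. cnj (a n) * (f t * character (-n) t))
      - cnj (\<Sum>n\<in>J. cnj (a n) * (f t * character (-n) t))
      + (\<Sum>n\<in>J. \<Sum>m\<in>J. a n * cnj (a m) * character (n - m) t)" for t
  proof -
    have cp: "cnj (?p t) = (\<Sum>n\<in>J. cnj (a n) * character (- n) t)"
      by (simp add: trig_poly_def cnj_character)
    have "f t * cnj (?p t) = (\<Sum>n\<in>J. cnj (a n) * (f t * character (-n) t))"
      unfolding cp by (simp add: sum_distrib_left mult_ac)
    moreover have "?p t * cnj (?p t) = (\<Sum>n\<in>J. \<Sum>m\<in>J. a n * cnj (a m) * character (n - m) t)"
      unfolding cp by (simp add: trig_poly_def sum_product character_add[of _ "- _", simplified] mult_ac)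
    moreover have "of_real ((norm (f t - ?p t))\<^sup>2) = of_real ((norm (f t))\<^sup>2) - f t * cnj (?p t) - cnj (f t * cnj (?p t)) + ?p t * cnj (?p t)"
      unfolding complex_norm_square by (simp add: algebra_simps)
    ultimately show ?thesis by simp
  qed
  have int1: "integrable \<U> (\<lambda>t. complex_of_real ((norm (f t))\<^sup>2))" using f2 by (rule integrable_of_real)
  have int2: "integrable \<U> (\<lambda>t. \<Sum>n\<in>J. cnj (a n) * (f t * character (-n) t))"
    by (intro Bochner_Integration.integrable_sum integrable_mult_right integrable_mult_character fi)
  have int3: "integrable \<U> (character n)" for n
    using integrable_mult_character[OF U.integrable_const[of "1::complex"], of n] by simp
  have int4: "integrable \<U> (\<lambda>t. \<Sum>n\<in>J. \<Sum>m\<in>J. a n * cnj (a m) * character (n - m) t)"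
    by (intro Bochner_Integration.integrable_sum integrable_mult_right int3)
  note int2' = integrable_cnj[OF int2]
  have "integrable \<U> (\<lambda>t. complex_of_real ((norm (f t - ?p t))\<^sup>2))"
    unfolding expand
    by (intro Bochner_Integration.integrable_add Bochner_Integration.integrable_diff int1 int2 int2' int4)
  from Bochner_Integration.integrable_Re[OF this] show "integrable \<U> (\<lambda>t. (norm (f t - ?p t))\<^sup>2)"
    unfolding Re_complex_of_real .
  have c: "(LINT t|\<U>. (\<Sum>n\<in>J. cnj (a n) * (f t * character (-n) t))) = (\<Sum>n\<in>J. cnj (a n) * ?c n)"
    by (simp add: fourier_coeff_def Bochner_Integration.integral_sum integrable_mult_character fi)
  have q: "(LINT t|\<U>. (\<Sum>n\<in>J. \<Sum>m\<in>J. a n * cnj (a m) * character (n - m) t)) = (\<Sum>n\<in>J. a n * cnj (a n))"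
  proof -
    have "(LINT t|\<U>. (\<Sum>n\<in>J. \<Sum>m\<in>J. a n * cnj (a m) * character (n - m) t))
       = (\<Sum>n\<in>J. \<Sum>m\<in>J. a n * cnj (a m) * (LINT t|\<U>. character (n - m) t))"
      by (simp add: Bochner_Integration.integral_sum int3)
    also have "\<dots> = (\<Sum>n\<in>J. \<Sum>m\<in>J. if m = n then a n * cnj (a n) else 0)"
      by (intro sum.cong refl) (auto simp: integral_character)
    finally show ?thesis using J by simp
  qed
  have "complex_of_real (LINT t|\<U>. (norm (f t - ?p t))\<^sup>2) = (LINT t|\<U>. complex_of_real ((norm (f t - ?p t))\<^sup>2))"
    by (rule integral_complex_of_real[symmetric])
  also have "\<dots> = (LINT t|\<U>. complex_of_real ((norm (f t))\<^sup>2)) - (\<Sum>n\<in>J. cnj (a n) * ?c n)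
      - cnj (\<Sum>n\<in>J. cnj (a n) * ?c n) + (\<Sum>n\<in>J. a n * cnj (a n))"
    unfolding expand c[symmetric] q[symmetric] Bochner_Integration.integral_cnj[symmetric]
    by (subst Bochner_Integration.integral_add Bochner_Integration.integral_diff;
        (intro Bochner_Integration.integrable_diff int1 int2 int2' int4)?)+ (simp only: Bochner_Integration.integral_cnj)
  also have "\<dots> = of_real ((LINT t|\<U>. (norm (f t))\<^sup>2) - (\<Sum>n\<in>J. (norm (?c n))\<^sup>2) + (\<Sum>n\<in>J. (norm (?c n - a n))\<^sup>2))"
  proof -
    have "of_real ((norm (?c n - a n))\<^sup>2) = of_real ((norm (?c n))\<^sup>2) - cnj (a n) * ?c n - cnj (cnj (a n) * ?c n) + a n * cnj (a n)" for n
      unfolding complex_norm_square by (simp add: algebra_simps)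
    then show ?thesis
      by (simp add: sum.distrib sum_subtractf integral_complex_of_real del: of_real_power)
  qed
  finally show "(LINT t|\<U>. (norm (f t - ?p t))\<^sup>2) =
      (LINT t|\<U>. (norm (f t))\<^sup>2) - (\<Sum>n\<in>J. (norm (?c n))\<^sup>2) + (\<Sum>n\<in>J. (norm (?c n - a n))\<^sup>2)"
    by (simp only: of_real_eq_iff)
qed

theorem parseval:
  assumes fm: "f \<in> borel_measurable \<U>" and f2: "integrable \<U> (\<lambda>t. (norm (f t))\<^sup>2)"
  shows "((\<lambda>n. (norm (fourier_coeff f n))\<^sup>2) has_sum (LINT t|\<U>. (norm (f t))\<^sup>2)) UNIV"
proof -
  let ?c = "fourier_coeff f" and ?S = "LINT t|\<U>. (norm (f t))\<^sup>2"
  have bessel: "(\<Sum>n\<in>J. (norm (?c n))\<^sup>2) \<le> ?S" if "finite J" for J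
  proof -
    have "0 \<le> (LINT t|\<U>. (norm (f t - trig_poly ?c J t))\<^sup>2)" by simp
    then show ?thesis using L2_dist_trig_poly(2)[OF fm f2 that, of ?c] by simp
  qed
  have sm: "(\<lambda>n. (norm (?c n))\<^sup>2) summable_on UNIV"
    by (rule nonneg_bdd_above_summable_on) (auto intro!: bdd_aboveI2[where M = ?S] bessel)
  have "(\<integral>\<^sup>+t. ennreal ((norm (f t))\<^sup>2) \<partial>\<U>) < \<infinity>"
    using f2 by (subst nn_integral_eq_integral) auto
  then have app: "L2_approximable f" by (rule L2_approximable_square_integrable[OF fm])
  have "?S \<le> infsum (\<lambda>n. (norm (?c n))\<^sup>2) UNIV + e" if e: "e > 0" for e
  proof -
    obtain p where p: "p \<in> trig_polys" "(\<integral>\<^sup>+t. ennreal ((norm (f t - p t))\<^sup>2) \<partial>\<U>) \<le> ennreal e"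
      using app e unfolding L2_approximable_def by blast
    obtain J a where J: "finite J" "p = trig_poly a J" using p(1) by (rule trig_polysE)
    have "(LINT t|\<U>. (norm (f t - trig_poly a J t))\<^sup>2) \<le> e"
      using p(2) e L2_dist_trig_poly(1)[OF fm f2 J(1), of a] unfolding J(2)
      by (subst (asm) nn_integral_eq_integral) auto
    moreover have "0 \<le> (\<Sum>n\<in>J. (norm (?c n - a n))\<^sup>2)" by (intro sum_nonneg) simp
    ultimately have "?S - (\<Sum>n\<in>J. (norm (?c n))\<^sup>2) \<le> e"
      unfolding L2_dist_trig_poly(2)[OF fm f2 J(1)] by linarith
    moreover have "(\<Sum>n\<in>J. (norm (?c n))\<^sup>2) \<le> infsum (\<lambda>n. (norm (?c n))\<^sup>2) UNIV"
      by (rule finite_sum_le_infsum[OF sm J(1)]) auto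
    ultimately show ?thesis by linarith
  qed
  then have "?S \<le> infsum (\<lambda>n. (norm (?c n))\<^sup>2) UNIV" by (rule field_le_epsilon)
  moreover have "infsum (\<lambda>n. (norm (?c n))\<^sup>2) UNIV \<le> ?S"
    by (rule infsum_le_finite_sums[OF sm]) (use bessel in auto)
  ultimately show ?thesis using sm has_sum_infsum by (metis antisym)
qed

section \<open>Separated sets and Schur's test\<close>

text \<open>A quantitative form of separatedness; the uniform constant s has to survive translation, reflection and
passage to subsets.\<close>

definition gap :: "real \<Rightarrow> real set \<Rightarrow> bool" where
  "gap s X \<longleftrightarrow> s > 0 \<and> (\<forall>x\<in>X. \<forall>y\<in>X. x \<noteq> y \<longrightarrow> s \<le> \<bar>x - y\<bar>)"

lemma gap_subset: "gap s X \<Longrightarrow> Y \<subseteq> X \<Longrightarrow> gap s Y"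
  unfolding gap_def by blast

lemma gap_Ints: "gap 1 \<int>"
  unfolding gap_def
proof (intro conjI ballI impI)
  fix x y :: real assume xy: "x \<in> \<int>" "y \<in> \<int>" "x \<noteq> y"
  then obtain m n :: int where "x = of_int m" "y = of_int n" "m \<noteq> n"
    by (auto elim!: Ints_cases)
  then show "1 \<le> \<bar>x - y\<bar>"
    using of_int_le_iff[of 1 "\<bar>m - n\<bar>", where 'a = real] by simp
qed simp

text \<open>Points of a separated set can be rounded to multiples of the gap without collisions. This reduces counting
and summation over such sets to the integers.\<close>

lemma gap_inj_floor:
  assumes "gap s X"
  shows "inj_on (\<lambda>x. \<lfloor>(x - y) / s\<rfloor>) X"
proof (rule inj_onI, rule ccontr)
  fix a b assume ab: "a \<in> X" "b \<in> X" "\<lfloor>(a - y) / s\<rfloor> = \<lfloor>(b - y) / s\<rfloor>" "a \<noteq> b"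
  have s: "s > 0" using assms by (simp add: gap_def)
  have "\<bar>(a - y) / s - (b - y) / s\<bar> < 1" using ab(3) by linarith
  moreover have "(a - y) / s - (b - y) / s = (a - b) / s" by (simp add: diff_divide_distrib)
  ultimately have "\<bar>a - b\<bar> < s" using s by (simp add: abs_divide field_simps)
  then show False using assms ab unfolding gap_def by force
qed

lemma gap_translate: "gap s X \<Longrightarrow> gap s ((\<lambda>l. a + l) ` X)"
  unfolding gap_def by auto

lemma gap_reflect: "gap s X \<Longrightarrow> gap s ((\<lambda>l. a - l) ` X)"
  unfolding gap_def by (auto simp: abs_minus_commute)

lemma separated_set_imp_gap:
  assumes "separated_set \<Lambda>"
  obtains s where "gap s \<Lambda>"
proof -
  let ?I = "INF p\<in>{(x, y). x \<in> \<Lambda> \<and> y \<in> \<Lambda> \<and> x \<noteq> y}. ereal \<bar>fst p - snd p\<bar>"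
  have "0 < ?I" using assms by (simp add: separated_set_def)
  then obtain s where s: "0 < ereal s" "ereal s < ?I"
    using ereal_dense2 by blast
  have "s \<le> \<bar>x - y\<bar>" if "x \<in> \<Lambda>" "y \<in> \<Lambda>" "x \<noteq> y" for x y
  proof -
    have "?I \<le> ereal \<bar>fst (x,y) - snd (x,y)\<bar>" using that by (intro INF_lower) auto
    from order_less_le_trans[OF s(2) this] have "ereal s < ereal \<bar>x - y\<bar>" by simp
    then show ?thesis by simp
  qed
  then show ?thesis using s(1) by (intro that[of s]) (auto simp: gap_def)
qed

lemma sum_exp_int_bound:
  fixes q :: real
  assumes q: "0 \<le> q" "q < 1" and "finite K"
  shows "(\<Sum>k\<in>K. q ^ nat \<bar>k\<bar>) \<le> 2 / (1 - q)"
proof -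
  let ?N = "Suc (nat (Max (insert 0 (abs ` K))))"
  have K: "nat \<bar>k\<bar> < ?N" if "k \<in> K" for k
  proof -
    have "\<bar>k\<bar> \<le> Max (insert 0 (abs ` K))" using assms that by (intro Max_ge) auto
    then show ?thesis by linarith
  qed
  have fib: "card {k\<in>K. nat \<bar>k\<bar> = n} \<le> 2" for n
  proof -
    have "{k\<in>K. nat \<bar>k\<bar> = n} \<subseteq> {int n, - int n}" by auto
    then show ?thesis
      by (rule order_trans[OF card_mono, rotated]) (auto simp: card_insert_le_m1)
  qed
  have "(\<Sum>k\<in>K. q ^ nat \<bar>k\<bar>) = (\<Sum>n<?N. \<Sum>k\<in>{k\<in>K. nat \<bar>k\<bar> = n}. q ^ nat \<bar>k\<bar>)"
    using K assms by (intro sum.group[symmetric]) auto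
  also have "\<dots> = (\<Sum>n<?N. real (card {k\<in>K. nat \<bar>k\<bar> = n}) * q ^ n)"
    by (intro sum.cong) auto
  also have "\<dots> \<le> (\<Sum>n<?N. 2 * q ^ n)"
  proof (intro sum_mono mult_right_mono)
    show "real (card {k\<in>K. nat \<bar>k\<bar> = n}) \<le> 2" for n using fib[of n] by linarith
  qed (use q in auto)
  also have "\<dots> = 2 * (\<Sum>n<?N. q ^ n)" by (simp add: sum_distrib_left)
  also have "\<dots> = 2 * ((1 - q ^ ?N) / (1 - q))"
    using q by (subst sum_gp_strict) auto
  also have "\<dots> \<le> 2 * (1 / (1 - q))"
    using q by (intro mult_left_mono divide_right_mono) auto
  finally show ?thesis by simp
qed

text \<open>A bound for the sum of exp(-d|x-y|) over the points x of any set with gap s, obtained from a two-sided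
geometric series. Only its independence of the set and of y matters.\<close>

definition tail_const :: "real \<Rightarrow> real \<Rightarrow> real" where
  "tail_const s d = exp (d * s) * (2 / (1 - exp (- d * s)))"

lemma tail_const_pos: "s > 0 \<Longrightarrow> d > 0 \<Longrightarrow> tail_const s d > 0"
  unfolding tail_const_def by (intro mult_pos_pos divide_pos_pos) auto

lemma gap_sum_exp:
  assumes X: "gap s X" "finite X" and d: "d > 0"
  shows "(\<Sum>x\<in>X. exp (- d * \<bar>x - y\<bar>)) \<le> tail_const s d"
proof -
  have s: "s > 0" using X by (simp add: gap_def)
  let ?h = "\<lambda>x. \<lfloor>(x - y) / s\<rfloor>"
  have inj: "inj_on ?h X" by (rule gap_inj_floor[OF X(1)])
  have summand: "exp (- d * \<bar>x - y\<bar>) \<le> exp (d * s) * exp (- d * s) ^ nat \<bar>?h x\<bar>" for x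
  proof -
    have "real (nat \<bar>?h x\<bar>) = real_of_int \<bar>?h x\<bar>" by simp
    also have "\<dots> \<le> \<bar>(x - y) / s\<bar> + 1" by linarith
    finally have "s * real (nat \<bar>?h x\<bar>) \<le> s * (\<bar>(x - y) / s\<bar> + 1)" using s by simp
    also have "\<dots> = \<bar>x - y\<bar> + s" using s by (simp add: abs_divide field_simps)
    finally have "d * (s * real (nat \<bar>?h x\<bar>)) \<le> d * (\<bar>x - y\<bar> + s)"
      using d by simp
    then show ?thesis
      by (simp add: exp_of_nat_mult[symmetric] exp_add[symmetric] algebra_simps)
  qed
  have "(\<Sum>x\<in>X. exp (- d * \<bar>x - y\<bar>)) \<le> (\<Sum>x\<in>X. exp (d * s) * exp (- d * s) ^ nat \<bar>?h x\<bar>)"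
    by (intro sum_mono summand)
  also have "\<dots> = exp (d * s) * (\<Sum>k\<in>?h ` X. exp (- d * s) ^ nat \<bar>k\<bar>)"
    by (simp add: sum.reindex[OF inj] sum_distrib_left)
  also have "\<dots> \<le> exp (d * s) * (2 / (1 - exp (- d * s)))"
    using X d s by (intro mult_left_mono sum_exp_int_bound) auto
  finally show ?thesis by (simp add: tail_const_def)
qed

lemma gap_sum_exp':
  assumes X: "gap s X" "finite X" and d: "d > 0"
  shows "(\<Sum>x\<in>X. exp (- d * \<bar>y - x\<bar>)) \<le> tail_const s d"
  using gap_sum_exp[OF assms, of y] by (simp add: abs_minus_commute)

text \<open>Split each weight into two square roots and apply the Cauchy-Schwarz inequality; summation over either
variable costs one uniform constant. The test is used for the upper frame bound, for tails of sampling sums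
and to absorb the error of the local sampling inequality.\<close>

lemma schur_test:
  fixes c :: "real \<Rightarrow> real"
  assumes X: "gap s X" "finite X" and Y: "gap t Y" "finite Y" and d: "d > 0"
  shows "(\<Sum>y\<in>Y. (\<Sum>x\<in>X. c x * exp (- d * \<bar>x - y\<bar>))\<^sup>2) \<le> tail_const s d * tail_const t d * (\<Sum>x\<in>X. (c x)\<^sup>2)"
proof -
  have cs: "(\<Sum>x\<in>X. c x * exp (- d * \<bar>x - y\<bar>))\<^sup>2 \<le> tail_const s d * (\<Sum>x\<in>X. (c x)\<^sup>2 * exp (- d * \<bar>x - y\<bar>))" for y
  proof -
    let ?e = "\<lambda>x. exp (- d * \<bar>x - y\<bar> / 2)"
    have e: "?e x * ?e x = exp (- d * \<bar>x - y\<bar>)" for x by (simp add: exp_add[symmetric])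
    have e2: "(?e x)\<^sup>2 = exp (- d * \<bar>x - y\<bar>)" for x by (simp only: power2_eq_square e)
    have "(\<Sum>x\<in>X. c x * exp (- d * \<bar>x - y\<bar>))\<^sup>2 = (\<Sum>x\<in>X. (c x * ?e x) * ?e x)\<^sup>2"
      by (simp only: e mult.assoc)
    also have "\<dots> \<le> (\<Sum>x\<in>X. (c x * ?e x)\<^sup>2) * (\<Sum>x\<in>X. (?e x)\<^sup>2)"
      by (rule Cauchy_Schwarz_ineq_sum)
    also have "\<dots> = (\<Sum>x\<in>X. (c x)\<^sup>2 * exp (- d * \<bar>x - y\<bar>)) * (\<Sum>x\<in>X. exp (- d * \<bar>x - y\<bar>))"
      by (simp only: power_mult_distrib e2)
    also have "\<dots> \<le> (\<Sum>x\<in>X. (c x)\<^sup>2 * exp (- d * \<bar>x - y\<bar>)) * tail_const s d"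
      by (intro mult_left_mono gap_sum_exp X d sum_nonneg) auto
    finally show ?thesis by (simp add: mult.commute)
  qed
  have tc: "tail_const s d \<ge> 0" using X d tail_const_pos[of s d] by (auto simp: gap_def)
  have "(\<Sum>y\<in>Y. (\<Sum>x\<in>X. c x * exp (- d * \<bar>x - y\<bar>))\<^sup>2) \<le> (\<Sum>y\<in>Y. tail_const s d * (\<Sum>x\<in>X. (c x)\<^sup>2 * exp (- d * \<bar>x - y\<bar>)))"
    by (intro sum_mono cs)
  also have "\<dots> = tail_const s d * (\<Sum>y\<in>Y. \<Sum>x\<in>X. (c x)\<^sup>2 * exp (- d * \<bar>x - y\<bar>))"
    by (simp add: sum_distrib_left)
  also have "(\<Sum>y\<in>Y. \<Sum>x\<in>X. (c x)\<^sup>2 * exp (- d * \<bar>x - y\<bar>)) = (\<Sum>x\<in>X. (c x)\<^sup>2 * (\<Sum>y\<in>Y. exp (- d * \<bar>x - y\<bar>)))"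
    by (subst sum.swap) (simp add: sum_distrib_left)
  also have "\<dots> \<le> (\<Sum>x\<in>X. (c x)\<^sup>2 * tail_const t d)"
    by (intro sum_mono mult_left_mono gap_sum_exp' Y d) auto
  also have "tail_const s d * (\<Sum>x\<in>X. (c x)\<^sup>2 * tail_const t d) = tail_const s d * tail_const t d * (\<Sum>x\<in>X. (c x)\<^sup>2)"
    by (simp add: sum_distrib_left mult_ac)
  finally show ?thesis using tc by (simp add: mult_left_mono)
qed

lemma gap_finite_Int:
  assumes "gap s X" "bounded B"
  shows "finite (X \<inter> B)"
proof (rule ccontr)
  assume inf: "infinite (X \<inter> B)"
  obtain R where R: "\<And>x. x \<in> B \<Longrightarrow> \<bar>x\<bar> \<le> R" using assms(2) by (auto simp: bounded_iff)
  obtain n :: nat where n: "tail_const s 1 * exp R < n" using reals_Archimedean2 by blast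
  obtain Y where Y: "Y \<subseteq> X \<inter> B" "finite Y" "card Y = n"
    using infinite_arbitrarily_large[OF inf] by blast
  have "n * exp (- R) = (\<Sum>x\<in>Y. exp (- R))" using Y by simp
  also have "\<dots> \<le> (\<Sum>x\<in>Y. exp (- 1 * \<bar>x - 0\<bar>))"
    using Y R by (intro sum_mono) auto
  also have "\<dots> \<le> tail_const s 1"
    using Y by (intro gap_sum_exp gap_subset[OF assms(1)]) auto
  finally have "n \<le> tail_const s 1 * exp R"
    by (simp add: exp_minus field_simps)
  then show False using n by linarith
qed

section \<open>Interpolation in an annulus\<close>

text \<open>Zeros at distinct points are removed one after the other by the removable singularity theorem.\<close>

lemma holomorphic_divide_zeros:
  assumes "finite X" "open U" "F holomorphic_on U" "\<And>x. x \<in> X \<Longrightarrow> F x = 0"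
  shows "\<exists>A. A holomorphic_on U \<and> (\<forall>w\<in>U. F w = A w * (\<Prod>x\<in>X. w - x))"
  using assms
proof (induction X arbitrary: F rule: finite_induct)
  case empty
  then show ?case by auto
next
  case (insert a X)
  \<comment> \<open>The difference quotient at a zero, completed by the derivative, removes that zero.\<close>
  define F1 where "F1 = (\<lambda>z. if z = a then deriv F a else (F z - F a) / (z - a))"
  have F1: "F1 holomorphic_on U" unfolding F1_def using insert.prems by (intro pole_lemma_open)
  have "F1 x = 0" if "x \<in> X" for x
    using insert.prems(3) insert.hyps(2) that by (auto simp: F1_def)
  then obtain A where A: "A holomorphic_on U" "\<forall>w\<in>U. F1 w = A w * (\<Prod>x\<in>X. w - x)"
    using insert.IH[OF insert.prems(1) F1] by blast
  have "F w = A w * (\<Prod>x\<in>insert a X. w - x)" if "w \<in> U" for w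
  proof -
    have "F w = (w - a) * F1 w" using insert.prems(3) by (auto simp: F1_def)
    then show ?thesis using A that insert.hyps by simp
  qed
  then show ?case using A(1) by blast
qed

definition lagrange_basis :: "complex set \<Rightarrow> complex \<Rightarrow> complex \<Rightarrow> complex" where
  "lagrange_basis X x w = (\<Prod>y\<in>X - {x}. (w - y) / (x - y))"

lemma lagrange_basis_at:
  assumes "finite X" "x \<in> X" "y \<in> X"
  shows "lagrange_basis X x y = (if x = y then 1 else 0)"
proof (cases "x = y")
  case True
  have "(\<Prod>z\<in>X - {x}. (x - z) / (x - z)) = 1" by (rule prod.neutral) auto
  then show ?thesis using True by (simp only: lagrange_basis_def) simp
next
  case False
  then show ?thesis using assms by (auto simp: lagrange_basis_def intro!: prod_zero bexI[of _ y])
qed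

lemma lagrange_basis_holomorphic: "lagrange_basis X x holomorphic_on S"
  unfolding lagrange_basis_def divide_inverse by (intro holomorphic_intros)

lemma annulus_frontier:
  fixes ra rb :: real
  assumes "z \<in> frontier {w::complex. ra \<le> norm w \<and> norm w \<le> rb}"
  shows "norm z = ra \<or> norm z = rb"
proof -
  let ?S = "{w::complex. ra \<le> norm w \<and> norm w \<le> rb}"
  have "closed ?S" by (intro closed_Collect_conj closed_Collect_le continuous_intros)
  then have z: "z \<in> ?S" "z \<notin> interior ?S" using assms by (auto simp: frontier_def)
  have "open {w::complex. ra < norm w \<and> norm w < rb}"
    by (intro open_Collect_conj open_Collect_less continuous_intros)
  then have "{w::complex. ra < norm w \<and> norm w < rb} \<subseteq> interior ?S"
    by (intro interior_maximal) auto
  then show ?thesis using z by force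
qed

text \<open>Subtracting the Lagrange interpolant makes F vanish at the nodes, so the node polynomial divides it
holomorphically, and the maximum principle applies to the quotient. The power w^p balances the two boundary
circles, on which the node polynomial has very different sizes; it does no harm at points of modulus at
least 1.\<close>

lemma annulus_interpolation_bound:
  fixes F :: "complex \<Rightarrow> complex" and X :: "complex set"
  assumes U: "open U" "F holomorphic_on U" and sub: "{w. ra \<le> norm w \<and> norm w \<le> rb} \<subseteq> U"
    and r: "0 < ra" and X: "finite X" "\<And>x. x \<in> X \<Longrightarrow> ra < norm x \<and> norm x < rb"
    and edge: "\<And>w. norm w = ra \<or> norm w = rb \<Longrightarrow> norm (F w) * norm w ^ p \<le> M * norm (\<Prod>x\<in>X. w - x)"
    and edge': "\<And>w. norm w = ra \<or> norm w = rb \<Longrightarrow> norm w ^ p \<le> M' * norm (\<Prod>x\<in>X. w - x)"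
    and lag: "\<And>w x. ra \<le> norm w \<Longrightarrow> norm w \<le> rb \<Longrightarrow> x \<in> X \<Longrightarrow> norm (lagrange_basis X x w) \<le> K"
    and w0: "1 \<le> norm w0" "ra \<le> norm w0" "norm w0 \<le> rb"
  shows "norm (F w0) \<le> norm (\<Prod>x\<in>X. w0 - x) * (M + M' * K * (\<Sum>x\<in>X. norm (F x))) + K * (\<Sum>x\<in>X. norm (F x))"
proof -
  let ?S = "{w::complex. ra \<le> norm w \<and> norm w \<le> rb}" and ?B = "\<lambda>w. \<Prod>x\<in>X. w - x"
  let ?s = "\<Sum>x\<in>X. norm (F x)"
  define I where "I = (\<lambda>w. \<Sum>x\<in>X. F x * lagrange_basis X x w)"
  have I: "I holomorphic_on U" unfolding I_def
    by (intro holomorphic_intros lagrange_basis_holomorphic)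
  have Ib: "norm (I w) \<le> K * ?s" if "w \<in> ?S" for w
  proof -
    have "norm (I w) \<le> (\<Sum>x\<in>X. norm (F x) * K)"
      unfolding I_def using lag that
      by (intro sum_norm_le) (auto simp: norm_mult intro!: mult_left_mono)
    then show ?thesis by (simp add: sum_distrib_left sum_distrib_right mult_ac)
  qed
  have "F x - I x = 0" if "x \<in> X" for x
  proof -
    have "I x = (\<Sum>y\<in>X. if y = x then F x else 0)"
      unfolding I_def using X that by (intro sum.cong) (auto simp: lagrange_basis_at)
    then show ?thesis using X that by simp
  qed
  then obtain A where A: "A holomorphic_on U" "\<And>w. w \<in> U \<Longrightarrow> F w - I w = A w * ?B w"
    using holomorphic_divide_zeros[of X U "\<lambda>w. F w - I w"] X U I
    by (metis (no_types, lifting) holomorphic_on_diff)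
  define C where "C = M + M' * K * ?s"
  \<comment> \<open>The maximum principle for the quotient A of F - I by the node polynomial, weighted by w^p.\<close>
  have "norm (A w0 * w0 ^ p) \<le> C"
  proof (rule maximum_modulus_frontier[where S = ?S and f = "\<lambda>w. A w * w ^ p"])
    have h: "(\<lambda>w. A w * w ^ p) holomorphic_on U" by (intro holomorphic_intros A)
    have cl: "closed ?S" by (intro closed_Collect_conj closed_Collect_le continuous_intros)
    show "(\<lambda>w. A w * w ^ p) holomorphic_on interior ?S"
      by (rule holomorphic_on_subset[OF h]) (use sub interior_subset in blast)
    show "continuous_on (closure ?S) (\<lambda>w. A w * w ^ p)"
      using cl sub by (intro holomorphic_on_imp_continuous_on holomorphic_on_subset[OF h]) auto
    show "bounded ?S" by (rule bounded_subset[of "cball 0 rb"]) auto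
    show "w0 \<in> ?S" using w0 by simp
    fix z assume "z \<in> frontier ?S"
    then have z: "norm z = ra \<or> norm z = rb" by (rule annulus_frontier)
    have zS: "z \<in> ?S" using z w0 by auto
    then have zU: "z \<in> U" using sub by blast
    have "z - x \<noteq> 0" if "x \<in> X" for x using X(2)[OF that] z by auto
    then have B0: "norm (?B z) > 0" using X by simp
    have "norm (A z * z ^ p) * norm (?B z) = norm (F z - I z) * norm z ^ p"
      using A(2)[OF zU] by (simp add: norm_mult norm_power mult_ac)
    also have "\<dots> \<le> (norm (F z) + K * ?s) * norm z ^ p"
      using norm_triangle_ineq4[of "F z" "I z"] Ib[OF zS] by (intro mult_right_mono) auto
    also have "\<dots> = norm (F z) * norm z ^ p + (K * ?s) * norm z ^ p" by (simp add: ring_distribs)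
    also have "\<dots> \<le> M * norm (?B z) + (K * ?s) * (M' * norm (?B z))"
      using Ib[OF zS] norm_ge_zero[of "I z"] by (intro add_mono mult_left_mono edge edge' z) linarith+
    also have "\<dots> = C * norm (?B z)" by (simp add: C_def ring_distribs mult_ac)
    finally show "norm (A z * z ^ p) \<le> C" using B0 by simp
  qed
  moreover have "norm (A w0) * 1 \<le> norm (A w0) * norm w0 ^ p"
    using w0 by (intro mult_left_mono) auto
  ultimately have "norm (A w0) \<le> C" by (simp add: norm_mult norm_power)
  then have "norm (F w0 - I w0) \<le> norm (?B w0) * C"
    using A(2)[of w0] sub w0 mult_right_mono[of "norm (A w0)" C "norm (?B w0)"]
    by (auto simp: norm_mult mult.commute)
  then show ?thesis
    using Ib[of w0] w0 norm_triangle_ineq[of "F w0 - I w0" "I w0"] by (simp add: C_def)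
qed

section \<open>Clearing the poles of a shift sum\<close>

definition shift_sum :: "(real \<Rightarrow> complex) \<Rightarrow> (int \<Rightarrow> complex) \<Rightarrow> int set \<Rightarrow> real \<Rightarrow> complex" where
  "shift_sum g c I x = (\<Sum>k\<in>I. c k * g (x - of_int k))"

text \<open>The common form of the generators. The polynomials enter only through growth estimates: Q has exact order q
on the positive half-line and outside a compact part of the punctured plane, which h measures on the
logarithmic scale, and P is small enough for g to decay exponentially. The bound on P is required on full
circles, since it is used on the boundary of an annulus. A is one constant for all estimates, chosen as an
exponent so that products of estimates become sums.\<close>

locale exp_rational =
  fixes \<alpha> \<beta> \<delta> A :: real and \<gamma> q h :: nat and P Q :: "complex poly" and g :: "real \<Rightarrow> complex"
  assumes alpha: "\<alpha> > 0" and delta: "\<delta> > 0"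
    and g_eq: "\<And>x. g x = of_real (exp (\<beta> * x - \<gamma> * \<alpha> * x\<^sup>2 / 2)) *
                    (poly P (of_real (exp (\<alpha> * x))) / poly Q (of_real (exp (\<alpha> * x))))"
    and P_upper: "\<And>u y. norm u = exp (\<alpha> * y) \<Longrightarrow>
        exp (\<beta> * y - \<gamma> * \<alpha> * y\<^sup>2 / 2) * norm (poly P u) \<le> exp (A + \<alpha> * q * max 0 y - \<delta> * \<bar>y\<bar>)"
    and Q_upper: "\<And>u y. norm u = exp (\<alpha> * y) \<Longrightarrow> norm (poly Q u) \<le> exp (A + \<alpha> * q * max 0 y)"
    and Q_lower: "\<And>y. exp (- A + \<alpha> * q * max 0 y) \<le> norm (poly Q (of_real (exp (\<alpha> * y))))"
    and Q_far: "\<And>u y. norm u = exp (\<alpha> * y) \<Longrightarrow> real h \<le> \<bar>y\<bar> \<Longrightarrow> exp (- A + \<alpha> * q * max 0 y) \<le> norm (poly Q u)"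
begin

definition wt :: "real \<Rightarrow> real" where "wt y = exp (\<beta> * y - \<gamma> * \<alpha> * y\<^sup>2 / 2)"

lemma wt_pos [simp]: "wt y > 0" by (simp add: wt_def)
lemma wt_nz [simp]: "wt y \<noteq> 0" using wt_pos[of y] by linarith

text \<open>A shifted Gaussian factor is the unshifted one times a function of w = e^(\<alpha>z): completing the square gives
wt(x-k) = wt(x) coef k w at w = e^(\<alpha>x).\<close>

definition coef :: "int \<Rightarrow> complex \<Rightarrow> complex" where
  "coef k w = of_real (exp (- \<beta> * k - \<gamma> * \<alpha> * (of_int k)\<^sup>2 / 2)) * w powi (int \<gamma> * k)"

definition shifted :: "int \<Rightarrow> complex \<Rightarrow> complex" where
  "shifted k w = w * of_real (exp (- \<alpha> * k))"

lemma norm_shifted: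
  fixes x :: real
  shows "norm w = exp (\<alpha> * x) \<Longrightarrow> norm (shifted k w) = exp (\<alpha> * (x - k))"
  by (simp add: shifted_def norm_mult exp_add[symmetric] algebra_simps)

lemma shifted_real:
  fixes x :: real
  shows "shifted k (of_real (exp (\<alpha> * x))) = of_real (exp (\<alpha> * (x - k)))"
  by (simp add: shifted_def algebra_simps flip: of_real_mult exp_add)

lemma wt_shift: "exp (- \<beta> * k - \<gamma> * \<alpha> * k\<^sup>2 / 2) * exp (real \<gamma> * k * (\<alpha> * x)) = wt (x - k) / wt x"
  unfolding wt_def exp_add[symmetric] exp_diff[symmetric]
  by (rule arg_cong[of _ _ exp]) (simp add: power2_eq_square field_simps)

lemma norm_coef:
  fixes x :: real
  shows "norm w = exp (\<alpha> * x) \<Longrightarrow> norm (coef k w) = wt (x - k) / wt x"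
  unfolding wt_shift[symmetric] coef_def by (simp add: norm_mult norm_power_int exp_power_int)

lemma coef_real:
  fixes x :: real
  shows "coef k (of_real (exp (\<alpha> * x))) = of_real (wt (x - k) / wt x)"
  unfolding wt_shift[symmetric] coef_def
  by (simp add: exp_power_int flip: of_real_power_int)

lemma Q_real_nz: "poly Q (of_real (exp (\<alpha> * y))) \<noteq> 0"
  using Q_lower[of y] by (metis exp_gt_zero norm_zero not_le)

lemma g_bound: "norm (g x) \<le> exp (2 * A) * exp (- \<delta> * \<bar>x\<bar>)"
proof -
  let ?u = "complex_of_real (exp (\<alpha> * x))"
  have "norm (g x) = wt x * norm (poly P ?u) / norm (poly Q ?u)"
    by (simp add: g_eq wt_def norm_mult norm_divide)
  also have "\<dots> \<le> exp (A + \<alpha> * q * max 0 x - \<delta> * \<bar>x\<bar>) / exp (- A + \<alpha> * q * max 0 x)"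
    unfolding wt_def by (intro frac_le P_upper Q_lower) auto
  also have "\<dots> = exp (2 * A) * exp (- \<delta> * \<bar>x\<bar>)"
    unfolding exp_add[symmetric] exp_diff[symmetric] by (rule arg_cong[of _ _ exp]) simp
  finally show ?thesis .
qed

lemma g_continuous: "continuous_on UNIV g"
  unfolding g_eq[abs_def] using Q_real_nz by (intro continuous_intros) auto


definition window :: "nat \<Rightarrow> int set" where "window V = {- int V..int V}"

lemma finite_window [simp]: "finite (window V)" by (simp add: window_def)
lemma card_window: "card (window V) = 2 * V + 1" by (simp add: window_def)

definition denom :: "nat \<Rightarrow> complex \<Rightarrow> complex" where
  "denom V w = (\<Prod>m\<in>window V. poly Q (shifted m w))"

text \<open>The k-th term of a shift sum times the common denominator. For k in the window the factor with poles in the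
annulus has been cancelled explicitly; for other k the quotient has no poles there.\<close>

definition numer_term :: "nat \<Rightarrow> int \<Rightarrow> complex \<Rightarrow> complex" where
  "numer_term V k w = coef k w * poly P (shifted k w) *
     (if k \<in> window V then \<Prod>m\<in>window V - {k}. poly Q (shifted m w)
      else denom V w / poly Q (shifted k w))"

definition numer :: "nat \<Rightarrow> (int \<Rightarrow> complex) \<Rightarrow> int set \<Rightarrow> complex \<Rightarrow> complex" where
  "numer V c I w = (\<Sum>k\<in>I. c k * numer_term V k w)"

text \<open>The logarithmic size of the common denominator at |w| = e^(\<alpha>x), in units of \<alpha>q.\<close>

definition load :: "nat \<Rightarrow> real \<Rightarrow> real" where
  "load V x = (\<Sum>m\<in>window V. max 0 (x - of_int m))"

lemma denom_upper:
  fixes x :: real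
  assumes "norm w = exp (\<alpha> * x)"
  shows "norm (denom V w) \<le> exp ((2 * real V + 1) * A + \<alpha> * q * load V x)"
proof -
  have "norm (denom V w) = (\<Prod>m\<in>window V. norm (poly Q (shifted m w)))"
    by (simp add: denom_def prod_norm)
  also have "\<dots> \<le> (\<Prod>m\<in>window V. exp (A + \<alpha> * q * max 0 (x - of_int m)))"
    by (intro prod_mono conjI norm_ge_zero Q_upper norm_shifted assms)
  also have "\<dots> = exp ((2 * real V + 1) * A + \<alpha> * q * load V x)"
    by (simp add: exp_sum[symmetric] sum.distrib load_def sum_distrib_left card_window algebra_simps)
  finally show ?thesis .
qed

lemma denom_lower:
  "exp (- (2 * real V + 1) * A + \<alpha> * q * load V x) \<le> norm (denom V (of_real (exp (\<alpha> * x))))"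
proof -
  have "exp (- (2 * real V + 1) * A + \<alpha> * q * load V x) = (\<Prod>m\<in>window V. exp (- A + \<alpha> * q * max 0 (x - of_int m)))"
    by (simp add: exp_sum[symmetric] sum.distrib sum_subtractf load_def sum_distrib_left card_window algebra_simps)
  also have "\<dots> \<le> (\<Prod>m\<in>window V. norm (poly Q (shifted m (of_real (exp (\<alpha> * x))))))"
    unfolding shifted_real by (intro prod_mono conjI Q_lower) auto
  finally show ?thesis by (simp only: denom_def prod_norm)
qed

text \<open>On the positive half-line the cleared shift sum is the shift sum itself times elementary factors.\<close>

lemma numer_real:
  fixes x :: real
  shows "numer V c I (of_real (exp (\<alpha> * x))) = denom V (of_real (exp (\<alpha> * x))) * shift_sum g c I x / of_real (wt x)"
proof -
  let ?w = "complex_of_real (exp (\<alpha> * x))"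
  have t: "numer_term V k ?w = denom V ?w * g (x - k) / of_real (wt x)" for k
  proof -
    have nz: "poly Q (shifted k ?w) \<noteq> 0" unfolding shifted_real by (rule Q_real_nz)
    have e: "(if k \<in> window V then \<Prod>m\<in>window V - {k}. poly Q (shifted m ?w)
      else denom V ?w / poly Q (shifted k ?w)) = denom V ?w / poly Q (shifted k ?w)"
      using nz by (auto simp: denom_def prod.remove[of "window V" k])
    have "g (x - k) = of_real (wt (x - k)) * (poly P (shifted k ?w) / poly Q (shifted k ?w))"
      by (simp only: g_eq wt_def shifted_real)
    then show ?thesis unfolding numer_term_def e coef_real by (simp add: field_simps)
  qed
  show ?thesis
    unfolding numer_def t shift_sum_def
    by (simp add: sum_distrib_left sum_divide_distrib mult_ac)
qed

text \<open>The exact order of Q makes both cases of the definition the same: a missing factor and a division by it cost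
the same exponent, and the bound on P turns it into the decay in |x-k|.\<close>

lemma norm_numer_term:
  fixes x :: real
  assumes w: "norm w = exp (\<alpha> * x)" and x: "\<bar>x\<bar> + h \<le> V + 1"
  shows "norm (numer_term V k w) \<le> exp ((2 * real V + 3) * A + \<alpha> * q * load V x) * exp (- \<delta> * \<bar>x - k\<bar>) / wt x"
proof -
  have A: "A \<ge> 0"
  proof -
    have "exp (- A + \<alpha> * q * max 0 0) \<le> exp (A + \<alpha> * q * max 0 0)"
      using order_trans[OF Q_lower[of 0] Q_upper[of "of_real (exp (\<alpha> * 0))" 0]] by simp
    then show ?thesis by simp
  qed
  have P: "norm (coef k w * poly P (shifted k w)) \<le> exp (A + \<alpha> * q * max 0 (x - k) - \<delta> * \<bar>x - k\<bar>) / wt x"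
  proof -
    have "norm (coef k w * poly P (shifted k w)) = wt (x - k) * norm (poly P (shifted k w)) / wt x"
      by (simp add: norm_mult norm_coef[OF w])
    also have "\<dots> \<le> exp (A + \<alpha> * q * max 0 (x - k) - \<delta> * \<bar>x - k\<bar>) / wt x"
      unfolding wt_def[of "x - k"]
      by (intro divide_right_mono P_upper norm_shifted w) (use wt_pos[of x] in linarith)
    finally show ?thesis .
  qed
  have R: "norm (if k \<in> window V then \<Prod>m\<in>window V - {k}. poly Q (shifted m w)
      else denom V w / poly Q (shifted k w)) \<le> exp ((2 * real V + 2) * A + \<alpha> * q * (load V x - max 0 (x - k)))"
  proof (cases "k \<in> window V")
    case True
    have "norm (\<Prod>m\<in>window V - {k}. poly Q (shifted m w)) = (\<Prod>m\<in>window V - {k}. norm (poly Q (shifted m w)))"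
      by (simp add: prod_norm)
    also have "\<dots> \<le> (\<Prod>m\<in>window V - {k}. exp (A + \<alpha> * q * max 0 (x - of_int m)))"
      by (intro prod_mono conjI norm_ge_zero Q_upper norm_shifted w)
    also have "\<dots> = exp ((2 * real V) * A + \<alpha> * q * (load V x - max 0 (x - k)))"
      using True by (simp add: exp_sum[symmetric] sum.distrib load_def sum_distrib_left card_window sum.remove[of "window V" k] algebra_simps)
    also have "\<dots> \<le> exp ((2 * real V + 2) * A + \<alpha> * q * (load V x - max 0 (x - k)))"
      using A by (simp add: algebra_simps)
    finally show ?thesis using True by simp
  next
    case False
    then have "int V + 1 \<le> \<bar>k\<bar>" by (auto simp: window_def)
    then have "real V + 1 \<le> \<bar>real_of_int k\<bar>" by linarith
    then have "real h \<le> \<bar>x - k\<bar>" using x by linarith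
    then have "exp (- A + \<alpha> * q * max 0 (x - k)) \<le> norm (poly Q (shifted k w))"
      by (intro Q_far norm_shifted w)
    then have "norm (denom V w) / norm (poly Q (shifted k w)) \<le> exp ((2 * real V + 1) * A + \<alpha> * q * load V x) / exp (- A + \<alpha> * q * max 0 (x - k))"
      by (intro frac_le denom_upper w) auto
    also have "\<dots> = exp ((2 * real V + 2) * A + \<alpha> * q * (load V x - max 0 (x - k)))"
      unfolding exp_diff[symmetric] by (rule arg_cong[of _ _ exp]) (simp add: algebra_simps)
    finally show ?thesis using False by (simp add: norm_divide)
  qed
  have "norm (numer_term V k w) \<le> exp (A + \<alpha> * q * max 0 (x - k) - \<delta> * \<bar>x - k\<bar>) / wt x * exp ((2 * real V + 2) * A + \<alpha> * q * (load V x - max 0 (x - k)))"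
    unfolding numer_term_def norm_mult[of "coef k w * poly P (shifted k w)"] by (intro mult_mono P R) (use wt_pos[of x] in \<open>auto intro: divide_nonneg_pos\<close>)
  also have "\<dots> = exp ((2 * real V + 3) * A + \<alpha> * q * load V x) * exp (- \<delta> * \<bar>x - k\<bar>) / wt x"
    unfolding times_divide_eq_left exp_add[symmetric]
    by (rule arg_cong[of _ _ "\<lambda>y. exp y / wt x"]) (simp add: algebra_simps)
  finally show ?thesis .
qed

lemma norm_numer:
  fixes x :: real
  assumes w: "norm w = exp (\<alpha> * x)" and x: "\<bar>x\<bar> + h \<le> V + 1"
  shows "norm (numer V c I w) \<le> exp ((2 * real V + 3) * A + \<alpha> * q * load V x) / wt x * (\<Sum>k\<in>I. norm (c k) * exp (- \<delta> * \<bar>x - k\<bar>))"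
proof -
  have "norm (numer V c I w) \<le> (\<Sum>k\<in>I. norm (c k) * (exp ((2 * real V + 3) * A + \<alpha> * q * load V x) * exp (- \<delta> * \<bar>x - k\<bar>) / wt x))"
    unfolding numer_def
  proof (rule sum_norm_le)
    fix k assume "k \<in> I"
    show "norm (c k * numer_term V k w) \<le> norm (c k) * (exp ((2 * real V + 3) * A + \<alpha> * q * load V x) * exp (- \<delta> * \<bar>x - k\<bar>) / wt x)"
      unfolding norm_mult by (intro mult_left_mono norm_numer_term w x) simp
  qed
  also have "\<dots> = exp ((2 * real V + 3) * A + \<alpha> * q * load V x) / wt x * (\<Sum>k\<in>I. norm (c k) * exp (- \<delta> * \<bar>x - k\<bar>))"
    unfolding sum_distrib_left by (intro sum.cong refl) simp
  finally show ?thesis .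
qed

lemma numer_holomorphic:
  fixes T :: real
  assumes T: "T + h \<le> real V + 1"
  shows "numer V c I holomorphic_on {w. exp (- \<alpha> * T) < norm w \<and> norm w < exp (\<alpha> * T)}"
proof -
  let ?U = "{w. exp (- \<alpha> * T) < norm w \<and> norm w < exp (\<alpha> * T)}"
  have U0: "w \<noteq> 0" if "w \<in> ?U" for w
    using that by (smt (verit) exp_gt_zero mem_Collect_eq norm_zero)
  have sh: "shifted k holomorphic_on ?U" for k unfolding shifted_def by (intro holomorphic_intros)
  have R: "(\<lambda>w. poly R (shifted k w)) holomorphic_on ?U" for k R by (intro holomorphic_intros sh)
  have D: "denom V holomorphic_on ?U" unfolding denom_def by (intro holomorphic_intros R)
  have "numer_term V k holomorphic_on ?U" for k
  proof -
    have C: "coef k holomorphic_on ?U" unfolding coef_def using U0 by (intro holomorphic_intros) auto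
    show ?thesis
    proof (cases "k \<in> window V")
      case True
      then have e: "numer_term V k = (\<lambda>w. coef k w * poly P (shifted k w) * (\<Prod>m\<in>window V - {k}. poly Q (shifted m w)))"
        by (simp add: numer_term_def fun_eq_iff)
      show ?thesis unfolding e by (intro holomorphic_intros C R)
    next
      case False
      have nz: "poly Q (shifted k w) \<noteq> 0" if w: "w \<in> ?U" for w
      proof -
        define x where "x = ln (norm w) / \<alpha>"
        have wx: "norm w = exp (\<alpha> * x)" using U0[OF w] alpha by (simp add: x_def)
        then have "exp (\<alpha> * (- T)) < exp (\<alpha> * x)" "exp (\<alpha> * x) < exp (\<alpha> * T)" using w by auto
        then have "- T < x" "x < T"
          using mult_less_cancel_left_pos[OF alpha, of "- T" x] mult_less_cancel_left_pos[OF alpha, of x T]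
          unfolding exp_less_cancel_iff by blast+
        then have "\<bar>x\<bar> < T" by linarith
        moreover have "int V + 1 \<le> \<bar>k\<bar>" using False by (auto simp: window_def)
        then have "real V + 1 \<le> \<bar>real_of_int k\<bar>" by linarith
        ultimately have "real h \<le> \<bar>x - k\<bar>" using T by linarith
        from Q_far[OF norm_shifted[OF wx] this] show ?thesis
          by (metis exp_gt_zero norm_zero not_le)
      qed
      have e: "numer_term V k = (\<lambda>w. coef k w * poly P (shifted k w) * (denom V w / poly Q (shifted k w)))"
        using False by (simp add: numer_term_def fun_eq_iff)
      show ?thesis unfolding e by (intro holomorphic_intros C R D nz)
    qed
  qed
  then show ?thesis unfolding numer_def by (intro holomorphic_intros)
qed

lemma sum_window_upper: "(\<Sum>m\<in>window V. real V - of_int m) = real V * (2 * real V + 1)"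
proof -
  have "(\<Sum>m\<in>window V. of_int m) = (\<Sum>m\<in>window V. - of_int m :: real)"
    by (rule sum.reindex_bij_witness[of _ uminus uminus]) (auto simp: window_def)
  then have "(\<Sum>m\<in>window V. real_of_int m) = 0" by (simp add: sum_negf)
  then show ?thesis by (simp add: sum_subtractf card_window)
qed

lemma load_right: "(x::real) \<le> real V \<Longrightarrow> load V x \<le> real V * (2 * real V + 1)"
  unfolding load_def sum_window_upper[symmetric]
  by (intro sum_mono) (auto simp: window_def)

lemma load_left: "load V (- (real V - real h)) \<le> (2 * real V + 1) * h"
proof -
  have "load V (- (real V - real h)) \<le> (\<Sum>m\<in>window V. real h)"
    unfolding load_def by (intro sum_mono) (auto simp: window_def)
  then show ?thesis by (simp add: card_window algebra_simps)
qed

lemma load_centre: "(x::real) \<ge> 0 \<Longrightarrow> real V * (real V + 1) / 2 \<le> load V x"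
proof -
  assume x: "x \<ge> 0"
  have "(\<Sum>i\<in>{0..V}. real i) = real V * (real V + 1) / 2"
    by (induction V) (auto simp: field_simps)
  moreover have "(\<Sum>i\<in>{0..V}. real i) = (\<Sum>m\<in>{- int V..0}. - of_int m)"
    by (rule sum.reindex_bij_witness[of _ "\<lambda>m. nat (- m)" "\<lambda>i. - int i"]) auto
  moreover have "(\<Sum>m\<in>{- int V..0}. - of_int m :: real) \<le> (\<Sum>m\<in>{- int V..0}. max 0 (x - of_int m))"
    using x by (intro sum_mono) auto
  moreover have "(\<Sum>m\<in>{- int V..0}. max 0 (x - of_int m)) \<le> load V x"
    unfolding load_def by (intro sum_mono2) (auto simp: window_def)
  ultimately show ?thesis by linarith
qed

end

section \<open>Interpolation nodes\<close>

lemma quadratic_exponent_small: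
  fixes a b c \<epsilon> :: real
  assumes "a > 0" "\<epsilon> > 0"
  shows "\<exists>N. \<forall>n::nat. n \<ge> N \<longrightarrow> exp (- a * (real n)\<^sup>2 + b * real n + c) \<le> \<epsilon>"
proof -
  define d where "d = \<bar>b\<bar> + \<bar>c\<bar> + \<bar>ln \<epsilon>\<bar>"
  obtain N0 :: nat where N0: "d / a < N0" using reals_Archimedean2 by blast
  show ?thesis
  proof (intro exI[of _ "Suc N0"] allI impI)
    fix n :: nat assume n: "Suc N0 \<le> n"
    have n1: "real n \<ge> 1" using n by simp
    have "d \<le> a * real n" using N0 n assms(1) by (simp add: field_simps)
      (smt (verit, best) mult_left_mono of_nat_mono Suc_leD)
    then have "d * real n \<le> a * real n * real n" using n1 by (intro mult_right_mono) auto
    moreover have "b * real n \<le> \<bar>b\<bar> * real n" using n1 by (intro mult_right_mono) auto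
    moreover have "\<bar>c\<bar> * 1 \<le> \<bar>c\<bar> * real n" "\<bar>ln \<epsilon>\<bar> * 1 \<le> \<bar>ln \<epsilon>\<bar> * real n" using n1 by (intro mult_left_mono; simp)+
    ultimately have "- a * (real n)\<^sup>2 + b * real n + c \<le> ln \<epsilon>"
      unfolding d_def by (simp add: power2_eq_square algebra_simps)
    then show "exp (- a * (real n)\<^sup>2 + b * real n + c) \<le> \<epsilon>"
      using assms(2) by (metis exp_le_cancel_iff exp_ln)
  qed
qed

lemma exp_separation:
  fixes a b \<alpha> N :: real
  assumes "\<alpha> > 0" "- N \<le> a" "- N \<le> b"
  shows "\<alpha> * exp (- \<alpha> * N) * \<bar>a - b\<bar> \<le> \<bar>exp (\<alpha> * a) - exp (\<alpha> * b)\<bar>"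
proof -
  have *: "\<alpha> * exp (- \<alpha> * N) * (y - x) \<le> exp (\<alpha> * y) - exp (\<alpha> * x)" if "- N \<le> x" "x \<le> y" for x y
  proof -
    have "exp (\<alpha> * - N) \<le> exp (\<alpha> * x)" using assms(1) that(1) by (subst exp_le_cancel_iff) (rule mult_left_mono, auto)
    then have "exp (- \<alpha> * N) * (\<alpha> * (y - x)) \<le> exp (\<alpha> * x) * (\<alpha> * (y - x))"
      using assms(1) that by (intro mult_right_mono) auto
    also have "\<dots> \<le> exp (\<alpha> * x) * (exp (\<alpha> * (y - x)) - 1)"
    proof (intro mult_left_mono)
      show "\<alpha> * (y - x) \<le> exp (\<alpha> * (y - x)) - 1" using exp_ge_add_one_self[of "\<alpha> * (y - x)"] by linarith
    qed simp
    also have "\<dots> = exp (\<alpha> * y) - exp (\<alpha> * x)" by (simp add: ring_distribs exp_add[symmetric])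
    finally show ?thesis by (simp add: mult_ac)
  qed
  show ?thesis using *[of a b] *[of b a] assms by (cases "a \<le> b") (auto simp: abs_real_def)
qed

text \<open>The sum of the left ends of the 2n unit blocks centred at 0, and of the positive parts of their right ends;
they bound the sums over the nodes that enter the size of the node polynomial.\<close>

lemma sum_blocks: "(\<Sum>b\<in>{- int n..<int n}. real_of_int b) = - real n"
  and sum_blocks_pos: "(\<Sum>b\<in>{- int n..<int n}. max 0 (real_of_int b + 1)) = real n * (real n + 1) / 2"
proof (induction n)
  case (Suc n)
  have e: "{- int (Suc n)..<int (Suc n)} = insert (- int n - 1) (insert (int n) {- int n..<int n})" by auto
  { case 1 then show ?case unfolding e using Suc(1) by simp }
  { case 2 then show ?case unfolding e using Suc(2) by (simp add: field_simps) }
qed auto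

text \<open>Exactly l nodes are taken from each of 2n consecutive blocks, which fixes the size of the node polynomial up
to exponents linear in n.\<close>

lemma select_nodes:
  fixes L n l :: nat
  assumes L: "L \<ge> 1" and l: "l \<ge> 1"
    and blocks: "\<And>a::real. l \<le> card (\<Gamma> \<inter> {a..a + (real L - 1)})"
  obtains X where "X \<subseteq> \<Gamma>" "finite X" "card X = 2 * n * l" "X \<subseteq> {- real (n * L)..real (n * L)}"
    "- real (l * n * L) \<le> \<Sum>X" "(\<Sum>x\<in>X. max 0 x) \<le> real (l * L) * (real n * (real n + 1) / 2)"
proof -
  let ?I = "{- int n..<int n}"
  have "\<exists>Y. Y \<subseteq> \<Gamma> \<inter> {of_int b * real L..of_int b * real L + (real L - 1)} \<and> card Y = l" for b :: int
    using obtain_subset_with_card_n[OF blocks[of "of_int b * real L"]] by metis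
  then obtain Y where Y: "\<And>b::int. Y b \<subseteq> \<Gamma> \<inter> {of_int b * real L..of_int b * real L + (real L - 1)}" "\<And>b. card (Y b) = l"
    by metis
  have fin: "finite (Y b)" for b using Y(2)[of b] l by (intro card_ge_0_finite) simp
  have Yb: "of_int b * real L \<le> x" "x \<le> of_int (b + 1) * real L - 1" if "x \<in> Y b" for x b
    using Y(1)[of b] that by (auto simp: algebra_simps)
  have Ym: "max 0 x \<le> max 0 (of_int b + 1) * real L" if "x \<in> Y b" for x b
  proof -
    have "x \<le> (of_int b + 1) * real L" using Yb(2)[OF that] by simp
    also have "\<dots> \<le> max 0 (of_int b + 1) * real L" by (intro mult_right_mono) auto
    finally show ?thesis by simp
  qed
  have disj: "Y b \<inter> Y b' = {}" if "b \<noteq> b'" for b b'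
  proof -
    have *: False if "x \<in> Y b" "x \<in> Y b'" "b < b'" for x b b'
    proof -
      have "of_int (b + 1) * real L \<le> of_int b' * real L" using that by (intro mult_right_mono) auto
      then show False using Yb(2)[OF that(1)] Yb(1)[OF that(2)] by linarith
    qed
    then show ?thesis using that by (metis disjoint_iff linorder_neqE)
  qed
  define X where "X = (\<Union>b\<in>?I. Y b)"
  have sumX: "(\<Sum>x\<in>X. f x) = (\<Sum>b\<in>?I. \<Sum>x\<in>Y b. f x)" for f :: "real \<Rightarrow> real"
    unfolding X_def using fin disj by (intro sum.UNION_disjoint) auto
  show ?thesis
  proof (rule that[of X])
    show "X \<subseteq> \<Gamma>" using Y(1) by (auto simp: X_def)
    show "finite X" using fin by (auto simp: X_def)
    have "card X = (\<Sum>b\<in>?I. card (Y b))"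
      unfolding X_def using fin disj by (intro card_UN_disjoint) auto
    then show "card X = 2 * n * l" by (simp add: Y nat_mult_distrib)
    show "X \<subseteq> {- real (n * L)..real (n * L)}"
    proof
      fix x assume "x \<in> X"
      then obtain b where b: "b \<in> ?I" "x \<in> Y b" by (auto simp: X_def)
      have "of_int (- int n) * real L \<le> of_int b * real L" using b by (intro mult_right_mono) (simp_all only: of_int_le_iff, auto)
      moreover have "of_int (b + 1) * real L \<le> of_int (int n) * real L" using b by (intro mult_right_mono) (simp_all only: of_int_le_iff, auto)
      ultimately show "x \<in> {- real (n * L)..real (n * L)}" using Yb[OF b(2)] by auto
    qed
    have "- real (l * n * L) = (\<Sum>b\<in>?I. real l * (of_int b * real L))"
      by (simp add: sum_distrib_left[symmetric] sum_distrib_right[symmetric] sum_blocks)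
    also have "\<dots> \<le> (\<Sum>b\<in>?I. \<Sum>x\<in>Y b. x)"
    proof (intro sum_mono)
      fix b
      have "(\<Sum>x\<in>Y b. of_int b * real L) \<le> (\<Sum>x\<in>Y b. x)" by (intro sum_mono Yb)
      then show "real l * (of_int b * real L) \<le> (\<Sum>x\<in>Y b. x)" using Y(2)[of b] by simp
    qed
    finally show "- real (l * n * L) \<le> \<Sum>X" using sumX[of "\<lambda>x. x"] by simp
    have "(\<Sum>x\<in>X. max 0 x) = (\<Sum>b\<in>?I. \<Sum>x\<in>Y b. max 0 x)" by (rule sumX)
    also have "\<dots> \<le> (\<Sum>b\<in>?I. real l * (max 0 (of_int b + 1) * real L))"
    proof (intro sum_mono)
      fix b
      have "(\<Sum>x\<in>Y b. max 0 x) \<le> (\<Sum>x\<in>Y b. max 0 (of_int b + 1) * real L)" by (intro sum_mono Ym)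
      then show "(\<Sum>x\<in>Y b. max 0 x) \<le> real l * (max 0 (of_int b + 1) * real L)" using Y(2)[of b] by simp
    qed
    also have "\<dots> = real (l * L) * (real n * (real n + 1) / 2)"
      by (simp add: sum_distrib_left[symmetric] sum_distrib_right[symmetric] sum_blocks_pos)
    finally show "(\<Sum>x\<in>X. max 0 x) \<le> real (l * L) * (real n * (real n + 1) / 2)" .
  qed
qed

text \<open>On the large circle every factor has the size of |w|. The nodes stay at logarithmic distance at least one
from the circle, which costs the constant \<kappa> for each factor; likewise for the small circle below.\<close>

lemma node_poly_outer:
  fixes X :: "real set" and \<alpha> \<kappa> :: real and w :: complex
  assumes a: "\<alpha> > 0" and \<kappa>: "exp (- \<kappa>) = 1 - exp (- \<alpha>)" and X: "finite X" "\<And>x. x \<in> X \<Longrightarrow> x \<le> T - 1"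
    and w: "norm w = exp (\<alpha> * T)"
  shows "exp (card X * (\<alpha> * T - \<kappa>)) \<le> norm (\<Prod>x\<in>X. w - of_real (exp (\<alpha> * x)))"
proof -
  have "exp (card X * (\<alpha> * T - \<kappa>)) = (\<Prod>x\<in>X. exp (\<alpha> * T - \<kappa>))"
    by (simp add: exp_of_nat_mult)
  also have "\<dots> \<le> (\<Prod>x\<in>X. norm (w - of_real (exp (\<alpha> * x))))"
  proof (intro prod_mono conjI)
    fix x assume x: "x \<in> X"
    have "exp (\<alpha> * T - \<kappa>) = exp (\<alpha> * T) * exp (- \<kappa>)" by (simp add: exp_diff exp_minus field_simps)
    also have "\<dots> = exp (\<alpha> * T) - exp (\<alpha> * (T - 1))" unfolding \<kappa> by (simp add: ring_distribs exp_add[symmetric])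
    also have "\<dots> \<le> exp (\<alpha> * T) - exp (\<alpha> * x)" using X(2)[OF x] a by simp
    also have "\<dots> \<le> norm (w - of_real (exp (\<alpha> * x)))"
      using norm_triangle_ineq2[of w "of_real (exp (\<alpha> * x))"] by (simp add: w)
    finally show "exp (\<alpha> * T - \<kappa>) \<le> norm (w - of_real (exp (\<alpha> * x)))" .
  qed simp
  finally show ?thesis by (simp add: prod_norm)
qed

lemma node_poly_inner:
  fixes X :: "real set" and \<alpha> \<kappa> :: real and w :: complex
  assumes a: "\<alpha> > 0" and \<kappa>: "exp (- \<kappa>) = 1 - exp (- \<alpha>)" and X: "finite X" "\<And>x. x \<in> X \<Longrightarrow> - T + 1 \<le> x"
    and w: "norm w = exp (\<alpha> * (- T))"
  shows "exp (\<alpha> * \<Sum>X - card X * \<kappa>) \<le> norm (\<Prod>x\<in>X. w - of_real (exp (\<alpha> * x)))"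
proof -
  have "exp (\<alpha> * \<Sum>X - card X * \<kappa>) = (\<Prod>x\<in>X. exp (\<alpha> * x - \<kappa>))"
    using X(1) by (simp add: exp_sum[symmetric] sum_subtractf sum_distrib_left)
  also have "\<dots> \<le> (\<Prod>x\<in>X. norm (w - of_real (exp (\<alpha> * x))))"
  proof (intro prod_mono conjI)
    fix x assume x: "x \<in> X"
    have "exp (\<alpha> * x - \<kappa>) = exp (\<alpha> * x) * exp (- \<kappa>)" by (simp add: exp_diff exp_minus field_simps)
    also have "\<dots> = exp (\<alpha> * x) - exp (\<alpha> * (x - 1))" unfolding \<kappa> by (simp add: ring_distribs exp_add[symmetric])
    also have "\<dots> \<le> exp (\<alpha> * x) - exp (\<alpha> * (- T))"
    proof -
      have "\<alpha> * (- T) \<le> \<alpha> * (x - 1)" using X(2)[OF x] a by (intro mult_left_mono) auto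
      then show ?thesis by simp
    qed
    also have "\<dots> \<le> norm (w - of_real (exp (\<alpha> * x)))"
      using norm_triangle_ineq2[of "of_real (exp (\<alpha> * x))" w] by (simp add: w norm_minus_commute)
    finally show "exp (\<alpha> * x - \<kappa>) \<le> norm (w - of_real (exp (\<alpha> * x)))" .
  qed simp
  finally show ?thesis by (simp add: prod_norm)
qed

lemma node_poly_centre:
  fixes X :: "real set" and \<alpha> :: real
  assumes a: "\<alpha> > 0" and X: "finite X" and x0: "0 \<le> x0" "x0 \<le> 1"
  shows "norm (\<Prod>x\<in>X. complex_of_real (exp (\<alpha> * x0)) - of_real (exp (\<alpha> * x))) \<le> exp (\<alpha> * (card X + (\<Sum>x\<in>X. max 0 x)))"
proof -
  have "(\<Prod>x\<in>X. norm (complex_of_real (exp (\<alpha> * x0)) - of_real (exp (\<alpha> * x)))) \<le> (\<Prod>x\<in>X. exp (\<alpha> * (1 + max 0 x)))"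
  proof (intro prod_mono conjI)
    fix x assume x: "x \<in> X"
    have "norm (complex_of_real (exp (\<alpha> * x0)) - of_real (exp (\<alpha> * x))) = \<bar>exp (\<alpha> * x0) - exp (\<alpha> * x)\<bar>"
      by (simp flip: of_real_diff)
    also have "\<dots> \<le> max (exp (\<alpha> * x0)) (exp (\<alpha> * x))"
      using exp_gt_zero[of "\<alpha> * x0"] exp_gt_zero[of "\<alpha> * x"] by linarith
    also have "\<dots> \<le> exp (\<alpha> * (1 + max 0 x))"
      using a x0 by (auto simp: intro!: mult_left_mono)
    finally show "norm (complex_of_real (exp (\<alpha> * x0)) - of_real (exp (\<alpha> * x))) \<le> exp (\<alpha> * (1 + max 0 x))" .
  qed simp
  also have "(\<Prod>x\<in>X. exp (\<alpha> * (1 + max 0 x))) = exp (\<alpha> * (card X + (\<Sum>x\<in>X. max 0 x)))"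
    using X by (simp add: exp_sum[symmetric] sum.distrib sum_distrib_left ring_distribs)
  finally show ?thesis by (simp add: prod_norm)
qed

lemma lagrange_basis_bound:
  assumes X: "finite X" and \<rho>: "\<rho> \<ge> 1" and b: "\<And>y. y \<in> X \<Longrightarrow> y \<noteq> x \<Longrightarrow> norm ((w - y) / (x - y)) \<le> \<rho>"
  shows "norm (lagrange_basis X x w) \<le> \<rho> ^ card X"
proof -
  have "norm (lagrange_basis X x w) = (\<Prod>y\<in>X - {x}. norm ((w - y) / (x - y)))"
    unfolding lagrange_basis_def by (rule prod_norm[symmetric])
  also have "\<dots> \<le> (\<Prod>y\<in>X - {x}. \<rho>)" using b by (intro prod_mono) auto
  also have "\<dots> = \<rho> ^ card (X - {x})" by simp
  also have "\<dots> \<le> \<rho> ^ card X" using X \<rho> by (intro power_increasing card_mono) auto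
  finally show ?thesis .
qed

section \<open>Balancing the exponents\<close>

context exp_rational
begin

definition kappa :: real where "kappa = - ln (1 - exp (- \<alpha>))"

lemma exp_kappa: "exp (- kappa) = 1 - exp (- \<alpha>)"
  using alpha by (simp add: kappa_def)

text \<open>These are the logarithms of the sizes that the maximum principle compares: of the cleared shift sum times the
balancing power divided by the node polynomial on the large and on the small circle, of the node polynomial in
the centre, and of the elementary factor over the common denominator in the centre. They are polynomials of
degree two in n with N = nL, boundary circles at logarithmic radius T = N + 1, window V = N + h + 1, balancing
power p = n(\<gamma>L+1) and l = (q+\<gamma>)L + 1 nodes per block.\<close>

definition outer_exponent :: "real \<Rightarrow> real \<Rightarrow> real" where
  "outer_exponent = (\<lambda>(L::real) (n::real). (2 * (n * L + h + 1) + 3) * A + \<alpha> * q * ((n * L + h + 1) * (2 * (n * L + h + 1) + 1))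
     + \<bar>\<beta>\<bar> * (n * L + 1) + \<gamma> * \<alpha> * (n * L + 1)\<^sup>2 / 2 + \<delta> * (n * L + 1)
     + \<alpha> * (n * L + 1) * (n * (\<gamma> * L + 1)) - 2 * n * ((q + \<gamma>) * L + 1) * (\<alpha> * (n * L + 1) - kappa))"

definition inner_exponent :: "real \<Rightarrow> real \<Rightarrow> real" where
  "inner_exponent = (\<lambda>(L::real) (n::real). (2 * (n * L + h + 1) + 3) * A + \<alpha> * q * ((2 * (n * L + h + 1) + 1) * h)
     + \<bar>\<beta>\<bar> * (n * L + 1) + \<gamma> * \<alpha> * (n * L + 1)\<^sup>2 / 2 + \<delta> * (n * L + 1)
     - \<alpha> * (n * L + 1) * (n * (\<gamma> * L + 1)) + \<alpha> * (((q + \<gamma>) * L + 1) * n * L) + 2 * n * ((q + \<gamma>) * L + 1) * kappa)"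

definition node_exponent :: "real \<Rightarrow> real \<Rightarrow> real" where
  "node_exponent = (\<lambda>(L::real) (n::real). \<alpha> * (2 * n * ((q + \<gamma>) * L + 1) + ((q + \<gamma>) * L + 1) * L * (n * (n + 1) / 2)))"

definition denom_exponent :: "real \<Rightarrow> real \<Rightarrow> real" where
  "denom_exponent = (\<lambda>(L::real) (n::real). \<bar>\<beta>\<bar> + (2 * (n * L + h + 1) + 1) * A - \<alpha> * q * ((n * L + h + 1) * (n * L + h + 1 + 1) / 2))"

text \<open>In both sums the contributions of q and \<gamma> to the coefficient of n^2 cancel, and the one surplus node per block
leaves -\<alpha>L/2. The lower coefficients are irrelevant, so they are read off from the values at 0 and 1 instead
of being computed.\<close>

lemma quadratic_as_interpolation:
  "outer_exponent L n + node_exponent L n + denom_exponent L n =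
     - (\<alpha> * L / 2) * n\<^sup>2 + (outer_exponent L 1 + node_exponent L 1 + denom_exponent L 1
        - (outer_exponent L 0 + node_exponent L 0 + denom_exponent L 0) + \<alpha> * L / 2) * n
     + (outer_exponent L 0 + node_exponent L 0 + denom_exponent L 0)"
  "inner_exponent L n + node_exponent L n + denom_exponent L n =
     - (\<alpha> * L / 2) * n\<^sup>2 + (inner_exponent L 1 + node_exponent L 1 + denom_exponent L 1
        - (inner_exponent L 0 + node_exponent L 0 + denom_exponent L 0) + \<alpha> * L / 2) * n
     + (inner_exponent L 0 + node_exponent L 0 + denom_exponent L 0)"
  unfolding outer_exponent_def inner_exponent_def node_exponent_def denom_exponent_def
  apply (simp_all only: power2_eq_square ring_distribs add_divide_distrib diff_divide_distrib
      mult_1_right mult_1_left mult_zero_left mult_zero_right)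
  apply (simp_all add: ring_distribs add_divide_distrib diff_divide_distrib mult_ac)
  done

lemma exponents_small:
  assumes "L > 0" "\<epsilon> > 0"
  shows "\<exists>n::nat. n \<ge> 1 \<and> exp (outer_exponent L n + node_exponent L n + denom_exponent L n) \<le> \<epsilon> \<and>
      exp (inner_exponent L n + node_exponent L n + denom_exponent L n) \<le> \<epsilon>"
proof -
  have a: "\<alpha> * L / 2 > 0" using assms alpha by simp
  obtain N1 :: nat where N1: "\<And>n::nat. n \<ge> N1 \<Longrightarrow> exp (outer_exponent L n + node_exponent L n + denom_exponent L n) \<le> \<epsilon>"
    unfolding quadratic_as_interpolation(1)[of L "real n" for n] using quadratic_exponent_small[OF a assms(2)] by blast
  obtain N2 :: nat where N2: "\<And>n::nat. n \<ge> N2 \<Longrightarrow> exp (inner_exponent L n + node_exponent L n + denom_exponent L n) \<le> \<epsilon>"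
    unfolding quadratic_as_interpolation(2)[of L "real n" for n] using quadratic_exponent_small[OF a assms(2)] by blast
  show ?thesis using N1[of "max 1 (max N1 N2)"] N2[of "max 1 (max N1 N2)"]
    by (intro exI[of _ "max 1 (max N1 N2)"]) auto
qed

lemma wt_nonneg [simp]: "0 \<le> wt x"
  using wt_pos[of x] by linarith

lemma wt_bounds:
  fixes x :: real
  shows "inverse (wt x) \<le> exp (\<bar>\<beta>\<bar> * \<bar>x\<bar> + \<gamma> * \<alpha> * x\<^sup>2 / 2)" and "wt x \<le> exp (\<bar>\<beta>\<bar> * \<bar>x\<bar>)"
proof -
  have "- (\<beta> * x) \<le> \<bar>\<beta>\<bar> * \<bar>x\<bar>" "\<beta> * x \<le> \<bar>\<beta>\<bar> * \<bar>x\<bar>" by (simp_all add: abs_mult[symmetric])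
  moreover have "0 \<le> \<gamma> * \<alpha> * x\<^sup>2 / 2" using alpha by simp
  ultimately show "inverse (wt x) \<le> exp (\<bar>\<beta>\<bar> * \<bar>x\<bar> + \<gamma> * \<alpha> * x\<^sup>2 / 2)" "wt x \<le> exp (\<bar>\<beta>\<bar> * \<bar>x\<bar>)"
    unfolding wt_def exp_minus[symmetric] exp_le_cancel_iff by linarith+
qed

text \<open>The interpolation bound in the annulus, translated back to shift sums. K is not controlled, but it depends only
on n, L and the gap of the nodes, not on the nodes or on the sequence.\<close>

lemma node_bound:
  fixes n L :: nat and s x0 :: real and c :: "int \<Rightarrow> complex"
  assumes n: "n \<ge> 1" and L: "L \<ge> 1" and s: "s > 0"
  shows "\<exists>K\<ge>0. \<forall>X c I x0. finite X \<longrightarrow> gap s X \<longrightarrow> card X = 2 * n * ((q + \<gamma>) * L + 1) \<longrightarrow>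
     X \<subseteq> {- real (n * L)..real (n * L)} \<longrightarrow> - real (((q + \<gamma>) * L + 1) * n * L) \<le> \<Sum>X \<longrightarrow>
     (\<Sum>x\<in>X. max 0 x) \<le> real (((q + \<gamma>) * L + 1) * L) * (real n * (real n + 1) / 2) \<longrightarrow>
     0 \<le> x0 \<longrightarrow> x0 \<le> 1 \<longrightarrow>
     norm (shift_sum g c I x0) \<le>
       exp (denom_exponent L n + node_exponent L n + max (outer_exponent L n) (inner_exponent L n)) * (\<Sum>k\<in>I. norm (c k) * exp (- \<delta> * \<bar>real_of_int k\<bar>))
       + K * (\<Sum>x\<in>X. norm (shift_sum g c I x))"
proof -
  define N where "N = real (n * L)"
  define T where "T = N + 1"
  define V where "V = n * L + h + 1"
  define p where "p = n * (\<gamma> * L + 1)"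
  define l where "l = (q + \<gamma>) * L + 1"
  define M where "M = exp (max (outer_exponent L n) (inner_exponent L n))"
  define M' where "M' = exp (\<alpha> * T * p + 2 * n * l * kappa + \<alpha> * l * N)"
  \<comment> \<open>\<eta> is a lower bound for the distance of two nodes, \<rho> one for all factors of the Lagrange basis from above.\<close>
  define \<eta> where "\<eta> = \<alpha> * exp (- \<alpha> * N) * s"
  define \<rho> where "\<rho> = 1 + 2 * exp (\<alpha> * T) / \<eta>"
  define K1 where "K1 = \<rho> ^ (2 * n * l)"
  define BB where "BB = exp (node_exponent L n)"
  define C0 where "C0 = exp (denom_exponent L n)"
  \<comment> \<open>K2 bounds the common denominator over wt at the nodes, where samples of the cleared sum are turned into samples of the shift sum.\<close>
  define K2 where "K2 = exp ((2 * real V + 1) * A + \<alpha> * q * ((2 * real V + 1) * (2 * real V))) * exp (\<bar>\<beta>\<bar> * N + \<gamma> * \<alpha> * N\<^sup>2 / 2)"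
  define K where "K = C0 * (BB * (M' * K1) + K1) * K2"
  have \<eta>: "\<eta> > 0" using alpha s by (simp add: \<eta>_def)
  have \<rho>: "\<rho> \<ge> 1" using \<eta> by (simp add: \<rho>_def)
  have K1: "K1 \<ge> 0" using \<rho> by (simp add: K1_def)
  have K: "K \<ge> 0" using K1 by (simp add: K_def C0_def BB_def M'_def K2_def)
  have N0: "N \<ge> 0" and T0: "T \<ge> 0" by (simp_all add: N_def T_def)
  show ?thesis
  proof (intro exI[of _ K] conjI K allI impI)
    fix X :: "real set" and c :: "int \<Rightarrow> complex" and I :: "int set" and x0 :: real
    assume fX: "finite X" and gX: "gap s X" and cX: "card X = 2 * n * ((q + \<gamma>) * L + 1)"
      and XN: "X \<subseteq> {- real (n * L)..real (n * L)}" and sX: "- real (((q + \<gamma>) * L + 1) * n * L) \<le> \<Sum>X"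
      and mX: "(\<Sum>x\<in>X. max 0 x) \<le> real (((q + \<gamma>) * L + 1) * L) * (real n * (real n + 1) / 2)"
      and x0: "0 \<le> x0" "x0 \<le> (1::real)"
    let ?S = "\<Sum>k\<in>I. norm (c k) * exp (- \<delta> * \<bar>real_of_int k\<bar>)"
    let ?e = "\<lambda>x. complex_of_real (exp (\<alpha> * x))"
    let ?F = "numer V c I"
    let ?Z = "?e ` X"
    have S0: "?S \<ge> 0" by (intro sum_nonneg) auto
    have inj: "inj_on ?e X" using alpha by (auto intro!: inj_onI)
    have BZ: "(\<Prod>z\<in>?Z. w - z) = (\<Prod>x\<in>X. w - ?e x)" for w by (simp add: prod.reindex[OF inj])
    have XN': "- N \<le> x" "x \<le> N" if "x \<in> X" for x using XN that by (auto simp: N_def)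
    have cXl: "card X = 2 * n * l" using cX by (simp add: l_def)
    \<comment> \<open>The common bound on both boundary circles; only the load distinguishes them.\<close>
    have Fbound: "norm (?F w) \<le> exp ((2 * real V + 3) * A + \<alpha> * q * load V x + \<bar>\<beta>\<bar> * T + \<gamma> * \<alpha> * T\<^sup>2 / 2 + \<delta> * T) * ?S"
      if w: "norm w = exp (\<alpha> * x)" and x: "\<bar>x\<bar> = T" for w x
    proof -
      have "norm (?F w) \<le> exp ((2 * real V + 3) * A + \<alpha> * q * load V x) / wt x * (\<Sum>k\<in>I. norm (c k) * exp (- \<delta> * \<bar>x - k\<bar>))"
        using x by (intro norm_numer w) (simp add: T_def N_def V_def)
      also have "\<dots> \<le> (exp ((2 * real V + 3) * A + \<alpha> * q * load V x) * exp (\<bar>\<beta>\<bar> * T + \<gamma> * \<alpha> * T\<^sup>2 / 2)) * (exp (\<delta> * T) * ?S)"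
      proof (intro mult_mono)
        have "inverse (wt x) \<le> exp (\<bar>\<beta>\<bar> * T + \<gamma> * \<alpha> * T\<^sup>2 / 2)"
          using wt_bounds(1)[of x] x by (metis power2_abs)
        then show "exp ((2 * real V + 3) * A + \<alpha> * q * load V x) / wt x \<le> exp ((2 * real V + 3) * A + \<alpha> * q * load V x) * exp (\<bar>\<beta>\<bar> * T + \<gamma> * \<alpha> * T\<^sup>2 / 2)"
          unfolding divide_inverse by (intro mult_left_mono) auto
        show "(\<Sum>k\<in>I. norm (c k) * exp (- \<delta> * \<bar>x - k\<bar>)) \<le> exp (\<delta> * T) * ?S"
          unfolding sum_distrib_left
        proof (intro sum_mono)
          fix k
          have "\<bar>real_of_int k\<bar> \<le> \<bar>x - k\<bar> + T" using x by linarith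
          then have "\<delta> * \<bar>real_of_int k\<bar> \<le> \<delta> * (\<bar>x - k\<bar> + T)" using delta by (intro mult_left_mono) auto
          then have "exp (- \<delta> * \<bar>x - k\<bar>) \<le> exp (\<delta> * T) * exp (- \<delta> * \<bar>real_of_int k\<bar>)"
            unfolding exp_add[symmetric] exp_le_cancel_iff by (simp add: algebra_simps)
          from mult_left_mono[OF this, of "norm (c k)"]
          show "norm (c k) * exp (- \<delta> * \<bar>x - k\<bar>) \<le> exp (\<delta> * T) * (norm (c k) * exp (- \<delta> * \<bar>real_of_int k\<bar>))"
            by (simp add: mult_ac)
        qed
        show "0 \<le> exp ((2 * real V + 3) * A + \<alpha> * q * load V x) * exp (\<bar>\<beta>\<bar> * T + \<gamma> * \<alpha> * T\<^sup>2 / 2)" by simp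
        show "0 \<le> (\<Sum>k\<in>I. norm (c k) * exp (- \<delta> * \<bar>x - k\<bar>))" by (intro sum_nonneg) simp
      qed
      also have "\<dots> = exp ((2 * real V + 3) * A + \<alpha> * q * load V x + \<bar>\<beta>\<bar> * T + \<gamma> * \<alpha> * T\<^sup>2 / 2 + \<delta> * T) * ?S"
        by (simp add: exp_add)
      finally show ?thesis .
    qed
    have rV: "real V = real n * real L + real h + 1" by (simp add: V_def)
    have rT: "T = real n * real L + 1" by (simp add: T_def N_def)
    have rp: "real p = real n * (real \<gamma> * real L + 1)" by (simp add: p_def ring_distribs)
    have rl: "real l = real (q + \<gamma>) * real L + 1" by (simp add: l_def ring_distribs)
    \<comment> \<open>inner_exponent and outer_exponent are by definition the differences of the exponents on the two sides.\<close>
    have inner: "exp ((2 * real V + 3) * A + \<alpha> * q * ((2 * real V + 1) * h) + \<bar>\<beta>\<bar> * T + \<gamma> * \<alpha> * T\<^sup>2 / 2 + \<delta> * T) * ?S * exp (- \<alpha> * T * p)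
        = (exp (inner_exponent L n) * exp (- \<alpha> * l * N - 2 * n * l * kappa)) * ?S"
    proof -
      have "(2 * real V + 3) * A + \<alpha> * q * ((2 * real V + 1) * h) + \<bar>\<beta>\<bar> * T + \<gamma> * \<alpha> * T\<^sup>2 / 2 + \<delta> * T + - \<alpha> * T * p
         = inner_exponent L n + (- \<alpha> * l * N - 2 * n * l * kappa)"
        unfolding inner_exponent_def rV[symmetric] rT[symmetric] rp[symmetric] rl[symmetric] by (simp add: N_def)
      then have e: "exp ((2 * real V + 3) * A + \<alpha> * q * ((2 * real V + 1) * h) + \<bar>\<beta>\<bar> * T + \<gamma> * \<alpha> * T\<^sup>2 / 2 + \<delta> * T) * exp (- \<alpha> * T * p)
         = exp (inner_exponent L n) * exp (- \<alpha> * l * N - 2 * n * l * kappa)"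
        unfolding exp_add[symmetric] by (rule arg_cong[of _ _ exp])
      have comm: "a * S * b = (a * b) * S" for a b S :: real by simp
      show ?thesis by (rule trans[OF comm]) (simp only: e)
    qed
    have outer: "exp ((2 * real V + 3) * A + \<alpha> * q * (real V * (2 * real V + 1)) + \<bar>\<beta>\<bar> * T + \<gamma> * \<alpha> * T\<^sup>2 / 2 + \<delta> * T) * ?S * exp (\<alpha> * T * p)
        = (exp (outer_exponent L n) * exp (2 * n * l * (\<alpha> * T - kappa))) * ?S"
    proof -
      have "(2 * real V + 3) * A + \<alpha> * q * (real V * (2 * real V + 1)) + \<bar>\<beta>\<bar> * T + \<gamma> * \<alpha> * T\<^sup>2 / 2 + \<delta> * T + \<alpha> * T * p
         = outer_exponent L n + 2 * n * l * (\<alpha> * T - kappa)"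
        unfolding outer_exponent_def rV[symmetric] rT[symmetric] rp[symmetric] rl[symmetric] by (simp add: rl)
      then have e: "exp ((2 * real V + 3) * A + \<alpha> * q * (real V * (2 * real V + 1)) + \<bar>\<beta>\<bar> * T + \<gamma> * \<alpha> * T\<^sup>2 / 2 + \<delta> * T) * exp (\<alpha> * T * p)
         = exp (outer_exponent L n) * exp (2 * n * l * (\<alpha> * T - kappa))"
        unfolding exp_add[symmetric] by (rule arg_cong[of _ _ exp])
      have comm: "a * S * b = (a * b) * S" for a b S :: real by simp
      show ?thesis by (rule trans[OF comm]) (simp only: e)
    qed
    have Bout: "exp (2 * n * l * (\<alpha> * T - kappa)) \<le> norm (\<Prod>z\<in>?Z. w - z)" if "norm w = exp (\<alpha> * T)" for w
      using node_poly_outer[OF alpha exp_kappa fX _ that] XN' by (simp add: BZ cXl T_def)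
    have Bin: "exp (- \<alpha> * l * N - 2 * n * l * kappa) \<le> norm (\<Prod>z\<in>?Z. w - z)" if "norm w = exp (\<alpha> * (- T))" for w
    proof -
      have "- (real l * N) \<le> \<Sum>X" using sX by (simp only: l_def N_def of_nat_mult mult.assoc)
      then have "\<alpha> * - (real l * N) \<le> \<alpha> * \<Sum>X" using alpha by (intro mult_left_mono) auto
      then have "exp (- \<alpha> * l * N - 2 * n * l * kappa) \<le> exp (\<alpha> * \<Sum>X - card X * kappa)"
        unfolding cXl exp_le_cancel_iff by (simp add: mult_ac)
      also have "\<dots> \<le> norm (\<Prod>z\<in>?Z. w - z)"
        using node_poly_inner[OF alpha exp_kappa fX _ that] XN' by (simp add: BZ T_def)
      finally show ?thesis .
    qed
    have dir: "norm w = exp (\<alpha> * (- T)) \<Longrightarrow> norm w ^ p = exp (- \<alpha> * T * p)"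
       "norm w = exp (\<alpha> * T) \<Longrightarrow> norm w ^ p = exp (\<alpha> * T * p)" for w :: complex
      by (simp_all add: exp_of_nat2_mult[symmetric])
    have main: "norm (?F (?e x0)) \<le> norm (\<Prod>z\<in>?Z. ?e x0 - z) * (M * ?S + M' * K1 * (\<Sum>z\<in>?Z. norm (?F z))) + K1 * (\<Sum>z\<in>?Z. norm (?F z))"
    proof (rule annulus_interpolation_bound[where ra = "exp (\<alpha> * (- T))" and rb = "exp (\<alpha> * T)" and p = p
             and U = "{w. exp (- \<alpha> * (T + 1)) < norm w \<and> norm w < exp (\<alpha> * (T + 1))}"])
      show "open {w::complex. exp (- \<alpha> * (T + 1)) < norm w \<and> norm w < exp (\<alpha> * (T + 1))}"
        by (intro open_Collect_conj open_Collect_less continuous_intros)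
      show "?F holomorphic_on {w. exp (- \<alpha> * (T + 1)) < norm w \<and> norm w < exp (\<alpha> * (T + 1))}"
        by (intro numer_holomorphic) (simp add: T_def N_def V_def)
      have lt: "exp (- \<alpha> * (T + 1)) < exp (\<alpha> * (- T))" "exp (\<alpha> * T) < exp (\<alpha> * (T + 1))"
        using alpha by (auto simp: algebra_simps)
      show "{w. exp (\<alpha> * - T) \<le> cmod w \<and> cmod w \<le> exp (\<alpha> * T)} \<subseteq> {w. exp (- \<alpha> * (T + 1)) < cmod w \<and> cmod w < exp (\<alpha> * (T + 1))}"
        using lt by (blast intro: less_le_trans le_less_trans)
      show "0 < exp (\<alpha> * - T)" by simp
      show "finite ?Z" using fX by simp
      show "exp (\<alpha> * - T) < norm z \<and> norm z < exp (\<alpha> * T)" if z: "z \<in> ?Z" for z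
      proof -
        obtain x where x: "x \<in> X" "z = ?e x" using z by blast
        then have "- T < x" "x < T" using XN' by (fastforce simp: T_def)+
        then have "\<alpha> * - T < \<alpha> * x" "\<alpha> * x < \<alpha> * T" using mult_strict_left_mono[OF _ alpha] by blast+
        then show ?thesis using x by simp
      qed
      show "norm (?F w) * norm w ^ p \<le> (M * ?S) * norm (\<Prod>z\<in>?Z. w - z)"
        if "norm w = exp (\<alpha> * - T) \<or> norm w = exp (\<alpha> * T)" for w
        using that
      proof
        assume w: "norm w = exp (\<alpha> * - T)"
        have ld: "load V (- T) \<le> (2 * real V + 1) * h"
        proof -
          have "- T = - (real V - real h)" by (simp add: T_def N_def V_def)
          then show ?thesis using load_left[of V] by (simp only:)
        qed
        have "norm (?F w) * norm w ^ p \<le> (exp ((2 * real V + 3) * A + \<alpha> * q * load V (- T) + \<bar>\<beta>\<bar> * T + \<gamma> * \<alpha> * T\<^sup>2 / 2 + \<delta> * T) * ?S) * exp (- \<alpha> * T * p)"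
          unfolding dir(1)[OF w] using T0 by (intro mult_right_mono Fbound w) auto
        also have "\<dots> \<le> (exp ((2 * real V + 3) * A + \<alpha> * q * ((2 * real V + 1) * h) + \<bar>\<beta>\<bar> * T + \<gamma> * \<alpha> * T\<^sup>2 / 2 + \<delta> * T) * ?S) * exp (- \<alpha> * T * p)"
          using alpha S0 ld by (intro mult_right_mono) (auto intro!: mult_left_mono)
        also have "\<dots> = (exp (inner_exponent L n) * exp (- \<alpha> * l * N - 2 * n * l * kappa)) * ?S"
          by (rule inner)
        also have "\<dots> \<le> (M * norm (\<Prod>z\<in>?Z. w - z)) * ?S"
          using S0 by (intro mult_right_mono mult_mono Bin w) (auto simp: M_def)
        finally show ?thesis by (simp add: mult_ac)
      next
        assume w: "norm w = exp (\<alpha> * T)"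
        have ld: "load V T \<le> real V * (2 * real V + 1)"
          by (rule load_right) (simp add: T_def N_def V_def)
        have "norm (?F w) * norm w ^ p \<le> (exp ((2 * real V + 3) * A + \<alpha> * q * load V T + \<bar>\<beta>\<bar> * T + \<gamma> * \<alpha> * T\<^sup>2 / 2 + \<delta> * T) * ?S) * exp (\<alpha> * T * p)"
          unfolding dir(2)[OF w] using T0 by (intro mult_right_mono Fbound w) auto
        also have "\<dots> \<le> (exp ((2 * real V + 3) * A + \<alpha> * q * (real V * (2 * real V + 1)) + \<bar>\<beta>\<bar> * T + \<gamma> * \<alpha> * T\<^sup>2 / 2 + \<delta> * T) * ?S) * exp (\<alpha> * T * p)"
          using alpha S0 ld by (intro mult_right_mono) (auto intro!: mult_left_mono)
        also have "\<dots> = (exp (outer_exponent L n) * exp (2 * n * l * (\<alpha> * T - kappa))) * ?S"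
          by (rule outer)
        also have "\<dots> \<le> (M * norm (\<Prod>z\<in>?Z. w - z)) * ?S"
          using S0 by (intro mult_right_mono mult_mono Bout w) (auto simp: M_def)
        finally show ?thesis by (simp add: mult_ac)
      qed
      show "norm w ^ p \<le> M' * norm (\<Prod>z\<in>?Z. w - z)"
        if "norm w = exp (\<alpha> * - T) \<or> norm w = exp (\<alpha> * T)" for w
        using that
      proof
        assume w: "norm w = exp (\<alpha> * - T)"
        have "norm w ^ p \<le> M' * exp (- \<alpha> * l * N - 2 * n * l * kappa)"
          unfolding dir(1)[OF w] M'_def exp_add[symmetric] exp_le_cancel_iff
          using alpha T0 by (simp add: mult_nonneg_nonneg)
        also have "\<dots> \<le> M' * norm (\<Prod>z\<in>?Z. w - z)"
          using Bin[OF w] by (intro mult_left_mono) (auto simp: M'_def)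
        finally show ?thesis .
      next
        assume w: "norm w = exp (\<alpha> * T)"
        have "0 \<le> 2 * n * l * (\<alpha> * T) + \<alpha> * l * N" using alpha T0 N0 by (intro add_nonneg_nonneg mult_nonneg_nonneg) auto
        then have "norm w ^ p \<le> M' * exp (2 * n * l * (\<alpha> * T - kappa))"
          unfolding dir(2)[OF w] M'_def exp_add[symmetric] exp_le_cancel_iff by (simp add: algebra_simps)
        also have "\<dots> \<le> M' * norm (\<Prod>z\<in>?Z. w - z)"
          using Bout[OF w] by (intro mult_left_mono) (auto simp: M'_def)
        finally show ?thesis .
      qed
      show "norm (lagrange_basis ?Z z w) \<le> K1"
        if w: "exp (\<alpha> * - T) \<le> norm w" "norm w \<le> exp (\<alpha> * T)" and z: "z \<in> ?Z" for w z
      proof -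
        have "norm (lagrange_basis ?Z z w) \<le> \<rho> ^ card ?Z"
        proof (rule lagrange_basis_bound[OF _ \<rho>])
          show "finite ?Z" using fX by simp
          fix y assume y: "y \<in> ?Z" "y \<noteq> z"
          obtain a b where ab: "a \<in> X" "b \<in> X" "z = ?e a" "y = ?e b" "a \<noteq> b" using y z by blast
          have "\<eta> \<le> \<alpha> * exp (- \<alpha> * N) * \<bar>a - b\<bar>"
            unfolding \<eta>_def using gX ab alpha by (intro mult_left_mono) (auto simp: gap_def)
          also have "\<dots> \<le> \<bar>exp (\<alpha> * a) - exp (\<alpha> * b)\<bar>"
            using XN' ab by (intro exp_separation alpha) auto
          also have "\<dots> = norm (z - y)" unfolding ab by (simp flip: of_real_diff)
          finally have zy: "\<eta> \<le> norm (z - y)" .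
          have "norm y \<le> exp (\<alpha> * T)" using XN'(2)[OF ab(2)] alpha ab by (simp add: T_def)
          then have "norm (w - y) \<le> 2 * exp (\<alpha> * T)" using w norm_triangle_ineq4[of w y] by linarith
          then have "norm (w - y) / norm (z - y) \<le> 2 * exp (\<alpha> * T) / \<eta>"
            using zy \<eta> by (intro frac_le) auto
          then show "norm ((w - y) / (z - y)) \<le> \<rho>" by (simp add: norm_divide \<rho>_def)
        qed
        then show ?thesis using cXl by (simp add: card_image[OF inj] K1_def)
      qed
      show "1 \<le> norm (?e x0)" using alpha x0 by simp
      have "- T \<le> x0" "x0 \<le> T" using x0 N0 by (auto simp: T_def)
      then have "\<alpha> * - T \<le> \<alpha> * x0" "\<alpha> * x0 \<le> \<alpha> * T" using mult_left_mono[OF _ less_imp_le[OF alpha]] by blast+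
      then show "exp (\<alpha> * - T) \<le> norm (?e x0)" "norm (?e x0) \<le> exp (\<alpha> * T)" by auto
    qed
    have sumF: "(\<Sum>z\<in>?Z. norm (?F z)) \<le> K2 * (\<Sum>x\<in>X. norm (shift_sum g c I x))"
    proof -
      have "norm (?F (?e x)) \<le> K2 * norm (shift_sum g c I x)" if x: "x \<in> X" for x
      proof -
        have xV: "\<bar>x\<bar> \<le> real V" and xN: "\<bar>x\<bar> \<le> N" using XN'[OF x] by (auto simp: N_def V_def)
        have "load V x \<le> (\<Sum>m\<in>window V. 2 * real V)"
          unfolding load_def
        proof (intro sum_mono)
          fix m assume "m \<in> window V"
          then have "\<bar>real_of_int m\<bar> \<le> real V" by (auto simp: window_def)
          then show "max 0 (x - of_int m) \<le> 2 * real V" using xV by linarith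
        qed
        then have ld: "load V x \<le> (2 * real V + 1) * (2 * real V)" by (simp add: card_window algebra_simps)
        have "norm (?F (?e x)) = norm (denom V (?e x)) * inverse (wt x) * norm (shift_sum g c I x)"
          unfolding numer_real using wt_pos[of x] by (simp add: norm_mult norm_divide divide_inverse norm_inverse abs_of_pos mult_ac)
        also have "\<dots> \<le> K2 * norm (shift_sum g c I x)"
          unfolding K2_def
        proof (intro mult_right_mono mult_mono)
          have "norm (denom V (?e x)) \<le> exp ((2 * real V + 1) * A + \<alpha> * q * load V x)"
            by (intro denom_upper) simp
          also have "\<dots> \<le> exp ((2 * real V + 1) * A + \<alpha> * q * ((2 * real V + 1) * (2 * real V)))"
            using ld alpha by (auto intro!: mult_left_mono)
          finally show "norm (denom V (?e x)) \<le> exp ((2 * real V + 1) * A + \<alpha> * q * ((2 * real V + 1) * (2 * real V)))" .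
          have "inverse (wt x) \<le> exp (\<bar>\<beta>\<bar> * \<bar>x\<bar> + \<gamma> * \<alpha> * x\<^sup>2 / 2)" by (rule wt_bounds)
          also have "\<dots> \<le> exp (\<bar>\<beta>\<bar> * N + \<gamma> * \<alpha> * N\<^sup>2 / 2)"
          proof -
            have "x\<^sup>2 \<le> N\<^sup>2" using power_mono[OF xN, of 2] by simp
            then have "\<gamma> * \<alpha> * x\<^sup>2 \<le> \<gamma> * \<alpha> * N\<^sup>2" using alpha by (intro mult_left_mono) auto
            moreover have "\<bar>\<beta>\<bar> * \<bar>x\<bar> \<le> \<bar>\<beta>\<bar> * N" using xN by (intro mult_left_mono) auto
            ultimately show ?thesis by simp
          qed
          finally show "inverse (wt x) \<le> exp (\<bar>\<beta>\<bar> * N + \<gamma> * \<alpha> * N\<^sup>2 / 2)" .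
        qed (use wt_pos[of x] in \<open>auto intro: less_imp_le\<close>)
        finally show ?thesis .
      qed
      then show ?thesis unfolding sum.reindex[OF inj] o_def sum_distrib_left by (intro sum_mono)
    qed
    have BB: "norm (\<Prod>z\<in>?Z. ?e x0 - z) \<le> BB"
    proof -
      have "norm (\<Prod>z\<in>?Z. ?e x0 - z) \<le> exp (\<alpha> * (card X + (\<Sum>x\<in>X. max 0 x)))"
        unfolding BZ by (rule node_poly_centre[OF alpha fX x0])
      also have "\<dots> \<le> BB"
        unfolding BB_def node_exponent_def exp_le_cancel_iff
        using mX alpha by (intro mult_left_mono) (auto simp: cXl l_def algebra_simps)
      finally show ?thesis .
    qed
    let ?s = "\<Sum>z\<in>?Z. norm (?F z)"
    have s0: "?s \<ge> 0" by (intro sum_nonneg) auto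
    have F0: "norm (?F (?e x0)) \<le> BB * (M * ?S + M' * K1 * ?s) + K1 * ?s"
    proof -
      have "norm (\<Prod>z\<in>?Z. ?e x0 - z) * (M * ?S + M' * K1 * ?s) \<le> BB * (M * ?S + M' * K1 * ?s)"
        using K1 S0 s0 by (intro mult_right_mono BB) (auto simp: M_def M'_def)
      then show ?thesis using main by linarith
    qed
    have "norm (shift_sum g c I x0) = wt x0 * norm (?F (?e x0)) / norm (denom V (?e x0))"
    proof -
      have "0 < norm (denom V (?e x0))" using less_le_trans[OF exp_gt_zero denom_lower] .
      then show ?thesis unfolding numer_real using wt_pos[of x0] by (simp add: norm_mult norm_divide abs_of_pos)
    qed
    also have "\<dots> \<le> exp \<bar>\<beta>\<bar> * norm (?F (?e x0)) / exp (- (2 * real V + 1) * A + \<alpha> * q * (real V * (real V + 1) / 2))"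
    proof (intro frac_le mult_right_mono)
      show "wt x0 \<le> exp \<bar>\<beta>\<bar>"
        using order_trans[OF wt_bounds(2)[of x0]] x0 mult_left_mono[of x0 1 "\<bar>\<beta>\<bar>"] by simp
      have "exp (- (2 * real V + 1) * A + \<alpha> * q * (real V * (real V + 1) / 2)) \<le> exp (- (2 * real V + 1) * A + \<alpha> * q * load V x0)"
        using alpha load_centre[OF x0(1), of V] unfolding exp_le_cancel_iff by (intro add_left_mono mult_left_mono) auto
      also have "\<dots> \<le> norm (denom V (?e x0))" by (rule denom_lower)
      finally show "exp (- (2 * real V + 1) * A + \<alpha> * q * (real V * (real V + 1) / 2)) \<le> norm (denom V (?e x0))" .
    qed auto
    also have "\<dots> = C0 * norm (?F (?e x0))"
    proof -
      have "C0 = exp (\<bar>\<beta>\<bar> - (- (2 * real V + 1) * A + \<alpha> * q * (real V * (real V + 1) / 2)))"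
        unfolding C0_def denom_exponent_def by (rule arg_cong[of _ _ exp]) (simp add: rV algebra_simps)
      then show ?thesis by (simp only: exp_diff times_divide_eq_left)
    qed
    also have "\<dots> \<le> C0 * (BB * (M * ?S + M' * K1 * (K2 * (\<Sum>x\<in>X. norm (shift_sum g c I x)))) + K1 * (K2 * (\<Sum>x\<in>X. norm (shift_sum g c I x))))"
    proof (intro mult_left_mono order_trans[OF F0] add_mono sumF order_refl)
      show "0 \<le> M' * K1" using K1 by (simp add: M'_def)
    qed (auto simp: C0_def BB_def M_def K1)
    also have "\<dots> = (C0 * BB * M) * ?S + K * (\<Sum>x\<in>X. norm (shift_sum g c I x))"
      by (simp add: K_def algebra_simps)
    also have "C0 * BB * M = exp (denom_exponent L n + node_exponent L n + max (outer_exponent L n) (inner_exponent L n))"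
      by (simp add: C0_def BB_def M_def exp_add)
    finally show "norm (shift_sum g c I x0) \<le>
       exp (denom_exponent L n + node_exponent L n + max (outer_exponent L n) (inner_exponent L n)) * ?S
       + K * (\<Sum>x\<in>X. norm (shift_sum g c I x))" .
  qed
qed

end

section \<open>The local sampling inequality\<close>

lemma shift_sum_translate:
  "shift_sum g c I (y + of_int m) = shift_sum g (\<lambda>k. c (k + m)) ((\<lambda>k. k - m) ` I) y"
proof -
  have inj: "inj_on (\<lambda>k. k - m) I" by (auto intro!: inj_onI)
  show ?thesis unfolding shift_sum_def sum.reindex[OF inj] by (simp add: algebra_simps)
qed

text \<open>Every closed interval of length L - 1 contains l points. Closed intervals make the notion invariant under
reflection, and intervals that start at multiples of L are disjoint.\<close>

definition dense_blocks :: "nat \<Rightarrow> nat \<Rightarrow> real set \<Rightarrow> bool" where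
  "dense_blocks L l \<Gamma> \<longleftrightarrow> (\<forall>a::real. l \<le> card (\<Gamma> \<inter> {a..a + (real L - 1)}))"

lemma dense_blocks_translate:
  assumes "dense_blocks L l \<Gamma>" shows "dense_blocks L l ((\<lambda>x. x + b) ` \<Gamma>)"
  unfolding dense_blocks_def
proof
  fix a
  have "(\<lambda>x. x + b) ` \<Gamma> \<inter> {a..a + (real L - 1)} = (\<lambda>x. x + b) ` (\<Gamma> \<inter> {a - b..(a - b) + (real L - 1)})"
    by auto
  then have "card ((\<lambda>x. x + b) ` \<Gamma> \<inter> {a..a + (real L - 1)}) = card (\<Gamma> \<inter> {a - b..(a - b) + (real L - 1)})"
    by (simp add: card_image)
  then show "l \<le> card ((\<lambda>x. x + b) ` \<Gamma> \<inter> {a..a + (real L - 1)})"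
    using assms unfolding dense_blocks_def by metis
qed

lemma dense_blocks_reflect:
  assumes "dense_blocks L l \<Gamma>" shows "dense_blocks L l ((\<lambda>x. b - x) ` \<Gamma>)"
  unfolding dense_blocks_def
proof
  fix a
  let ?a = "b - a - (real L - 1)"
  have "(\<lambda>x. b - x) ` \<Gamma> \<inter> {a..a + (real L - 1)} = (\<lambda>x. b - x) ` (\<Gamma> \<inter> {?a..?a + (real L - 1)})"
    by auto
  moreover have "inj_on (\<lambda>x. b - x) S" for S by (auto intro!: inj_onI)
  ultimately have "card ((\<lambda>x. b - x) ` \<Gamma> \<inter> {a..a + (real L - 1)}) = card (\<Gamma> \<inter> {?a..?a + (real L - 1)})"
    by (simp add: card_image)
  then show "l \<le> card ((\<lambda>x. b - x) ` \<Gamma> \<inter> {a..a + (real L - 1)})"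
    using assms unfolding dense_blocks_def by metis
qed

context exp_rational
begin

text \<open>Choose n so large that the exponential gain beats \<epsilon>.\<close>

lemma local_sampling_unit:
  assumes L: "L \<ge> 1" and s: "s > 0" and \<epsilon>: "\<epsilon> > 0"
  shows "\<exists>R K. 0 \<le> R \<and> 0 \<le> K \<and> (\<forall>\<Gamma> c I x. gap s \<Gamma> \<longrightarrow> dense_blocks L ((q + \<gamma>) * L + 1) \<Gamma> \<longrightarrow> 0 \<le> x \<longrightarrow> x \<le> 1 \<longrightarrow>
     norm (shift_sum g c I x) \<le> K * (\<Sum>l\<in>\<Gamma> \<inter> {-R..R}. norm (shift_sum g c I l))
        + \<epsilon> * (\<Sum>k\<in>I. norm (c k) * exp (- \<delta> * \<bar>real_of_int k\<bar>)))"
proof -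
  obtain n :: nat where n: "n \<ge> 1" "exp (outer_exponent L n + node_exponent L n + denom_exponent L n) \<le> \<epsilon>"
      "exp (inner_exponent L n + node_exponent L n + denom_exponent L n) \<le> \<epsilon>"
    using exponents_small[of "real L" \<epsilon>] L \<epsilon> by auto
  have e: "exp (denom_exponent L n + node_exponent L n + max (outer_exponent L n) (inner_exponent L n)) \<le> \<epsilon>"
    using n by (cases "outer_exponent L n \<le> inner_exponent L n") (simp_all add: max_def add_ac)
  obtain K where K: "K \<ge> 0" and nb: "\<And>X c I x0. finite X \<Longrightarrow> gap s X \<Longrightarrow> card X = 2 * n * ((q + \<gamma>) * L + 1) \<Longrightarrow>
     X \<subseteq> {- real (n * L)..real (n * L)} \<Longrightarrow> - real (((q + \<gamma>) * L + 1) * n * L) \<le> \<Sum>X \<Longrightarrow>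
     (\<Sum>x\<in>X. max 0 x) \<le> real (((q + \<gamma>) * L + 1) * L) * (real n * (real n + 1) / 2) \<Longrightarrow>
     0 \<le> x0 \<Longrightarrow> x0 \<le> 1 \<Longrightarrow>
     norm (shift_sum g c I x0) \<le>
       exp (denom_exponent L n + node_exponent L n + max (outer_exponent L n) (inner_exponent L n)) * (\<Sum>k\<in>I. norm (c k) * exp (- \<delta> * \<bar>real_of_int k\<bar>))
       + K * (\<Sum>x\<in>X. norm (shift_sum g c I x))"
    using node_bound[OF n(1) L s] by blast
  show ?thesis
  proof (rule exI[of _ "real (n * L)"], rule exI[of _ K], intro conjI allI impI K)
    fix \<Gamma> and c :: "int \<Rightarrow> complex" and I and x :: real
    assume \<Gamma>: "gap s \<Gamma>" "dense_blocks L ((q + \<gamma>) * L + 1) \<Gamma>" and x: "0 \<le> x" "x \<le> 1"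
    have l1: "(q + \<gamma>) * L + 1 \<ge> 1" by simp
    obtain X where X: "X \<subseteq> \<Gamma>" "finite X" "card X = 2 * n * ((q + \<gamma>) * L + 1)" "X \<subseteq> {- real (n * L)..real (n * L)}"
      "- real (((q + \<gamma>) * L + 1) * n * L) \<le> \<Sum>X" "(\<Sum>x\<in>X. max 0 x) \<le> real (((q + \<gamma>) * L + 1) * L) * (real n * (real n + 1) / 2)"
      using select_nodes[OF L l1, of \<Gamma> n] \<Gamma>(2) unfolding dense_blocks_def by metis
    let ?S = "\<Sum>k\<in>I. norm (c k) * exp (- \<delta> * \<bar>real_of_int k\<bar>)"
    have "norm (shift_sum g c I x) \<le>
       exp (denom_exponent L n + node_exponent L n + max (outer_exponent L n) (inner_exponent L n)) * ?S
       + K * (\<Sum>x\<in>X. norm (shift_sum g c I x))"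
      by (rule nb[OF X(2) gap_subset[OF \<Gamma>(1) X(1)] X(3-6) x])
    also have "\<dots> \<le> \<epsilon> * ?S + K * (\<Sum>l\<in>\<Gamma> \<inter> {- real (n * L)..real (n * L)}. norm (shift_sum g c I l))"
    proof (intro add_mono mult_right_mono e mult_left_mono K sum_mono2)
      show "finite (\<Gamma> \<inter> {- real (n * L)..real (n * L)})" by (rule gap_finite_Int[OF \<Gamma>(1)]) simp
      show "X \<subseteq> \<Gamma> \<inter> {- real (n * L)..real (n * L)}" using X by blast
      show "0 \<le> ?S" by (intro sum_nonneg) simp
    qed simp
    finally show "norm (shift_sum g c I x) \<le> K * (\<Sum>l\<in>\<Gamma> \<inter> {- real (n * L)..real (n * L)}. norm (shift_sum g c I l)) + \<epsilon> * ?S"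
      by linarith
  qed simp
qed

lemma local_sampling:
  assumes L: "L \<ge> 1" and s: "s > 0" and \<epsilon>: "\<epsilon> > 0"
  shows "\<exists>R K. 0 \<le> R \<and> 0 \<le> K \<and> (\<forall>\<Gamma> c I x (m::int). gap s \<Gamma> \<longrightarrow> dense_blocks L ((q + \<gamma>) * L + 1) \<Gamma> \<longrightarrow> 0 \<le> x \<longrightarrow> x \<le> 1 \<longrightarrow>
     norm (shift_sum g c I (x + m)) \<le> K * (\<Sum>l\<in>\<Gamma> \<inter> {m - R..m + R}. norm (shift_sum g c I l))
        + \<epsilon> * (\<Sum>k\<in>I. norm (c k) * exp (- \<delta> * \<bar>real_of_int k - m\<bar>)))"
proof -
  obtain R K where RK: "0 \<le> R" "0 \<le> K" and ls: "\<And>\<Gamma> c I x. gap s \<Gamma> \<Longrightarrow> dense_blocks L ((q + \<gamma>) * L + 1) \<Gamma> \<Longrightarrow> 0 \<le> x \<Longrightarrow> x \<le> 1 \<Longrightarrow>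
     norm (shift_sum g c I x) \<le> K * (\<Sum>l\<in>\<Gamma> \<inter> {-R..R}. norm (shift_sum g c I l))
        + \<epsilon> * (\<Sum>k\<in>I. norm (c k) * exp (- \<delta> * \<bar>real_of_int k\<bar>))"
    using local_sampling_unit[OF assms] by blast
  show ?thesis
  proof (rule exI[of _ R], rule exI[of _ K], intro conjI RK allI impI)
    fix \<Gamma> and c :: "int \<Rightarrow> complex" and I and x :: real and m :: int
    assume \<Gamma>: "gap s \<Gamma>" "dense_blocks L ((q + \<gamma>) * L + 1) \<Gamma>" and x: "0 \<le> x" "x \<le> 1"
    let ?\<Gamma> = "(\<lambda>l. l + - of_int m) ` \<Gamma>" and ?c = "\<lambda>k. c (k + m)" and ?I = "(\<lambda>k. k - m) ` I"
    have inj: "inj_on (\<lambda>k. k - m) I" by (auto intro!: inj_onI)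
    have gap: "gap s ?\<Gamma>" using gap_translate[OF \<Gamma>(1), of "- of_int m"] by (simp add: add.commute)
    have "norm (shift_sum g ?c ?I x) \<le> K * (\<Sum>l\<in>?\<Gamma> \<inter> {-R..R}. norm (shift_sum g ?c ?I l))
        + \<epsilon> * (\<Sum>k\<in>?I. norm (?c k) * exp (- \<delta> * \<bar>real_of_int k\<bar>))"
      by (rule ls[OF gap dense_blocks_translate[OF \<Gamma>(2)] x])
    moreover have "(\<Sum>k\<in>?I. norm (?c k) * exp (- \<delta> * \<bar>real_of_int k\<bar>)) = (\<Sum>k\<in>I. norm (c k) * exp (- \<delta> * \<bar>real_of_int k - m\<bar>))"
      unfolding sum.reindex[OF inj] by simp
    moreover have "(\<Sum>l\<in>?\<Gamma> \<inter> {-R..R}. norm (shift_sum g ?c ?I l)) = (\<Sum>l\<in>\<Gamma> \<inter> {m - R..m + R}. norm (shift_sum g c I l))"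
      by (rule sum.reindex_bij_witness[of _ "\<lambda>l. l - of_int m" "\<lambda>l. l + of_int m"])
         (auto simp: shift_sum_translate[symmetric])
    ultimately show "norm (shift_sum g c I (x + m)) \<le> K * (\<Sum>l\<in>\<Gamma> \<inter> {m - R..m + R}. norm (shift_sum g c I l))
        + \<epsilon> * (\<Sum>k\<in>I. norm (c k) * exp (- \<delta> * \<bar>real_of_int k - m\<bar>))"
      by (simp add: shift_sum_translate)
  qed
qed

end

section \<open>The Zak transform and a lower Riesz bound\<close>

lemma schur_test_indexed:
  fixes a :: "'i \<Rightarrow> real"
  assumes u: "inj_on u I" "gap s (u ` I)" "finite I" and v: "inj_on v J" "gap t (v ` J)" "finite J" and d: "d > 0"
  shows "(\<Sum>j\<in>J. (\<Sum>i\<in>I. a i * exp (- d * \<bar>u i - v j\<bar>))\<^sup>2) \<le> tail_const s d * tail_const t d * (\<Sum>i\<in>I. (a i)\<^sup>2)"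
proof -
  define c where "c = (\<lambda>x. a (the_inv_into I u x))"
  have c: "c (u i) = a i" if "i \<in> I" for i using that u(1) by (simp add: c_def the_inv_into_f_f)
  have "(\<Sum>y\<in>v ` J. (\<Sum>x\<in>u ` I. c x * exp (- d * \<bar>x - y\<bar>))\<^sup>2) \<le> tail_const s d * tail_const t d * (\<Sum>x\<in>u ` I. (c x)\<^sup>2)"
    using u v d by (intro schur_test) auto
  then show ?thesis unfolding sum.reindex[OF u(1)] sum.reindex[OF v(1)] by (simp add: c)
qed

lemma gap_of_int: "gap 1 (real_of_int ` J)"
  by (rule gap_subset[OF gap_Ints]) auto

lemma inj_of_int_real: "inj_on real_of_int J"
  by (auto intro!: inj_onI)

lemma integrable_exp_abs:
  fixes \<delta> :: real
  assumes "\<delta> > 0"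
  shows "integrable lborel (\<lambda>x. exp (- \<delta> * \<bar>x\<bar>))"
proof -
  let ?h = "\<lambda>x::real. exp (- \<delta> * x) * indicator {0..} x"
  have "(\<integral>\<^sup>+x. ennreal (exp (- \<delta> * x)) * indicator {0..} x \<partial>lborel) = ennreal (0 - (- exp (- \<delta> * 0) / \<delta>))"
  proof (rule nn_integral_FTC_atLeast)
    show "((\<lambda>x. - exp (- \<delta> * x) / \<delta>) \<longlongrightarrow> 0) at_top"
    proof -
      have "filterlim (\<lambda>x::real. \<delta> * x) at_top at_top"
        using assms by (intro filterlim_tendsto_pos_mult_at_top[OF tendsto_const]) (auto intro: filterlim_ident)
      then have "filterlim (\<lambda>x. - \<delta> * x) at_bot at_top"
        by (simp add: filterlim_uminus_at_bot)
      then have "((\<lambda>x. exp (- \<delta> * x)) \<longlongrightarrow> 0) at_top"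
        by (rule filterlim_compose[OF exp_at_bot])
      from tendsto_divide[OF tendsto_minus[OF this] tendsto_const[of \<delta>]] show ?thesis using assms by simp
    qed
    show "((\<lambda>x. - exp (- \<delta> * x) / \<delta>) has_real_derivative exp (- \<delta> * x)) (at x)" for x
      using assms by (auto intro!: derivative_eq_intros)
  qed auto
  moreover have "(\<integral>\<^sup>+x. ennreal (?h x) \<partial>lborel) = (\<integral>\<^sup>+x. ennreal (exp (- \<delta> * x)) * indicator {0..} x \<partial>lborel)"
    by (intro nn_integral_cong) (auto simp: indicator_def)
  ultimately have h: "integrable lborel ?h"
    by (intro integrableI_nonneg) auto
  have "integrable lborel (\<lambda>x. ?h (0 + (-1) * x))"
    by (rule lborel_integrable_real_affine[OF h]) simp
  with h have "integrable lborel (\<lambda>x. ?h x + ?h (0 + (-1) * x))" by (rule Bochner_Integration.integrable_add)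
  then show ?thesis
    by (rule Bochner_Integration.integrable_bound) (auto simp: indicator_def abs_real_def)
qed

lemma integrable_U_continuous:
  fixes f :: "real \<Rightarrow> complex"
  assumes "continuous_on UNIV f"
  shows "integrable \<U> f"
proof -
  have "compact (f ` {0..1})" using assms by (intro compact_continuous_image continuous_on_subset[OF assms]) auto
  then obtain B where B: "\<And>x. x \<in> {0..1} \<Longrightarrow> norm (f x) \<le> B"
    by (meson bounded_iff compact_imp_bounded image_eqI)
  show ?thesis
    by (rule integrable_bounded_U[of _ B])
       (use B assms in \<open>auto intro: measurable_U borel_measurable_continuous_onI\<close>)
qed

lemma integral_unit_interval:
  fixes F :: "real \<Rightarrow> complex"
  shows "(LINT x:{of_int j..<of_int j + 1}|lborel. F x) = (LINT x|\<U>. F (x + of_int j))"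
proof -
  have "(LINT x:{of_int j..<of_int j + 1}|lborel. F x) = (LINT x|lborel. indicator {of_int j..<of_int j + 1} (of_int j + 1 * x) *\<^sub>R F (of_int j + 1 * x))"
    unfolding set_lebesgue_integral_def by (subst lborel_integral_real_affine[of 1 _ "of_int j"]) auto
  also have "\<dots> = (LINT x:{0..<1}|lborel. F (x + of_int j))"
    unfolding set_lebesgue_integral_def
    by (intro Bochner_Integration.integral_cong) (auto simp: indicator_def add.commute)
  finally show ?thesis by (simp add: integral_restrict_space set_lebesgue_integral_def)
qed

text \<open>The unit intervals are enumerated by the natural numbers, so that the theory of series applies.\<close>

lemma integral_sum_unit_intervals:
  fixes F :: "real \<Rightarrow> complex"
  assumes "integrable lborel F"
  shows "(LINT x|lborel. F x) = (\<Sum>n. LINT x|\<U>. F (x + of_int (int_decode n)))"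
proof -
  let ?A = "\<lambda>n. {real_of_int (int_decode n)..<real_of_int (int_decode n) + 1}"
  have U: "(\<Union>n. ?A n) = UNIV"
  proof -
    have "x \<in> ?A (int_encode \<lfloor>x\<rfloor>)" for x by simp
    then show ?thesis by blast
  qed
  have d: "?A m \<inter> ?A n = {}" if "m \<noteq> n" for m n
  proof -
    have "int_decode m \<noteq> int_decode n" using that inj_int_decode by (metis injD)
    then have "int_decode m + 1 \<le> int_decode n \<or> int_decode n + 1 \<le> int_decode m" by linarith
    then have "real_of_int (int_decode m) + 1 \<le> real_of_int (int_decode n) \<or> real_of_int (int_decode n) + 1 \<le> real_of_int (int_decode m)"
      by linarith
    then show ?thesis by auto
  qed
  have "(LINT x|lborel. F x) = (LINT x:(\<Union>n. ?A n)|lborel. F x)"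
    unfolding U by (simp add: set_lebesgue_integral_def)
  also have "\<dots> = (\<Sum>n. LINT x:?A n|lborel. F x)"
    by (rule lebesgue_integral_countable_add[OF _ d]) (auto simp: U set_integrable_def assms)
  finally show ?thesis unfolding integral_unit_interval .
qed

locale decaying_generator =
  fixes g :: "real \<Rightarrow> complex" and C \<delta> :: real
  assumes g_cont: "continuous_on UNIV g" and g_decay: "\<And>x. norm (g x) \<le> C * exp (- \<delta> * \<bar>x\<bar>)" and \<delta>_pos: "\<delta> > 0"
begin

lemma C_nonneg: "C \<ge> 0"
  using order_trans[OF norm_ge_zero g_decay[of 0]] by simp

lemma g_measurable [measurable]: "g \<in> borel_measurable borel"
  using g_cont by (rule borel_measurable_continuous_onI)

lemma g_integrable: "integrable lborel g"
proof (rule Bochner_Integration.integrable_bound)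
  show "integrable lborel (\<lambda>x. C * exp (- \<delta> * \<bar>x\<bar>))" by (intro integrable_mult_right integrable_exp_abs \<delta>_pos)
  show "AE x in lborel. norm (g x) \<le> norm (C * exp (- \<delta> * \<bar>x\<bar>))"
    using g_decay C_nonneg by (intro AE_I2) (simp add: abs_mult)
qed simp

lemma g_decay_shift:
  assumes "0 \<le> x" "x \<le> 1"
  shows "norm (g (x + y)) \<le> C * exp \<delta> * exp (- \<delta> * \<bar>y\<bar>)"
proof -
  have "\<bar>y\<bar> \<le> \<bar>x + y\<bar> + 1" using assms by linarith
  then have "\<delta> * \<bar>y\<bar> \<le> \<delta> * (\<bar>x + y\<bar> + 1)" using \<delta>_pos by (intro mult_left_mono) auto
  then have "exp (- \<delta> * \<bar>x + y\<bar>) \<le> exp \<delta> * exp (- \<delta> * \<bar>y\<bar>)"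
    unfolding exp_add[symmetric] exp_le_cancel_iff by (simp add: algebra_simps)
  from mult_left_mono[OF this C_nonneg] show ?thesis
    using g_decay[of "x + y"] by (simp add: mult_ac)
qed

lemma summable_exp_int: "summable (\<lambda>n. exp (- \<delta> * \<bar>real_of_int (int_decode n)\<bar>))"
proof (rule summableI_nonneg_bounded)
  fix n
  have inj: "inj_on (\<lambda>n. real_of_int (int_decode n)) {..<n}"
    by (rule inj_onI) (auto dest: inj_onD[OF inj_int_decode[of UNIV]])
  have "(\<Sum>i<n. exp (- \<delta> * \<bar>real_of_int (int_decode i)\<bar>)) = (\<Sum>x\<in>(\<lambda>n. real_of_int (int_decode n)) ` {..<n}. exp (- \<delta> * \<bar>x - 0\<bar>))"
    unfolding sum.reindex[OF inj] by simp
  also have "\<dots> \<le> tail_const 1 \<delta>"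
    by (intro gap_sum_exp gap_subset[OF gap_Ints] \<delta>_pos) auto
  finally show "(\<Sum>i<n. exp (- \<delta> * \<bar>real_of_int (int_decode i)\<bar>)) \<le> tail_const 1 \<delta>" .
qed simp

text \<open>The Zak transform. With the integers enumerated by the natural numbers it is an absolutely convergent
series.\<close>

definition zak :: "real \<Rightarrow> real \<Rightarrow> complex" where
  "zak x \<theta> = (\<Sum>n. g (x + of_int (int_decode n)) * character (int_decode n) \<theta>)"

lemma summable_majorant: "summable (\<lambda>n. C * exp \<delta> * exp (- \<delta> * \<bar>real_of_int (int_decode n)\<bar>))"
  by (intro summable_mult summable_exp_int)

lemma zak_term_bound:
  assumes "0 \<le> x" "x \<le> 1"
  shows "norm (g (x + of_int j) * character j' \<theta>) \<le> C * exp \<delta> * exp (- \<delta> * \<bar>real_of_int j\<bar>)"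
  using g_decay_shift[OF assms] by (simp add: norm_mult)

lemma summable_zak_norm:
  assumes "0 \<le> x" "x \<le> 1"
  shows "summable (\<lambda>n. norm (g (x + of_int (int_decode n)) * character (int_decode n) \<theta>))"
  by (rule summable_comparison_test[OF _ summable_majorant]) (use zak_term_bound[OF assms] in auto)

lemma zak_continuous:
  assumes x: "0 \<le> x" "x \<le> 1"
  shows "continuous_on UNIV (zak x)"
proof -
  have ul: "uniform_limit UNIV (\<lambda>N \<theta>. \<Sum>n<N. g (x + of_int (int_decode n)) * character (int_decode n) \<theta>) (zak x) sequentially"
    unfolding zak_def[abs_def]
    by (rule Weierstrass_m_test[OF _ summable_majorant]) (use zak_term_bound[OF x] in auto)
  show ?thesis
    by (rule uniform_limit_theorem[OF _ ul]) (auto intro!: always_eventually continuous_intros)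
qed

lemma zak_coeff:
  assumes x: "0 \<le> x" "x \<le> 1"
  shows "fourier_coeff (zak x) m = g (x + of_int m)"
proof -
  let ?f = "\<lambda>n t. g (x + of_int (int_decode n)) * character (int_decode n - m) t"
  have nf: "norm (?f n t) \<le> C * exp \<delta> * exp (- \<delta> * \<bar>real_of_int (int_decode n)\<bar>)" for n t
    by (rule zak_term_bound[OF x])
  have int: "integrable \<U> (?f n)" for n by (intro integrable_U_continuous continuous_intros)
  have "fourier_coeff (zak x) m = (LINT t|\<U>. (\<Sum>n. ?f n t))"
    unfolding fourier_coeff_def zak_def
  proof (rule Bochner_Integration.integral_cong[OF refl])
    fix t
    have "(\<Sum>n. g (x + of_int (int_decode n)) * character (int_decode n) t) * character (- m) t
       = (\<Sum>n. g (x + of_int (int_decode n)) * character (int_decode n) t * character (- m) t)"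
      by (rule suminf_mult2[OF summable_norm_cancel[OF summable_zak_norm[OF x]]])
    also have "\<dots> = (\<Sum>n. ?f n t)"
      by (intro suminf_cong) (simp add: character_add[of _ "- m", simplified] mult_ac)
    finally show "(\<Sum>n. g (x + of_int (int_decode n)) * character (int_decode n) t) * character (- m) t = (\<Sum>n. ?f n t)" .
  qed
  also have "\<dots> = (\<Sum>n. LINT t|\<U>. ?f n t)"
  proof (rule integral_suminf[OF int])
    show "AE t in \<U>. summable (\<lambda>n. norm (?f n t))"
      by (intro AE_I2 summable_comparison_test[OF _ summable_majorant]) (use nf in auto)
    have "(LINT t|\<U>. norm (?f n t)) = norm (g (x + of_int (int_decode n)))" for n
      by (simp add: norm_mult measure_U_1)
    then show "summable (\<lambda>n. LINT t|\<U>. norm (?f n t))"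
      using summable_zak_norm[OF x, of 0] by (simp only: norm_mult norm_character mult_1_right)
  qed
  also have "\<dots> = (\<Sum>n. if n = int_encode m then g (x + of_int m) else 0)"
  proof (rule suminf_cong)
    fix n
    have "int_decode n - m = 0 \<longleftrightarrow> n = int_encode m" by (metis eq_iff_diff_eq_0 int_decode_inverse int_encode_inverse)
    then show "(LINT t|\<U>. ?f n t) = (if n = int_encode m then g (x + of_int m) else 0)"
      by (auto simp: integral_character)
  qed
  also have "\<dots> = g (x + of_int m)" by (subst suminf_finite[of "{int_encode m}"]) auto
  finally show ?thesis .
qed

lemma character_periodic: "character n (t + of_int k) = character n t"
proof -
  have "cis (2 * pi * of_int n * of_int k) = 1"
    using cis_multiple_2pi[of "of_int (n * k)"] by (simp add: mult_ac)
  then show ?thesis by (simp add: character_def distrib_left cis_mult[symmetric])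
qed

lemma zak_periodic: "zak x (t + of_int k) = zak x t"
  by (simp add: zak_def character_periodic)

text \<open>Periodisation: cutting the Fourier integral into unit intervals produces the Zak transform. Since the latter
is 1-periodic in its second variable, the values of the Fourier transform on one coset of the integers all come
from the single function zak x (-t) of x.\<close>

lemma fourier_eq_zak:
  "fourier g t = (LINT x|\<U>. exp (- 2 * of_real pi * \<i> * of_real x * of_real t) * zak x (- t))"
proof -
  let ?F = "\<lambda>x. exp (- 2 * of_real pi * \<i> * of_real x * of_real t) * g x"
  have F_meas: "?F \<in> borel_measurable borel"
    by (intro borel_measurable_times g_measurable borel_measurable_continuous_onI continuous_intros)
  have nF: "norm (?F x) = norm (g x)" for x
    by (simp add: norm_mult)
  have intF: "integrable lborel ?F"
    by (rule Bochner_Integration.integrable_bound[OF g_integrable]) (use F_meas nF in auto)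
  have Fs: "?F (x + of_int j) = exp (- 2 * of_real pi * \<i> * of_real x * of_real t) * (g (x + of_int j) * character j (- t))" for x and j :: int
  proof -
    have "character j (- t) = exp (- 2 * of_real pi * \<i> * of_int j * of_real t)"
      unfolding character_def cis_conv_exp by (rule arg_cong[of _ _ exp]) simp
    moreover have "exp (- 2 * of_real pi * \<i> * of_real (x + of_int j) * of_real t)
        = exp (- 2 * of_real pi * \<i> * of_real x * of_real t) * exp (- 2 * of_real pi * \<i> * of_int j * of_real t)"
      unfolding exp_add[symmetric] by (rule arg_cong[of _ _ exp]) (simp add: algebra_simps)
    ultimately show ?thesis by simp
  qed
  have bound: "norm (?F (x + of_int (int_decode n))) \<le> C * exp \<delta> * exp (- \<delta> * \<bar>real_of_int (int_decode n)\<bar>)" if "0 \<le> x" "x \<le> 1" for x n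
    unfolding nF by (rule g_decay_shift[OF that])
  have "fourier g t = (\<Sum>n. LINT x|\<U>. ?F (x + of_int (int_decode n)))"
    unfolding fourier_def by (rule integral_sum_unit_intervals[OF intF])
  also have "\<dots> = (LINT x|\<U>. (\<Sum>n. ?F (x + of_int (int_decode n))))"
  proof (rule integral_suminf[symmetric])
    have shm: "(\<lambda>x. ?F (x + of_int (int_decode n))) \<in> borel_measurable \<U>" for n
      by (rule measurable_U) (rule measurable_compose[OF _ F_meas], simp)
    show "integrable \<U> (\<lambda>x. ?F (x + of_int (int_decode n)))" for n
      by (rule integrable_bounded_U[OF shm bound]) auto
    show "AE x in \<U>. summable (\<lambda>n. norm (?F (x + of_int (int_decode n))))"
    proof (rule AE_I2)
      fix x assume "x \<in> space \<U>"
      then show "summable (\<lambda>n. norm (?F (x + of_int (int_decode n))))"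
        by (intro summable_comparison_test[OF _ summable_majorant] exI[of _ 0] allI impI)
           (simp only: real_norm_def abs_norm_cancel, rule bound, auto)
    qed
    show "summable (\<lambda>n. LINT x|\<U>. norm (?F (x + of_int (int_decode n))))"
    proof (rule summable_comparison_test[OF _ summable_majorant], intro exI[of _ 0] allI impI)
      fix n
      let ?M = "C * exp \<delta> * exp (- \<delta> * \<bar>real_of_int (int_decode n)\<bar>)"
      have "(LINT x|\<U>. norm (?F (x + of_int (int_decode n)))) \<le> (LINT x|\<U>. ?M)"
      proof (rule integral_mono)
        show "integrable \<U> (\<lambda>x. norm (?F (x + of_int (int_decode n))))"
          by (intro integrable_norm integrable_bounded_U[OF shm bound]) auto
      qed (use bound in auto)
      also have "\<dots> = ?M" by (simp add: measure_U_1)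
      finally show "norm (LINT x|\<U>. norm (?F (x + of_int (int_decode n)))) \<le> ?M"
        by (simp add: abs_of_nonneg)
    qed
  qed
  also have "\<dots> = (LINT x|\<U>. exp (- 2 * of_real pi * \<i> * of_real x * of_real t) * zak x (- t))"
  proof (rule Bochner_Integration.integral_cong[OF refl])
    fix x assume "x \<in> space \<U>"
    then have x: "0 \<le> x" "x \<le> 1" by auto
    show "(\<Sum>n. ?F (x + of_int (int_decode n))) = exp (- 2 * of_real pi * \<i> * of_real x * of_real t) * zak x (- t)"
      unfolding Fs zak_def by (rule suminf_mult[OF summable_norm_cancel[OF summable_zak_norm[OF x]]])
  qed
  finally show ?thesis .
qed

lemma zak_nonvanishing:
  assumes "fourier_nonvanishing g"
  shows "\<exists>x\<in>{0..<1}. zak x \<theta> \<noteq> 0"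
proof (rule ccontr)
  assume "\<not> ?thesis"
  then have z: "zak x \<theta> = 0" if "x \<in> {0..<1}" for x using that by blast
  \<comment> \<open>The hypothesis concerns cosets with representative in [0,1), and zak is 1-periodic in \<theta>.\<close>
  have "0 \<le> frac (- \<theta>)" "frac (- \<theta>) < 1" by (auto simp: frac_lt_1)
  then obtain n :: int where n: "fourier g (of_int n + frac (- \<theta>)) \<noteq> 0"
    using assms unfolding fourier_nonvanishing_def by blast
  have "- (of_int n + frac (- \<theta>)) = \<theta> + of_int (\<lfloor>- \<theta>\<rfloor> - n)" by (simp add: frac_def)
  then have "zak x (- (of_int n + frac (- \<theta>))) = zak x \<theta>" for x by (simp only: zak_periodic)
  then have "fourier g (of_int n + frac (- \<theta>)) = (LINT x|\<U>. 0)"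
    unfolding fourier_eq_zak by (intro Bochner_Integration.integral_cong refl) (use z in auto)
  then show False using n by simp
qed

text \<open>The open sets on which zak x is nonzero cover the compact interval [0,1].\<close>

lemma zak_finite_lower_bound:
  assumes "fourier_nonvanishing g"
  obtains X a where "finite X" "X \<subseteq> {0..<1}" "a > 0" "\<And>\<theta>. \<theta> \<in> {0..1} \<Longrightarrow> a \<le> (\<Sum>x\<in>X. (norm (zak x \<theta>))\<^sup>2)"
proof -
  define Ux where "Ux = (\<lambda>x. {\<theta>. zak x \<theta> \<noteq> 0})"
  have op: "open (Ux x)" if "x \<in> {0..<1}" for x
  proof -
    have "continuous_on UNIV (zak x)" using that by (intro zak_continuous) auto
    then have "open (zak x -` (- {0}))" by (intro open_vimage) auto
    moreover have "zak x -` (- {0}) = Ux x" by (auto simp: Ux_def)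
    ultimately show ?thesis by simp
  qed
  have cov: "{0..1} \<subseteq> (\<Union>x\<in>{0..<1}. Ux x)"
    using zak_nonvanishing[OF assms] by (auto simp: Ux_def)
  obtain X where X: "X \<subseteq> {0..<1}" "finite X" "{0..1} \<subseteq> (\<Union>x\<in>X. Ux x)"
    using compactE_image[OF compact_Icc op cov] by metis
  let ?W = "\<lambda>\<theta>. \<Sum>x\<in>X. (norm (zak x \<theta>))\<^sup>2"
  have "continuous_on {0..1} ?W"
    using X by (intro continuous_intros continuous_on_subset[OF zak_continuous]) auto
  then obtain t where t: "t \<in> {0..1}" "\<And>\<theta>. \<theta> \<in> {0..1} \<Longrightarrow> ?W t \<le> ?W \<theta>"
    using continuous_attains_inf[of "{0..1::real}" ?W] by auto
  obtain y where y: "y \<in> X" "zak y t \<noteq> 0" using X(3) t(1) by (auto simp: Ux_def)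
  have "0 < (norm (zak y t))\<^sup>2" using y by simp
  also have "\<dots> \<le> ?W t" using X y by (intro member_le_sum) auto
  finally show ?thesis using that X t by blast
qed

lemma shift_sum_bound:
  "norm (shift_sum g c I y) \<le> C * (\<Sum>k\<in>I. norm (c k) * exp (- \<delta> * \<bar>real_of_int k - y\<bar>))"
proof -
  have "norm (shift_sum g c I y) \<le> (\<Sum>k\<in>I. norm (c k) * (C * exp (- \<delta> * \<bar>y - of_int k\<bar>)))"
    unfolding shift_sum_def
  proof (rule sum_norm_le)
    fix k show "norm (c k * g (y - of_int k)) \<le> norm (c k) * (C * exp (- \<delta> * \<bar>y - of_int k\<bar>))"
      unfolding norm_mult by (intro mult_left_mono g_decay) simp
  qed
  then show ?thesis by (simp add: sum_distrib_left mult_ac abs_minus_commute)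
qed

text \<open>Convolution with c becomes multiplication by a trigonometric polynomial: the values of the shift sum on
x + \<int> are the Fourier coefficients of that polynomial times zak x.\<close>

lemma shift_sum_parseval:
  assumes I: "finite I" and x: "0 \<le> x" "x \<le> 1"
  shows "((\<lambda>m::int. (norm (shift_sum g c I (x + of_int m)))\<^sup>2) has_sum
      (LINT \<theta>|\<U>. (norm (trig_poly c I \<theta>))\<^sup>2 * (norm (zak x \<theta>))\<^sup>2)) UNIV"
proof -
  let ?\<phi> = "\<lambda>\<theta>. trig_poly c I \<theta> * zak x \<theta>"
  have tp: "trig_poly c I \<in> trig_polys" using I by (auto simp: trig_polys_def)
  have cont: "continuous_on UNIV ?\<phi>"
    by (intro continuous_on_mult trig_polys_continuous tp zak_continuous x)
  have cz: "integrable \<U> (\<lambda>t. c k * (zak x t * character (k - m) t))" for k m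
    by (intro integrable_U_continuous continuous_intros zak_continuous x)
  have "fourier_coeff ?\<phi> m = shift_sum g c I (x + of_int m)" for m
  proof -
    have "fourier_coeff ?\<phi> m = (LINT t|\<U>. (\<Sum>k\<in>I. c k * (zak x t * character (k - m) t)))"
      unfolding fourier_coeff_def trig_poly_def sum_distrib_right
      by (intro Bochner_Integration.integral_cong refl sum.cong)
         (simp add: character_add[of _ "- m", simplified] mult_ac)
    also have "\<dots> = (\<Sum>k\<in>I. c k * fourier_coeff (zak x) (m - k))"
      using cz by (simp add: Bochner_Integration.integral_sum fourier_coeff_def)
    also have "\<dots> = shift_sum g c I (x + of_int m)"
      by (simp add: zak_coeff[OF x] shift_sum_def algebra_simps)
    finally show ?thesis .
  qed
  moreover have "((\<lambda>n. (norm (fourier_coeff ?\<phi> n))\<^sup>2) has_sum (LINT t|\<U>. (norm (?\<phi> t))\<^sup>2)) UNIV"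
  proof (rule parseval)
    show "?\<phi> \<in> borel_measurable \<U>" by (intro measurable_U borel_measurable_continuous_onI cont)
    have "integrable \<U> (\<lambda>t. complex_of_real ((norm (?\<phi> t))\<^sup>2))"
      by (intro integrable_U_continuous continuous_intros cont)
    from Bochner_Integration.integrable_Re[OF this] show "integrable \<U> (\<lambda>t. (norm (?\<phi> t))\<^sup>2)"
      unfolding Re_complex_of_real .
  qed
  ultimately show ?thesis by (simp add: norm_mult power_mult_distrib)
qed

lemma trig_poly_parseval:
  assumes "finite I"
  shows "(LINT \<theta>|\<U>. (norm (trig_poly c I \<theta>))\<^sup>2) = (\<Sum>k\<in>I. (norm (c k))\<^sup>2)"
  using L2_dist_trig_poly(2)[of "\<lambda>_. 0" I c] assms by (simp add: fourier_coeff_def)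

lemma riesz_lower_bound:
  assumes "fourier_nonvanishing g"
  obtains X a where "finite X" "X \<subseteq> {0..<1}" "a > 0"
    "\<forall>c I. finite I \<longrightarrow> a * (\<Sum>k\<in>I. (norm (c k))\<^sup>2) \<le> (\<Sum>x\<in>X. \<Sum>\<^sub>\<infinity>m. (norm (shift_sum g c I (x + of_int m)))\<^sup>2)"
proof -
  obtain X a where X: "finite X" "X \<subseteq> {0..<1}" "a > 0" and low: "\<And>\<theta>. \<theta> \<in> {0..1} \<Longrightarrow> a \<le> (\<Sum>x\<in>X. (norm (zak x \<theta>))\<^sup>2)"
    using zak_finite_lower_bound[OF assms] by metis
  have "a * (\<Sum>k\<in>I. (norm (c k))\<^sup>2) \<le> (\<Sum>x\<in>X. \<Sum>\<^sub>\<infinity>m. (norm (shift_sum g c I (x + of_int m)))\<^sup>2)" if I: "finite I" for c I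
  proof -
    have tp: "trig_poly c I \<in> trig_polys" using I by (auto simp: trig_polys_def)
    have int: "integrable \<U> (\<lambda>\<theta>. (norm (trig_poly c I \<theta>))\<^sup>2 * (norm (zak x \<theta>))\<^sup>2)" if "x \<in> X" for x
    proof -
      have "0 \<le> x" "x \<le> 1" using that X by auto
      then have "integrable \<U> (\<lambda>\<theta>. complex_of_real ((norm (trig_poly c I \<theta>))\<^sup>2 * (norm (zak x \<theta>))\<^sup>2))"
        by (intro integrable_U_continuous continuous_intros zak_continuous trig_polys_continuous tp)
      from Bochner_Integration.integrable_Re[OF this] show ?thesis unfolding Re_complex_of_real .
    qed
    have int0: "integrable \<U> (\<lambda>\<theta>. (norm (trig_poly c I \<theta>))\<^sup>2)"
    proof -
      have "integrable \<U> (\<lambda>\<theta>. complex_of_real ((norm (trig_poly c I \<theta>))\<^sup>2))"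
        by (intro integrable_U_continuous continuous_intros trig_polys_continuous tp)
      from Bochner_Integration.integrable_Re[OF this] show ?thesis unfolding Re_complex_of_real .
    qed
    have "a * (\<Sum>k\<in>I. (norm (c k))\<^sup>2) = (LINT \<theta>|\<U>. a * (norm (trig_poly c I \<theta>))\<^sup>2)"
      by (simp add: trig_poly_parseval[OF I])
    also have "\<dots> \<le> (LINT \<theta>|\<U>. (\<Sum>x\<in>X. (norm (trig_poly c I \<theta>))\<^sup>2 * (norm (zak x \<theta>))\<^sup>2))"
    proof (rule integral_mono)
      fix \<theta> assume "\<theta> \<in> space \<U>"
      then show "a * (norm (trig_poly c I \<theta>))\<^sup>2 \<le> (\<Sum>x\<in>X. (norm (trig_poly c I \<theta>))\<^sup>2 * (norm (zak x \<theta>))\<^sup>2)"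
        using mult_right_mono[OF low[of \<theta>], of "(norm (trig_poly c I \<theta>))\<^sup>2"] by (simp add: sum_distrib_left mult_ac)
    qed (auto intro!: integrable_mult_right int0 Bochner_Integration.integrable_sum int)
    also have "\<dots> = (\<Sum>x\<in>X. LINT \<theta>|\<U>. (norm (trig_poly c I \<theta>))\<^sup>2 * (norm (zak x \<theta>))\<^sup>2)"
      by (rule Bochner_Integration.integral_sum) (rule int)
    also have "\<dots> = (\<Sum>x\<in>X. \<Sum>\<^sub>\<infinity>m. (norm (shift_sum g c I (x + of_int m)))\<^sup>2)"
      using X by (intro sum.cong refl infsumI[symmetric] shift_sum_parseval I) auto
    finally show ?thesis .
  qed
  then show ?thesis using that X by blast
qed

end

section \<open>Stable sampling of shift sums\<close>

lemma sum_sq_le: "(a + b)\<^sup>2 \<le> 2 * a\<^sup>2 + 2 * (b::real)\<^sup>2"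
  using sum_squares_bound[of a b] by (simp add: power2_sum)

context decaying_generator
begin

lemma shift_sum_bessel:
  assumes I: "finite I" and Y: "gap s Y" "finite Y"
  shows "(\<Sum>y\<in>Y. (norm (shift_sum g c I y))\<^sup>2) \<le> C\<^sup>2 * (tail_const 1 \<delta> * tail_const s \<delta>) * (\<Sum>k\<in>I. (norm (c k))\<^sup>2)"
proof -
  have "(\<Sum>y\<in>Y. (norm (shift_sum g c I y))\<^sup>2) \<le> (\<Sum>y\<in>Y. (C * (\<Sum>k\<in>I. norm (c k) * exp (- \<delta> * \<bar>real_of_int k - y\<bar>)))\<^sup>2)"
    by (intro sum_mono power_mono shift_sum_bound) simp
  also have "\<dots> = C\<^sup>2 * (\<Sum>y\<in>Y. (\<Sum>k\<in>I. norm (c k) * exp (- \<delta> * \<bar>real_of_int k - y\<bar>))\<^sup>2)"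
    unfolding power_mult_distrib by (rule sum_distrib_left[symmetric])
  also have "\<dots> \<le> C\<^sup>2 * (tail_const 1 \<delta> * tail_const s \<delta> * (\<Sum>k\<in>I. (norm (c k))\<^sup>2))"
    using schur_test_indexed[of real_of_int I 1 "\<lambda>y. y" Y s \<delta> "\<lambda>k. norm (c k)"] I Y \<delta>_pos gap_of_int inj_of_int_real
    by (intro mult_left_mono) auto
  finally show ?thesis by (simp add: mult.assoc)
qed

lemma exp_decay_small:
  assumes "E \<ge> 0" "\<eta> > 0"
  obtains n :: nat where "E * exp (- \<delta> * n) \<le> \<eta>"
proof -
  obtain n :: nat where n: "E / (\<eta> * \<delta>) < n" using reals_Archimedean2 by blast
  have "E \<le> \<eta> * (\<delta> * n)" using n assms \<delta>_pos by (simp add: field_simps)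
  also have "\<dots> \<le> \<eta> * exp (\<delta> * n)"
  proof (intro mult_left_mono)
    show "\<delta> * n \<le> exp (\<delta> * n)" using exp_ge_add_one_self[of "\<delta> * n"] by linarith
  qed (use assms in simp)
  finally have "E * exp (- \<delta> * n) \<le> \<eta> * exp (\<delta> * n) * exp (- \<delta> * n)" by (intro mult_right_mono) auto
  also have "\<dots> = \<eta>" by (simp add: mult.assoc exp_add[symmetric])
  finally show ?thesis using that by blast
qed

text \<open>Far from the support of c half of the exponential decay is given away as a small factor; the other half is
enough for Schur's test.\<close>

lemma shift_sum_tail:
  assumes \<eta>: "\<eta> > 0"
  shows "\<exists>M::nat. \<forall>x c I J. 0 \<le> x \<longrightarrow> x \<le> 1 \<longrightarrow> I \<subseteq> {- int N..int N} \<longrightarrow> finite J \<longrightarrow> (\<forall>m\<in>J. int M < \<bar>m\<bar>) \<longrightarrow>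
    (\<Sum>m\<in>J. (norm (shift_sum g c I (x + of_int m)))\<^sup>2) \<le> \<eta> * (\<Sum>k\<in>I. (norm (c k))\<^sup>2)"
proof -
  define T where "T = tail_const 1 (\<delta> / 2) * tail_const 1 (\<delta> / 2)"
  have T: "T \<ge> 0" using tail_const_pos[of 1 "\<delta> / 2"] \<delta>_pos by (simp add: T_def)
  obtain n :: nat where n: "(C * exp \<delta>)\<^sup>2 * T * exp (- \<delta> * n) \<le> \<eta>"
    using exp_decay_small[of "(C * exp \<delta>)\<^sup>2 * T" \<eta>] T \<eta> by auto
  show ?thesis
  proof (intro exI[of _ "N + n"] allI impI)
    fix x :: real and c :: "int \<Rightarrow> complex" and I J
    assume x: "0 \<le> x" "x \<le> 1" and I: "I \<subseteq> {- int N..int N}" and J: "finite J" "\<forall>m\<in>J. int (N + n) < \<bar>m\<bar>"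
    have fI: "finite I" using I finite_subset by blast
    let ?D = "C * exp \<delta> * exp (- \<delta> * n / 2)"
    let ?e = "\<lambda>m. \<Sum>k\<in>I. norm (c k) * exp (- (\<delta> / 2) * \<bar>real_of_int k - real_of_int m\<bar>)"
    have b: "norm (shift_sum g c I (x + of_int m)) \<le> ?D * ?e m" if m: "m \<in> J" for m
    proof -
      have "exp (- \<delta> * \<bar>real_of_int k - (x + of_int m)\<bar>) \<le> exp \<delta> * exp (- \<delta> * n / 2) * exp (- (\<delta> / 2) * \<bar>real_of_int k - real_of_int m\<bar>)"
        if k: "k \<in> I" for k
      proof -
        have halves: "b \<le> t \<Longrightarrow> t \<le> u + 1 \<Longrightarrow> b / 2 + t / 2 - 1 \<le> u" for b t u :: real by linarith
        have "k \<in> {- int N..int N}" using k I by blast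
        then have "\<bar>k\<bar> \<le> int N" by auto
        moreover have "int (N + n) < \<bar>m\<bar>" using J m by blast
        ultimately have "int n \<le> \<bar>k - m\<bar>" by linarith
        then have n_le: "real n \<le> \<bar>real_of_int k - real_of_int m\<bar>" by linarith
        have "\<bar>real_of_int k - real_of_int m\<bar> \<le> \<bar>real_of_int k - (x + of_int m)\<bar> + 1" using x by linarith
        with n_le have "\<bar>real_of_int k - (x + of_int m)\<bar> \<ge> real n / 2 + \<bar>real_of_int k - real_of_int m\<bar> / 2 - 1"
          by (rule halves)
        then have "\<delta> * \<bar>real_of_int k - (x + of_int m)\<bar> \<ge> \<delta> * (real n / 2 + \<bar>real_of_int k - real_of_int m\<bar> / 2 - 1)"
          using \<delta>_pos by (intro mult_left_mono) auto
        then show ?thesis unfolding exp_add[symmetric] exp_le_cancel_iff by (simp add: algebra_simps)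
      qed
      then have "C * (\<Sum>k\<in>I. norm (c k) * exp (- \<delta> * \<bar>real_of_int k - (x + of_int m)\<bar>))
         \<le> C * (\<Sum>k\<in>I. norm (c k) * (exp \<delta> * exp (- \<delta> * n / 2) * exp (- (\<delta> / 2) * \<bar>real_of_int k - real_of_int m\<bar>)))"
        by (intro mult_left_mono sum_mono C_nonneg) auto
      then show ?thesis using order_trans[OF shift_sum_bound[of c I "x + of_int m"]] by (simp add: sum_distrib_left mult_ac)
    qed
    have "(\<Sum>m\<in>J. (norm (shift_sum g c I (x + of_int m)))\<^sup>2) \<le> (\<Sum>m\<in>J. (?D * ?e m)\<^sup>2)"
      by (intro sum_mono power_mono b) auto
    also have "\<dots> = ?D\<^sup>2 * (\<Sum>m\<in>J. (?e m)\<^sup>2)"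
      unfolding power_mult_distrib[of ?D] by (rule sum_distrib_left[symmetric])
    also have "\<dots> \<le> ?D\<^sup>2 * (T * (\<Sum>k\<in>I. (norm (c k))\<^sup>2))"
      unfolding T_def
      by (intro mult_left_mono schur_test_indexed inj_of_int_real gap_of_int fI J) (use \<delta>_pos in auto)
    also have "\<dots> = ((C * exp \<delta>)\<^sup>2 * T * exp (- \<delta> * n)) * (\<Sum>k\<in>I. (norm (c k))\<^sup>2)"
    proof -
      have "(exp (- \<delta> * n / 2))\<^sup>2 = exp (- \<delta> * n)" by (simp add: power2_eq_square exp_add[symmetric])
      then show ?thesis by (simp add: power_mult_distrib mult_ac)
    qed
    also have "\<dots> \<le> \<eta> * (\<Sum>k\<in>I. (norm (c k))\<^sup>2)" by (intro mult_right_mono n sum_nonneg) auto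
    finally show "(\<Sum>m\<in>J. (norm (shift_sum g c I (x + of_int m)))\<^sup>2) \<le> \<eta> * (\<Sum>k\<in>I. (norm (c k))\<^sup>2)" .
  qed
qed

text \<open>The finite range of m, uniform in all sequences with a common finite support, makes the number of sampling
points in the next theorem finite, so that they can be interchanged with integration in x later.\<close>

lemma riesz_lower_bound_truncated:
  assumes "fourier_nonvanishing g"
  obtains X a where "finite X" "X \<subseteq> {0..<1}" "a > 0"
    "\<forall>N. \<exists>M::nat. \<forall>c I. I \<subseteq> {- int N..int N} \<longrightarrow>
       a * (\<Sum>k\<in>I. (norm (c k))\<^sup>2) \<le> (\<Sum>x\<in>X. \<Sum>m\<in>{- int M..int M}. (norm (shift_sum g c I (x + of_int m)))\<^sup>2)"
proof -
  obtain X a where X: "finite X" "X \<subseteq> {0..<1}" "a > 0" and low: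
    "\<forall>c I. finite I \<longrightarrow> a * (\<Sum>k\<in>I. (norm (c k))\<^sup>2) \<le> (\<Sum>x\<in>X. \<Sum>\<^sub>\<infinity>m. (norm (shift_sum g c I (x + of_int m)))\<^sup>2)"
    by (rule riesz_lower_bound[OF assms])
  \<comment> \<open>The tails at all points of X together may use up half of the lower bound.\<close>
  define \<eta> where "\<eta> = a / (2 * (real (card X) + 1))"
  have \<eta>: "\<eta> > 0" using X by (simp add: \<eta>_def)
  have \<eta>2: "card X * \<eta> \<le> a / 2" using X by (simp add: \<eta>_def field_simps)
  have "\<exists>M::nat. \<forall>c I. I \<subseteq> {- int N..int N} \<longrightarrow>
       a / 2 * (\<Sum>k\<in>I. (norm (c k))\<^sup>2) \<le> (\<Sum>x\<in>X. \<Sum>m\<in>{- int M..int M}. (norm (shift_sum g c I (x + of_int m)))\<^sup>2)" for N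
  proof -
    obtain M :: nat where M: "\<And>x c I J. 0 \<le> x \<Longrightarrow> x \<le> 1 \<Longrightarrow> I \<subseteq> {- int N..int N} \<Longrightarrow> finite J \<Longrightarrow> (\<forall>m\<in>J. int M < \<bar>m\<bar>) \<Longrightarrow>
      (\<Sum>m\<in>J. (norm (shift_sum g c I (x + of_int m)))\<^sup>2) \<le> \<eta> * (\<Sum>k\<in>I. (norm (c k))\<^sup>2)"
      using shift_sum_tail[OF \<eta>] by blast
    show ?thesis
    proof (intro exI[of _ M] allI impI)
      fix c :: "int \<Rightarrow> complex" and I assume I: "I \<subseteq> {- int N..int N}"
      have fI: "finite I" using I finite_subset by blast
      let ?n = "\<Sum>k\<in>I. (norm (c k))\<^sup>2" and ?W = "{- int M..int M}"
      have n0: "?n \<ge> 0" by (intro sum_nonneg) auto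
      have x: "(\<Sum>\<^sub>\<infinity>m. (norm (shift_sum g c I (x + of_int m)))\<^sup>2) \<le> (\<Sum>m\<in>?W. (norm (shift_sum g c I (x + of_int m)))\<^sup>2) + \<eta> * ?n"
        if "x \<in> X" for x
      proof -
        let ?h = "\<lambda>m::int. (norm (shift_sum g c I (x + of_int m)))\<^sup>2"
        have x01: "0 \<le> x" "x \<le> 1" using that X by auto
        show ?thesis
        proof (rule infsum_le_finite_sums)
          show "?h summable_on UNIV" using shift_sum_parseval[OF fI x01] by (rule has_sum_imp_summable)
          fix F :: "int set" assume F: "finite F"
          have "sum ?h F = sum ?h (F \<inter> ?W) + sum ?h (F - ?W)" using F by (subst sum.union_disjoint[symmetric]) (auto intro: sum.cong)
          also have "sum ?h (F \<inter> ?W) \<le> sum ?h ?W" by (intro sum_mono2) auto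
          also have "sum ?h (F - ?W) \<le> \<eta> * ?n" using F by (intro M x01 I) auto
          finally show "sum ?h F \<le> sum ?h ?W + \<eta> * ?n" by simp
        qed
      qed
      have "a * ?n \<le> (\<Sum>x\<in>X. (\<Sum>m\<in>?W. (norm (shift_sum g c I (x + of_int m)))\<^sup>2) + \<eta> * ?n)"
        by (rule order_trans[OF low[rule_format, OF fI] sum_mono[OF x]])
      also have "\<dots> = (\<Sum>x\<in>X. \<Sum>m\<in>?W. (norm (shift_sum g c I (x + of_int m)))\<^sup>2) + card X * \<eta> * ?n"
        by (simp add: sum.distrib)
      also have "card X * \<eta> * ?n \<le> a / 2 * ?n" by (intro mult_right_mono \<eta>2 n0)
      finally have "a * ?n \<le> (\<Sum>x\<in>X. \<Sum>m\<in>?W. (norm (shift_sum g c I (x + of_int m)))\<^sup>2) + a / 2 * ?n" by simp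
      moreover have "a * ?n = a / 2 * ?n + a / 2 * ?n" by simp
      ultimately show "a / 2 * ?n \<le> (\<Sum>x\<in>X. \<Sum>m\<in>?W. (norm (shift_sum g c I (x + of_int m)))\<^sup>2)" by linarith
    qed
  qed
  then show ?thesis using that[of X "a / 2"] X by simp
qed

end

sublocale exp_rational \<subseteq> decaying_generator g "exp (2 * A)" \<delta>
  by unfold_locales (use g_continuous g_bound delta in auto)

context exp_rational
begin

text \<open>The constant a does not depend on the support of c, whereas the window R does. In the proof \<epsilon> is chosen after
the finite set X of base points, so that the total error of the local inequality at these points is at most half
of the lower bound.\<close>

theorem sampling_inequality:
  assumes nv: "fourier_nonvanishing g" and L: "L \<ge> 1" and s: "s > 0"
  shows "\<exists>a>0. \<forall>N::nat. \<exists>R. \<forall>\<Gamma> c I. gap s \<Gamma> \<longrightarrow> dense_blocks L ((q + \<gamma>) * L + 1) \<Gamma> \<longrightarrow> I \<subseteq> {- int N..int N} \<longrightarrow>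
     a * (\<Sum>k\<in>I. (norm (c k))\<^sup>2) \<le> (\<Sum>y\<in>\<Gamma> \<inter> {- R..R}. (norm (shift_sum g c I y))\<^sup>2)"
proof -
  obtain X a where X: "finite X" "X \<subseteq> {0..<1}" "a > 0" and low:
    "\<forall>N. \<exists>M::nat. \<forall>c I. I \<subseteq> {- int N..int N} \<longrightarrow>
       a * (\<Sum>k\<in>I. (norm (c k))\<^sup>2) \<le> (\<Sum>x\<in>X. \<Sum>m\<in>{- int M..int M}. (norm (shift_sum g c I (x + of_int m)))\<^sup>2)"
    by (rule riesz_lower_bound_truncated[OF nv])
  define T where "T = tail_const 1 \<delta> * tail_const 1 \<delta>"
  have T: "T > 0" using tail_const_pos[of 1 \<delta>] delta by (simp add: T_def)
  \<comment> \<open>The error at the points of X adds up to card X * 2 * \<epsilon>^2 * T times the squared norm of c; this is at most half of the lower bound a.\<close>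
  define \<epsilon> where "\<epsilon> = sqrt (a / (4 * (real (card X) + 1) * T))"
  have \<epsilon>: "\<epsilon> > 0" using X T by (simp add: \<epsilon>_def)
  have \<epsilon>2: "card X * (2 * \<epsilon>\<^sup>2 * T) \<le> a / 2"
  proof -
    have "2 * \<epsilon>\<^sup>2 * T = a / (2 * (real (card X) + 1))"
    proof -
      have "\<epsilon>\<^sup>2 = a / (4 * (real (card X) + 1) * T)" unfolding \<epsilon>_def using X T by (intro real_sqrt_pow2) simp
      moreover have "2 * (a / (4 * r * T)) * T = a / (2 * r)" for r using T by simp
      ultimately show ?thesis by (simp only:)
    qed
    moreover have "card X * (a / (2 * (real (card X) + 1))) \<le> a / 2" using X by (simp add: field_simps)
    ultimately show ?thesis by (simp only:)
  qed
  obtain R K where RK: "0 \<le> R" "0 \<le> K" and ls: "\<And>\<Gamma> c I x (m::int). gap s \<Gamma> \<Longrightarrow> dense_blocks L ((q + \<gamma>) * L + 1) \<Gamma> \<Longrightarrow> 0 \<le> x \<Longrightarrow> x \<le> 1 \<Longrightarrow>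
     norm (shift_sum g c I (x + m)) \<le> K * (\<Sum>l\<in>\<Gamma> \<inter> {m - R..m + R}. norm (shift_sum g c I l))
        + \<epsilon> * (\<Sum>k\<in>I. norm (c k) * exp (- \<delta> * \<bar>real_of_int k - m\<bar>))"
    using local_sampling[OF L s \<epsilon>] by blast
  define B where "B = 2 * (K * exp R)\<^sup>2 * (tail_const s 1 * tail_const 1 1)"
  have B: "B \<ge> 0" using tail_const_pos[of s 1] tail_const_pos[of 1 1] s by (simp add: B_def)
  define a' where "a' = a / 2 / (card X * B + 1)"
  have a': "a' > 0" using X B by (simp add: a'_def add_nonneg_pos)
  show ?thesis
  proof (rule exI[of _ a'], intro conjI a' allI)
    fix N
    obtain M :: nat where M: "\<And>c I. I \<subseteq> {- int N..int N} \<Longrightarrow>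
       a * (\<Sum>k\<in>I. (norm (c k))\<^sup>2) \<le> (\<Sum>x\<in>X. \<Sum>m\<in>{- int M..int M}. (norm (shift_sum g c I (x + of_int m)))\<^sup>2)"
      using low by blast
    let ?R = "real M + R" and ?J = "{- int M..int M}"
    show "\<exists>R. \<forall>\<Gamma> c I. gap s \<Gamma> \<longrightarrow> dense_blocks L ((q + \<gamma>) * L + 1) \<Gamma> \<longrightarrow> I \<subseteq> {- int N..int N} \<longrightarrow>
     a' * (\<Sum>k\<in>I. (norm (c k))\<^sup>2) \<le> (\<Sum>y\<in>\<Gamma> \<inter> {- R..R}. (norm (shift_sum g c I y))\<^sup>2)"
    proof (intro exI[of _ ?R] allI impI)
      fix \<Gamma> and c :: "int \<Rightarrow> complex" and I
      assume \<Gamma>: "gap s \<Gamma>" "dense_blocks L ((q + \<gamma>) * L + 1) \<Gamma>" and I: "I \<subseteq> {- int N..int N}"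
      have fI: "finite I" using I finite_subset by blast
      let ?\<Gamma> = "\<Gamma> \<inter> {- ?R..?R}" and ?f = "shift_sum g c I"
      let ?n = "\<Sum>k\<in>I. (norm (c k))\<^sup>2" and ?S = "\<Sum>y\<in>?\<Gamma>. (norm (?f y))\<^sup>2"
      have f\<Gamma>: "finite ?\<Gamma>" by (rule gap_finite_Int[OF \<Gamma>(1)]) simp
      have S0: "?S \<ge> 0" and n0: "?n \<ge> 0" by (intro sum_nonneg; simp)+
      have step: "(\<Sum>m\<in>?J. (norm (?f (x + of_int m)))\<^sup>2) \<le> B * ?S + 2 * \<epsilon>\<^sup>2 * T * ?n" if x: "x \<in> X" for x
      proof -
        let ?u = "\<lambda>m. \<Sum>l\<in>?\<Gamma>. norm (?f l) * exp (- 1 * \<bar>l - real_of_int m\<bar>)"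
        let ?v = "\<lambda>m. \<Sum>k\<in>I. norm (c k) * exp (- \<delta> * \<bar>real_of_int k - real_of_int m\<bar>)"
        have "(norm (?f (x + of_int m)))\<^sup>2 \<le> 2 * (K * exp R)\<^sup>2 * (?u m)\<^sup>2 + 2 * \<epsilon>\<^sup>2 * (?v m)\<^sup>2" if m: "m \<in> ?J" for m
        proof -
          have "(\<Sum>l\<in>\<Gamma> \<inter> {m - R..m + R}. norm (?f l)) \<le> exp R * ?u m"
          proof -
            have "(\<Sum>l\<in>\<Gamma> \<inter> {m - R..m + R}. norm (?f l)) \<le> (\<Sum>l\<in>\<Gamma> \<inter> {m - R..m + R}. exp R * (norm (?f l) * exp (- 1 * \<bar>l - real_of_int m\<bar>)))"
            proof (rule sum_mono)
              fix l assume "l \<in> \<Gamma> \<inter> {m - R..m + R}"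
              \<comment> \<open>Inside the window the weight exp(R - |l-m|) is at least 1; this turns the windowed sum into one to which Schur's test applies.\<close>
              then have "1 \<le> exp R * exp (- 1 * \<bar>l - real_of_int m\<bar>)"
                unfolding exp_add[symmetric] by (auto simp: abs_le_iff)
              from mult_left_mono[OF this, of "norm (?f l)"] show "norm (?f l) \<le> exp R * (norm (?f l) * exp (- 1 * \<bar>l - real_of_int m\<bar>))"
                by (simp add: mult_ac)
            qed
            also have "\<dots> \<le> (\<Sum>l\<in>?\<Gamma>. exp R * (norm (?f l) * exp (- 1 * \<bar>l - real_of_int m\<bar>)))"
            proof (rule sum_mono2[OF f\<Gamma>])
              have "\<bar>real_of_int m\<bar> \<le> real M" using m by auto
              then show "\<Gamma> \<inter> {m - R..m + R} \<subseteq> ?\<Gamma>" by auto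
            qed simp
            finally show ?thesis by (simp add: sum_distrib_left)
          qed
          then have "K * (\<Sum>l\<in>\<Gamma> \<inter> {m - R..m + R}. norm (?f l)) \<le> (K * exp R) * ?u m"
            using mult_left_mono[OF _ RK(2)] by (simp add: mult.assoc)
          moreover have "norm (?f (x + m)) \<le> K * (\<Sum>l\<in>\<Gamma> \<inter> {m - R..m + R}. norm (?f l)) + \<epsilon> * ?v m"
            by (rule ls[OF \<Gamma>]) (use x X in auto)
          ultimately have "norm (?f (x + m)) \<le> (K * exp R) * ?u m + \<epsilon> * ?v m" by linarith
          then have "(norm (?f (x + m)))\<^sup>2 \<le> ((K * exp R) * ?u m + \<epsilon> * ?v m)\<^sup>2" by (intro power_mono) auto
          also have "\<dots> \<le> 2 * ((K * exp R) * ?u m)\<^sup>2 + 2 * (\<epsilon> * ?v m)\<^sup>2" by (rule sum_sq_le)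
          finally show ?thesis by (simp only: power_mult_distrib mult.assoc)
        qed
        then have "(\<Sum>m\<in>?J. (norm (?f (x + of_int m)))\<^sup>2) \<le> (\<Sum>m\<in>?J. 2 * (K * exp R)\<^sup>2 * (?u m)\<^sup>2 + 2 * \<epsilon>\<^sup>2 * (?v m)\<^sup>2)"
          by (rule sum_mono)
        also have "\<dots> = 2 * (K * exp R)\<^sup>2 * (\<Sum>m\<in>?J. (?u m)\<^sup>2) + 2 * \<epsilon>\<^sup>2 * (\<Sum>m\<in>?J. (?v m)\<^sup>2)"
          by (simp only: sum.distrib sum_distrib_left)
        also have "\<dots> \<le> 2 * (K * exp R)\<^sup>2 * (tail_const s 1 * tail_const 1 1 * ?S) + 2 * \<epsilon>\<^sup>2 * (tail_const 1 \<delta> * tail_const 1 \<delta> * ?n)"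
        proof (intro add_mono mult_left_mono)
          show "(\<Sum>m\<in>?J. (?u m)\<^sup>2) \<le> tail_const s 1 * tail_const 1 1 * ?S"
            by (rule schur_test_indexed[where u = "\<lambda>l. l"])
               (use f\<Gamma> gap_subset[OF \<Gamma>(1), of ?\<Gamma>] gap_of_int inj_of_int_real in auto)
          show "(\<Sum>m\<in>?J. (?v m)\<^sup>2) \<le> tail_const 1 \<delta> * tail_const 1 \<delta> * ?n"
            by (rule schur_test_indexed) (use fI gap_of_int inj_of_int_real delta in auto)
        qed auto
        finally show ?thesis by (simp only: B_def T_def mult.assoc)
      qed
      have "a * ?n \<le> (\<Sum>x\<in>X. B * ?S + 2 * \<epsilon>\<^sup>2 * T * ?n)" by (rule order_trans[OF M[OF I] sum_mono[OF step]])
      also have "\<dots> = card X * B * ?S + card X * (2 * \<epsilon>\<^sup>2 * T) * ?n" by (simp add: algebra_simps)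
      also have "\<dots> \<le> (card X * B + 1) * ?S + a / 2 * ?n"
        using S0 n0 by (intro add_mono mult_right_mono \<epsilon>2) auto
      finally have "a * ?n \<le> (card X * B + 1) * ?S + a / 2 * ?n" .
      moreover have "a * ?n = a / 2 * ?n + a / 2 * ?n" by simp
      ultimately have "a / 2 * ?n \<le> (card X * B + 1) * ?S" by linarith
      have D: "0 < card X * B + 1" using B by (simp add: add_nonneg_pos)
      from \<open>a / 2 * ?n \<le> (card X * B + 1) * ?S\<close> have "a / 2 * ?n \<le> ?S * (card X * B + 1)" by (subst mult.commute)
      then have "(a / 2 * ?n) / (card X * B + 1) \<le> ?S" unfolding pos_divide_le_eq[OF D] .
      then show "a' * ?n \<le> ?S" unfolding a'_def by (simp only: times_divide_eq_left)
    qed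
  qed
qed

end

section \<open>From stable sampling to Gabor frames\<close>

text \<open>For compact support the decomposition into unit intervals is a finite sum and commutes with integration.\<close>

lemma integral_compact_support:
  fixes F :: "real \<Rightarrow> complex"
  assumes F: "integrable lborel F" and supp: "\<And>x. real N < \<bar>x\<bar> \<Longrightarrow> F x = 0"
  shows "integrable \<U> (\<lambda>x. F (x + of_int k))"
    and "(LINT x|lborel. F x) = (LINT x|\<U>. (\<Sum>k\<in>{- int (N + 1)..int (N + 1)}. F (x + of_int k)))"
proof -
  show i: "integrable \<U> (\<lambda>x. F (x + of_int k))" for k
  proof -
    have "integrable lborel (\<lambda>x. F (of_int k + 1 * x))" using F by (intro lborel_integrable_real_affine) auto
    then have "integrable lborel (\<lambda>x. indicat_real {0..<1} x *\<^sub>R F (x + of_int k))"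
      by (intro integrable_mult_indicator) (auto simp: add.commute)
    then show ?thesis by (subst integrable_restrict_space) auto
  qed
  let ?I = "{- int (N + 1)..int (N + 1)}"
  have z: "(LINT x|\<U>. F (x + of_int k)) = 0" if "k \<notin> ?I" for k
  proof -
    have "(LINT x|\<U>. F (x + of_int k)) = (LINT x|\<U>. 0)"
    proof (intro Bochner_Integration.integral_cong refl supp)
      fix x assume "x \<in> space \<U>"
      then have x: "0 \<le> x" "x < 1" by auto
      have "int N + 1 < \<bar>k\<bar>" using that by auto
      then have "real N + 1 < \<bar>real_of_int k\<bar>" by linarith
      then show "real N < \<bar>x + of_int k\<bar>" using x by linarith
    qed
    then show ?thesis by simp
  qed
  have inj: "inj_on int_encode ?I" by (rule inj_int_encode)
  have "(LINT x|lborel. F x) = (\<Sum>n. LINT x|\<U>. F (x + of_int (int_decode n)))"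
    by (rule integral_sum_unit_intervals[OF F])
  also have "\<dots> = (\<Sum>n\<in>int_encode ` ?I. LINT x|\<U>. F (x + of_int (int_decode n)))"
  proof (rule suminf_finite)
    fix n assume "n \<notin> int_encode ` ?I"
    then have "int_decode n \<notin> ?I" by (metis imageI int_decode_inverse)
    then show "(LINT x|\<U>. F (x + of_int (int_decode n))) = 0" by (rule z)
  qed simp
  also have "\<dots> = (\<Sum>k\<in>?I. LINT x|\<U>. F (x + of_int k))"
    unfolding sum.reindex[OF inj] by simp
  also have "\<dots> = (LINT x|\<U>. (\<Sum>k\<in>?I. F (x + of_int k)))"
    by (rule Bochner_Integration.integral_sum[symmetric]) (rule i)
  finally show "(LINT x|lborel. F x) = (LINT x|\<U>. (\<Sum>k\<in>?I. F (x + of_int k)))" .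
qed

lemma cnj_measurable: "h \<in> borel_measurable M \<Longrightarrow> (\<lambda>x. cnj (h x)) \<in> borel_measurable M"
  by (erule measurable_compose)
    (intro borel_measurable_continuous_onI continuous_on_cnj continuous_on_id)

lemma L2_product_integrable:
  assumes "f \<in> L2_functions" "h \<in> L2_functions"
  shows "integrable lborel (\<lambda>x. f x * cnj (h x))"
proof (rule Bochner_Integration.integrable_bound)
  have [measurable]: "f \<in> borel_measurable borel" "h \<in> borel_measurable borel"
    using assms by (auto simp: L2_functions_def)
  show "integrable lborel (\<lambda>x. (norm (f x))\<^sup>2 + (norm (h x))\<^sup>2)"
    using assms by (intro Bochner_Integration.integrable_add) (auto simp: L2_functions_def)
  show "(\<lambda>x. f x * cnj (h x)) \<in> borel_measurable lborel"
    using assms by (intro borel_measurable_times cnj_measurable) (auto simp: L2_functions_def)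
  have "a * b \<le> a\<^sup>2 + b\<^sup>2" if "0 \<le> a" "0 \<le> b" for a b :: real
    using sum_squares_bound[of a b] mult_nonneg_nonneg[OF that] by linarith
  then show "AE x in lborel. norm (f x * cnj (h x)) \<le> norm ((norm (f x))\<^sup>2 + (norm (h x))\<^sup>2)"
    by (intro AE_I2) (simp add: norm_mult)
qed

lemma L2_norm_sq: "(L2_norm f)\<^sup>2 = (LINT x|lborel. (norm (f x))\<^sup>2)"
  unfolding L2_norm_def by (simp add: Bochner_Integration.integral_nonneg)

lemma L2_diff:
  assumes "f \<in> L2_functions" "h \<in> L2_functions"
  shows "(\<lambda>x. f x - h x) \<in> L2_functions"
proof -
  have [measurable]: "f \<in> borel_measurable borel" "h \<in> borel_measurable borel"
    using assms by (auto simp: L2_functions_def)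
  have "integrable lborel (\<lambda>x. 2 * (norm (f x))\<^sup>2 + 2 * (norm (h x))\<^sup>2)"
    using assms by (intro Bochner_Integration.integrable_add integrable_mult_right) (auto simp: L2_functions_def)
  then have "integrable lborel (\<lambda>x. (norm (f x - h x))\<^sup>2)"
  proof (rule Bochner_Integration.integrable_bound)
    show "AE x in lborel. norm ((norm (f x - h x))\<^sup>2) \<le> norm (2 * (norm (f x))\<^sup>2 + 2 * (norm (h x))\<^sup>2)"
      using norm_add_sq_le[of "f _" "- h _"] by (intro AE_I2) simp
  qed simp
  then show ?thesis by (simp add: L2_functions_def)
qed

definition truncate :: "nat \<Rightarrow> (real \<Rightarrow> complex) \<Rightarrow> real \<Rightarrow> complex" where
  "truncate N f x = indicator {- real N..real N} x * f x"

lemma norm_truncate: "norm (truncate N f x) \<le> norm (f x)"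
  by (simp add: truncate_def indicator_def)

lemma truncate_measurable: "f \<in> borel_measurable borel \<Longrightarrow> truncate N f \<in> borel_measurable borel"
  unfolding truncate_def[abs_def] by measurable

lemma truncate_L2:
  assumes "f \<in> L2_functions" shows "truncate N f \<in> L2_functions"
proof -
  have [measurable]: "f \<in> borel_measurable borel" using assms by (simp add: L2_functions_def)
  note [measurable] = truncate_measurable
  have i: "integrable lborel (\<lambda>x. (norm (f x))\<^sup>2)" using assms by (simp add: L2_functions_def)
  have "integrable lborel (\<lambda>x. (norm (truncate N f x))\<^sup>2)"
    by (rule Bochner_Integration.integrable_bound[OF i])
       (auto intro!: power_mono norm_truncate measurable_compose[OF truncate_measurable])
  then show ?thesis by (simp add: L2_functions_def truncate_measurable)
qed

lemma truncate_eventually: "\<forall>\<^sub>F N in sequentially. truncate N f x = f x"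
proof -
  obtain N0 :: nat where "\<bar>x\<bar> \<le> N0" using real_arch_simple by blast
  then have "truncate N f x = f x" if "N \<ge> N0" for N
    using that by (auto simp: truncate_def indicator_def abs_le_iff)
  then show ?thesis using eventually_sequentially by blast
qed

lemma truncate_inner_tendsto:
  assumes "f \<in> L2_functions" "h \<in> L2_functions"
  shows "(\<lambda>N. L2_inner (truncate N f) h) \<longlonglongrightarrow> L2_inner f h"
  unfolding L2_inner_def
proof (rule integral_dominated_convergence)
  have m[measurable]: "f \<in> borel_measurable borel" "h \<in> borel_measurable borel"
    using assms by (auto simp: L2_functions_def)
  show "(\<lambda>x. f x * cnj (h x)) \<in> borel_measurable lborel"
    by (intro borel_measurable_times cnj_measurable) simp_all
  show "(\<lambda>x. truncate N f x * cnj (h x)) \<in> borel_measurable lborel" for N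
    using truncate_measurable[OF m(1), of N] by (intro borel_measurable_times cnj_measurable) simp_all
  show "integrable lborel (\<lambda>x. norm (f x * cnj (h x)))"
    by (rule integrable_norm[OF L2_product_integrable[OF assms]])
  show "AE x in lborel. (\<lambda>N. truncate N f x * cnj (h x)) \<longlonglongrightarrow> f x * cnj (h x)"
    by (intro AE_I2 tendsto_mult tendsto_const tendsto_eventually truncate_eventually)
  show "AE x in lborel. norm (truncate N f x * cnj (h x)) \<le> norm (f x * cnj (h x))" for N
    by (intro AE_I2) (auto simp: norm_mult intro!: mult_right_mono norm_truncate)
qed

lemma truncate_norm_tendsto:
  assumes "f \<in> L2_functions"
  shows "(\<lambda>N. (L2_norm (truncate N f))\<^sup>2) \<longlonglongrightarrow> (L2_norm f)\<^sup>2"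
  unfolding L2_norm_sq
proof (rule integral_dominated_convergence)
  have m[measurable]: "f \<in> borel_measurable borel" using assms by (auto simp: L2_functions_def)
  show "(\<lambda>x. (norm (f x))\<^sup>2) \<in> borel_measurable lborel" by simp
  show "(\<lambda>x. (norm (truncate N f x))\<^sup>2) \<in> borel_measurable lborel" for N
    using truncate_measurable[OF m(1), of N] by simp
  show "integrable lborel (\<lambda>x. (norm (f x))\<^sup>2)" using assms by (simp add: L2_functions_def)
  show "AE x in lborel. (\<lambda>N. (norm (truncate N f x))\<^sup>2) \<longlonglongrightarrow> (norm (f x))\<^sup>2"
    by (intro AE_I2 tendsto_power tendsto_norm tendsto_eventually truncate_eventually)
  show "AE x in lborel. norm ((norm (truncate N f x))\<^sup>2) \<le> (norm (f x))\<^sup>2" for N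
    by (intro AE_I2) (auto intro!: power_mono norm_truncate)
qed

lemma truncate_remainder_norm:
  assumes "f \<in> L2_functions"
  shows "(L2_norm (\<lambda>x. f x - truncate N f x))\<^sup>2 = (L2_norm f)\<^sup>2 - (L2_norm (truncate N f))\<^sup>2"
proof -
  have "(norm (f x - truncate N f x))\<^sup>2 = (norm (f x))\<^sup>2 - (norm (truncate N f x))\<^sup>2" for x
    by (simp add: truncate_def indicator_def)
  then show ?thesis
    unfolding L2_norm_sq using assms truncate_L2[OF assms, of N]
    by (simp add: L2_functions_def Bochner_Integration.integral_diff)
qed

context decaying_generator
begin

text \<open>For fixed x, this is the sequence f(x+k) paired with the translate of g along x + \<int>. Its Fourier coefficients
in x are the Gabor coefficients of f.\<close>

definition fiber :: "(real \<Rightarrow> complex) \<Rightarrow> int set \<Rightarrow> real \<Rightarrow> real \<Rightarrow> complex" where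
  "fiber f I l x = (\<Sum>k\<in>I. f (x + of_int k) * cnj (g (x + of_int k - l)))"

definition gabor_energy :: "(real \<Rightarrow> complex) \<Rightarrow> real \<times> real \<Rightarrow> real" where
  "gabor_energy f = (\<lambda>(l, \<xi>). (cmod (L2_inner f (modulation \<xi> (translation l g))))\<^sup>2)"

lemma gabor_energy_nonneg: "0 \<le> gabor_energy f p"
  by (simp add: gabor_energy_def split: prod.split)

text \<open>Up to conjugation a fiber is a shift sum evaluated at x - l, with the sequence f(x+k) reversed; this is why
the sampling set is x - \<Lambda> and why a symmetric range of k is convenient.\<close>

lemma norm_fiber:
  assumes "I = {- int N..int N}"
  shows "norm (fiber f I l x) = norm (shift_sum g (\<lambda>k. cnj (f (x - of_int k))) I (x - l))"
proof -
  have "cnj (fiber f I l x) = (\<Sum>k\<in>I. cnj (f (x + of_int k)) * g (x + of_int k - l))"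
    by (simp add: fiber_def)
  also have "\<dots> = shift_sum g (\<lambda>k. cnj (f (x - of_int k))) I (x - l)"
    unfolding shift_sum_def
    by (rule sum.reindex_bij_witness[of _ uminus uminus]) (auto simp: assms algebra_simps)
  finally show ?thesis by (metis complex_mod_cnj)
qed

lemma atom_L2: "modulation \<xi> (translation l g) \<in> L2_functions"
proof -
  have gl: "(\<lambda>x. g (x - l)) \<in> borel_measurable borel"
    by (rule measurable_compose[OF _ g_measurable]) simp
  have ex: "(\<lambda>x::real. exp (2 * of_real pi * \<i> * of_real \<xi> * of_real x)) \<in> borel_measurable borel"
    by (intro borel_measurable_continuous_onI continuous_intros)
  have m: "modulation \<xi> (translation l g) \<in> borel_measurable borel"
    unfolding modulation_def[abs_def] translation_def using gl ex by simp
  have n: "norm (modulation \<xi> (translation l g) x) = norm (g (x - l))" for x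
    by (simp add: modulation_def translation_def norm_mult)
  have "integrable lborel (\<lambda>x. C * norm (g (- l + 1 * x)))"
    using g_integrable by (intro integrable_mult_right integrable_norm lborel_integrable_real_affine) auto
  then have "integrable lborel (\<lambda>x. (norm (modulation \<xi> (translation l g) x))\<^sup>2)"
  proof (rule Bochner_Integration.integrable_bound)
    have "norm (g y) \<le> C" for y
      using order_trans[OF g_decay[of y] mult_left_mono[OF _ C_nonneg, of "exp (- \<delta> * \<bar>y\<bar>)" 1]] \<delta>_pos by simp
    then have "(norm (g y))\<^sup>2 \<le> C * norm (g y)" for y
      unfolding power2_eq_square by (intro mult_right_mono) auto
    then show "AE x in lborel. norm ((norm (modulation \<xi> (translation l g) x))\<^sup>2) \<le> norm (C * norm (g (- l + 1 * x)))"
      using C_nonneg by (intro AE_I2) (simp add: n abs_mult)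
    show "(\<lambda>x. (norm (modulation \<xi> (translation l g) x))\<^sup>2) \<in> borel_measurable lborel" using m by simp
  qed
  then show ?thesis using m by (simp add: L2_functions_def)
qed

lemma gabor_energy_diff:
  assumes "f \<in> L2_functions" "h \<in> L2_functions"
  shows "gabor_energy h p \<le> 2 * gabor_energy f p + 2 * gabor_energy (\<lambda>x. f x - h x) p"
proof -
  obtain l \<xi> where p: "p = (l, \<xi>)" by force
  let ?a = "modulation \<xi> (translation l g)"
  have "L2_inner (\<lambda>x. f x - h x) ?a = L2_inner f ?a - L2_inner h ?a"
    unfolding L2_inner_def left_diff_distrib
    by (intro Bochner_Integration.integral_diff L2_product_integrable assms atom_L2)
  then have "L2_inner h ?a = L2_inner f ?a + - L2_inner (\<lambda>x. f x - h x) ?a" by simp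
  then show ?thesis unfolding p gabor_energy_def prod.case
    using norm_add_sq_le[of "L2_inner f ?a" "- L2_inner (\<lambda>x. f x - h x) ?a"] by simp
qed

context
  fixes f :: "real \<Rightarrow> complex" and N :: nat and I :: "int set"
  assumes f: "f \<in> L2_functions" and supp: "\<And>x. real N < \<bar>x\<bar> \<Longrightarrow> f x = 0"
    and I_def: "I = {- int (N + 1)..int (N + 1)}"
begin

lemma compact_norm:
  "integrable \<U> (\<lambda>x. \<Sum>k\<in>I. (norm (f (x + of_int k)))\<^sup>2)"
  "(L2_norm f)\<^sup>2 = (LINT x|\<U>. (\<Sum>k\<in>I. (norm (f (x + of_int k)))\<^sup>2))"
proof -
  let ?F = "\<lambda>x. complex_of_real ((norm (f x))\<^sup>2)"
  have i: "integrable lborel ?F" using f by (intro integrable_of_real) (simp add: L2_functions_def)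
  have s: "\<And>x. real N < \<bar>x\<bar> \<Longrightarrow> ?F x = 0" using supp by simp
  have "integrable \<U> (\<lambda>x. complex_of_real (\<Sum>k\<in>I. (norm (f (x + of_int k)))\<^sup>2))"
    unfolding of_real_sum by (intro Bochner_Integration.integrable_sum integral_compact_support(1)[OF i s])
  from Bochner_Integration.integrable_Re[OF this]
  show "integrable \<U> (\<lambda>x. \<Sum>k\<in>I. (norm (f (x + of_int k)))\<^sup>2)" unfolding Re_complex_of_real .
  have "complex_of_real ((L2_norm f)\<^sup>2) = (LINT x|lborel. ?F x)"
    unfolding L2_norm_sq integral_complex_of_real ..
  also have "\<dots> = (LINT x|\<U>. complex_of_real (\<Sum>k\<in>I. (norm (f (x + of_int k)))\<^sup>2))"
    unfolding of_real_sum I_def by (rule integral_compact_support(2)[OF i s])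
  finally show "(L2_norm f)\<^sup>2 = (LINT x|\<U>. (\<Sum>k\<in>I. (norm (f (x + of_int k)))\<^sup>2))"
    unfolding integral_complex_of_real of_real_eq_iff .
qed

lemma fiber_measurable: "fiber f I l \<in> borel_measurable \<U>"
proof -
  have fm: "f \<in> borel_measurable borel" using f by (simp add: L2_functions_def)
  have "(\<lambda>x. f (x + of_int k)) \<in> borel_measurable borel" for k
    by (rule measurable_compose[OF _ fm]) simp
  moreover have "(\<lambda>x. g (x + of_int k - l)) \<in> borel_measurable borel" for k
    by (rule measurable_compose[OF _ g_measurable]) simp
  ultimately show ?thesis unfolding fiber_def[abs_def]
    by (intro measurable_U borel_measurable_sum borel_measurable_times cnj_measurable)
qed

lemma coefficient_energy:
  "(\<Sum>k\<in>I. (norm (cnj (f (x - of_int k))))\<^sup>2) = (\<Sum>k\<in>I. (norm (f (x + of_int k)))\<^sup>2)"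
  by (rule sum.reindex_bij_witness[of _ uminus uminus]) (auto simp: I_def)

lemma fiber_bessel:
  assumes J: "gap s J" "finite J"
  shows "(\<Sum>l\<in>J. (norm (fiber f I l x))\<^sup>2) \<le> C\<^sup>2 * (tail_const 1 \<delta> * tail_const s \<delta>) * (\<Sum>k\<in>I. (norm (f (x + of_int k)))\<^sup>2)"
proof -
  have inj: "inj_on (\<lambda>l. x - l) J" by (auto intro!: inj_onI)
  have "(\<Sum>l\<in>J. (norm (fiber f I l x))\<^sup>2) = (\<Sum>y\<in>(\<lambda>l. x - l) ` J. (norm (shift_sum g (\<lambda>k. cnj (f (x - of_int k))) I y))\<^sup>2)"
    unfolding sum.reindex[OF inj] by (simp add: norm_fiber[OF I_def])
  also have "\<dots> \<le> C\<^sup>2 * (tail_const 1 \<delta> * tail_const s \<delta>) * (\<Sum>k\<in>I. (norm (cnj (f (x - of_int k))))\<^sup>2)"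
    using J by (intro shift_sum_bessel gap_reflect) (auto simp: I_def)
  finally show ?thesis unfolding coefficient_energy .
qed

lemma fiber_square_integrable: "integrable \<U> (\<lambda>x. (norm (fiber f I l x))\<^sup>2)"
proof (rule Bochner_Integration.integrable_bound)
  let ?B = "C\<^sup>2 * (tail_const 1 \<delta> * tail_const 1 \<delta>)"
  show "integrable \<U> (\<lambda>x. ?B * (\<Sum>k\<in>I. (norm (f (x + of_int k)))\<^sup>2))"
    by (intro integrable_mult_right compact_norm(1))
  have "(norm (fiber f I l x))\<^sup>2 \<le> ?B * (\<Sum>k\<in>I. (norm (f (x + of_int k)))\<^sup>2)" for x
    using fiber_bessel[of 1 "{l}" x] by (simp add: gap_def)
  then show "AE x in \<U>. norm ((norm (fiber f I l x))\<^sup>2) \<le> norm (?B * (\<Sum>k\<in>I. (norm (f (x + of_int k)))\<^sup>2))"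
    by (intro AE_I2) (smt (verit) real_norm_def zero_le_power2)
  show "(\<lambda>x. (norm (fiber f I l x))\<^sup>2) \<in> borel_measurable \<U>" using fiber_measurable by measurable
qed

lemma inner_eq_fiber_coeff:
  "L2_inner f (modulation (of_int n) (translation l g)) = fourier_coeff (fiber f I l) n"
proof -
  let ?a = "modulation (of_int n) (translation l g)"
  have "L2_inner f ?a = (LINT x|\<U>. (\<Sum>k\<in>I. f (x + of_int k) * cnj (?a (x + of_int k))))"
    unfolding L2_inner_def I_def
    by (rule integral_compact_support(2)[OF L2_product_integrable[OF f atom_L2]]) (simp add: supp)
  also have "\<dots> = fourier_coeff (fiber f I l) n"
    unfolding fourier_coeff_def
  proof (intro Bochner_Integration.integral_cong refl)
    fix x
    have c: "exp (2 * of_real pi * \<i> * of_real (of_int n) * of_real y) = character n y" for y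
      unfolding character_def cis_conv_exp by (rule arg_cong[of _ _ exp]) simp
    have "cnj (?a (x + of_int k)) = character (- n) x * cnj (g (x + of_int k - l))" for k
      unfolding modulation_def translation_def c by (simp add: character_periodic cnj_character)
    then show "(\<Sum>k\<in>I. f (x + of_int k) * cnj (?a (x + of_int k))) = fiber f I l x * character (- n) x"
      by (simp add: fiber_def sum_distrib_left mult_ac)
  qed
  finally show ?thesis .
qed

text \<open>All modulations of one translate together have the energy of the fiber, by Parseval's identity.\<close>

lemma row_energy:
  "((\<lambda>\<xi>. gabor_energy f (l, \<xi>)) has_sum (LINT x|\<U>. (norm (fiber f I l x))\<^sup>2)) \<int>"
proof -
  have "((\<lambda>n. gabor_energy f (l, of_int n)) has_sum (LINT x|\<U>. (norm (fiber f I l x))\<^sup>2)) (UNIV :: int set)"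
    unfolding gabor_energy_def prod.case inner_eq_fiber_coeff
    by (rule parseval[OF fiber_measurable fiber_square_integrable])
  then show ?thesis
    unfolding Ints_def
    by (subst has_sum_reindex) (auto intro!: inj_onI simp: o_def)
qed

lemma finite_energy_le_rows:
  assumes S: "finite S" "S \<subseteq> \<Lambda> \<times> \<int>"
  shows "(\<Sum>p\<in>S. gabor_energy f p) \<le> (\<Sum>l\<in>fst ` S. LINT x|\<U>. (norm (fiber f I l x))\<^sup>2)"
proof -
  have "(\<Sum>p\<in>S. gabor_energy f p) \<le> (\<Sum>p\<in>fst ` S \<times> snd ` S. gabor_energy f p)"
    using S by (intro sum_mono2) (auto simp: gabor_energy_nonneg intro!: rev_image_eqI)
  also have "\<dots> = (\<Sum>l\<in>fst ` S. \<Sum>\<xi>\<in>snd ` S. gabor_energy f (l, \<xi>))" by (simp add: sum.cartesian_product)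
  also have "\<dots> \<le> (\<Sum>l\<in>fst ` S. LINT x|\<U>. (norm (fiber f I l x))\<^sup>2)"
  proof (rule sum_mono)
    fix l
    have "(\<Sum>\<xi>\<in>snd ` S. gabor_energy f (l, \<xi>)) \<le> infsum (\<lambda>\<xi>. gabor_energy f (l, \<xi>)) \<int>"
      using S by (intro finite_sum_le_infsum has_sum_imp_summable[OF row_energy]) (auto simp: gabor_energy_nonneg)
    then show "(\<Sum>\<xi>\<in>snd ` S. gabor_energy f (l, \<xi>)) \<le> (LINT x|\<U>. (norm (fiber f I l x))\<^sup>2)"
      by (simp add: infsumI[OF row_energy])
  qed
  finally show ?thesis .
qed

lemma rows_integral: "finite J \<Longrightarrow> (\<Sum>l\<in>J. LINT x|\<U>. (norm (fiber f I l x))\<^sup>2) = (LINT x|\<U>. (\<Sum>l\<in>J. (norm (fiber f I l x))\<^sup>2))"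
  by (rule Bochner_Integration.integral_sum[symmetric]) (rule fiber_square_integrable)

lemma finite_energy_bessel:
  assumes \<Lambda>: "gap s \<Lambda>" and S: "finite S" "S \<subseteq> \<Lambda> \<times> \<int>"
  shows "(\<Sum>p\<in>S. gabor_energy f p) \<le> C\<^sup>2 * (tail_const 1 \<delta> * tail_const s \<delta>) * (L2_norm f)\<^sup>2"
proof -
  have J: "gap s (fst ` S)" "finite (fst ` S)" using S by (intro gap_subset[OF \<Lambda>], auto)
  have "(\<Sum>p\<in>S. gabor_energy f p) \<le> (LINT x|\<U>. (\<Sum>l\<in>fst ` S. (norm (fiber f I l x))\<^sup>2))"
    using finite_energy_le_rows[OF S] rows_integral[OF J(2)] by simp
  also have "\<dots> \<le> (LINT x|\<U>. C\<^sup>2 * (tail_const 1 \<delta> * tail_const s \<delta>) * (\<Sum>k\<in>I. (norm (f (x + of_int k)))\<^sup>2))"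
    by (intro integral_mono Bochner_Integration.integrable_sum fiber_square_integrable integrable_mult_right compact_norm(1) fiber_bessel J)
  also have "\<dots> = C\<^sup>2 * (tail_const 1 \<delta> * tail_const s \<delta>) * (L2_norm f)\<^sup>2"
    unfolding compact_norm(2) by simp
  finally show ?thesis .
qed

lemma rows_le_energy:
  assumes sm: "gabor_energy f summable_on \<Lambda> \<times> \<int>" and J: "finite J" "J \<subseteq> \<Lambda>"
  shows "(LINT x|\<U>. (\<Sum>l\<in>J. (norm (fiber f I l x))\<^sup>2)) \<le> infsum (gabor_energy f) (\<Lambda> \<times> \<int>)"
proof -
  have smJ: "gabor_energy f summable_on J \<times> \<int>"
    by (rule summable_on_subset_banach[OF sm]) (use J in auto)
  have "(LINT x|\<U>. (\<Sum>l\<in>J. (norm (fiber f I l x))\<^sup>2)) = (\<Sum>l\<in>J. infsum (\<lambda>\<xi>. gabor_energy f (l, \<xi>)) \<int>)"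
    unfolding rows_integral[OF J(1), symmetric] by (intro sum.cong refl infsumI[symmetric] row_energy)
  also have "\<dots> = infsum (gabor_energy f) (J \<times> \<int>)"
    using infsum_Sigma_banach[of "gabor_energy f" J "\<lambda>_. \<int>"] smJ J(1) by simp
  also have "\<dots> \<le> infsum (gabor_energy f) (\<Lambda> \<times> \<int>)"
    by (rule infsum_mono_neutral[OF smJ sm]) (use J gabor_energy_nonneg in auto)
  finally show ?thesis .
qed

end

text \<open>Finite partial sums are continuous under truncation of f, so the bound for compact support persists.\<close>

lemma energy_bessel:
  assumes \<Lambda>: "gap s \<Lambda>" and f: "f \<in> L2_functions"
  shows "gabor_energy f summable_on \<Lambda> \<times> \<int>"
    and "infsum (gabor_energy f) (\<Lambda> \<times> \<int>) \<le> C\<^sup>2 * (tail_const 1 \<delta> * tail_const s \<delta>) * (L2_norm f)\<^sup>2"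
proof -
  let ?B = "C\<^sup>2 * (tail_const 1 \<delta> * tail_const s \<delta>)"
  have fin: "(\<Sum>p\<in>S. gabor_energy f p) \<le> ?B * (L2_norm f)\<^sup>2" if S: "finite S" "S \<subseteq> \<Lambda> \<times> \<int>" for S
  proof (rule LIMSEQ_le)
    show "(\<lambda>N. \<Sum>p\<in>S. gabor_energy (truncate N f) p) \<longlonglongrightarrow> (\<Sum>p\<in>S. gabor_energy f p)"
      unfolding gabor_energy_def case_prod_unfold
      by (intro tendsto_sum tendsto_power tendsto_norm truncate_inner_tendsto f atom_L2)
    show "(\<lambda>N. ?B * (L2_norm (truncate N f))\<^sup>2) \<longlonglongrightarrow> ?B * (L2_norm f)\<^sup>2"
      by (intro tendsto_mult tendsto_const truncate_norm_tendsto f)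
    show "\<exists>N0. \<forall>N\<ge>N0. (\<Sum>p\<in>S. gabor_energy (truncate N f) p) \<le> ?B * (L2_norm (truncate N f))\<^sup>2"
    proof (intro exI allI impI)
      fix N
      show "(\<Sum>p\<in>S. gabor_energy (truncate N f) p) \<le> ?B * (L2_norm (truncate N f))\<^sup>2"
        by (rule finite_energy_bessel[OF truncate_L2[OF f] _ refl \<Lambda> S, of N]) (auto simp: truncate_def indicator_def)
    qed
  qed
  show sm: "gabor_energy f summable_on \<Lambda> \<times> \<int>"
    by (rule nonneg_bdd_above_summable_on) (auto simp: gabor_energy_nonneg intro!: bdd_aboveI2[where M = "?B * (L2_norm f)\<^sup>2"] fin)
  show "infsum (gabor_energy f) (\<Lambda> \<times> \<int>) \<le> ?B * (L2_norm f)\<^sup>2"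
    by (rule infsum_le_finite_sums[OF sm fin])
qed

text \<open>For compact support the sampling inequality is integrated over x. The lower bound passes to general f because
the truncation error is controlled by the upper bound; the factor 2 lost there is harmless.\<close>

theorem gabor_frame_of_sampling:
  assumes \<Lambda>: "gap s \<Lambda>" and a: "a > 0"
    and samp: "\<And>N::nat. \<exists>R. \<forall>x c I. 0 \<le> x \<longrightarrow> x < 1 \<longrightarrow> I \<subseteq> {- int N..int N} \<longrightarrow>
       a * (\<Sum>k\<in>I. (norm (c k))\<^sup>2) \<le> (\<Sum>y\<in>(\<lambda>l. x - l) ` \<Lambda> \<inter> {- R..R}. (norm (shift_sum g c I y))\<^sup>2)"
  shows "gabor_frame g (\<Lambda> \<times> \<int>)"
proof -
  let ?B = "C\<^sup>2 * (tail_const 1 \<delta> * tail_const s \<delta>)"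
  have B0: "?B \<ge> 0" using tail_const_pos[of 1 \<delta>] tail_const_pos[of s \<delta>] \<delta>_pos \<Lambda> by (simp add: gap_def)
  have low: "a * (L2_norm f)\<^sup>2 \<le> infsum (gabor_energy f) (\<Lambda> \<times> \<int>)"
    if f: "f \<in> L2_functions" and supp: "\<And>x. real N < \<bar>x\<bar> \<Longrightarrow> f x = 0" for f N
  proof -
    \<comment> \<open>For 0 \<le> x < 1 the values f(x+k) vanish unless |k| \<le> N + 1.\<close>
    define I where "I = {- int (N + 1)..int (N + 1)}"
    obtain R where R: "\<And>x c I. 0 \<le> x \<Longrightarrow> x < 1 \<Longrightarrow> I \<subseteq> {- int (N + 1)..int (N + 1)} \<Longrightarrow>
       a * (\<Sum>k\<in>I. (norm (c k))\<^sup>2) \<le> (\<Sum>y\<in>(\<lambda>l. x - l) ` \<Lambda> \<inter> {- R..R}. (norm (shift_sum g c I y))\<^sup>2)"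
      using samp[of "N + 1"] by blast
    \<comment> \<open>J contains every l with |x-l| \<le> R for some x in [0,1).\<close>
    define J where "J = \<Lambda> \<inter> {- \<bar>R\<bar> - 1..\<bar>R\<bar> + 1}"
    have J: "finite J" "J \<subseteq> \<Lambda>" unfolding J_def by (auto intro: gap_finite_Int[OF \<Lambda>])
    have pt: "a * (\<Sum>k\<in>I. (norm (f (x + of_int k)))\<^sup>2) \<le> (\<Sum>l\<in>J. (norm (fiber f I l x))\<^sup>2)" if x: "0 \<le> x" "x < 1" for x
    proof -
      let ?c = "\<lambda>k. cnj (f (x - of_int k))"
      have inj: "inj_on (\<lambda>l. x - l) J" by (auto intro!: inj_onI)
      have "a * (\<Sum>k\<in>I. (norm (f (x + of_int k)))\<^sup>2) = a * (\<Sum>k\<in>I. (norm (?c k))\<^sup>2)"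
        by (simp only: coefficient_energy[OF f supp I_def])
      also have "\<dots> \<le> (\<Sum>y\<in>(\<lambda>l. x - l) ` \<Lambda> \<inter> {- R..R}. (norm (shift_sum g ?c I y))\<^sup>2)"
        by (rule R[OF x]) (simp add: I_def)
      also have "\<dots> \<le> (\<Sum>y\<in>(\<lambda>l. x - l) ` J. (norm (shift_sum g ?c I y))\<^sup>2)"
        using J x by (intro sum_mono2) (auto simp: J_def)
      also have "\<dots> = (\<Sum>l\<in>J. (norm (fiber f I l x))\<^sup>2)"
        unfolding sum.reindex[OF inj] by (simp add: norm_fiber[OF I_def])
      finally show ?thesis .
    qed
    have "a * (L2_norm f)\<^sup>2 = (LINT x|\<U>. a * (\<Sum>k\<in>I. (norm (f (x + of_int k)))\<^sup>2))"
      using compact_norm[OF f supp I_def] by simp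
    also have "\<dots> \<le> (LINT x|\<U>. (\<Sum>l\<in>J. (norm (fiber f I l x))\<^sup>2))"
      by (intro integral_mono integrable_mult_right compact_norm(1)[OF f supp I_def]
            Bochner_Integration.integrable_sum fiber_square_integrable[OF f supp I_def] pt) auto
    also have "\<dots> \<le> infsum (gabor_energy f) (\<Lambda> \<times> \<int>)"
      by (rule rows_le_energy[OF f supp I_def energy_bessel(1)[OF \<Lambda> f] J])
    finally show ?thesis .
  qed
  have lower: "a * (L2_norm f)\<^sup>2 \<le> 2 * infsum (gabor_energy f) (\<Lambda> \<times> \<int>)" if f: "f \<in> L2_functions" for f
  proof -
    have fin: "a * (L2_norm (truncate N f))\<^sup>2 \<le> 2 * infsum (gabor_energy f) (\<Lambda> \<times> \<int>) + 2 * (?B * ((L2_norm f)\<^sup>2 - (L2_norm (truncate N f))\<^sup>2))" for N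
    proof -
      let ?h = "truncate N f" and ?S = "\<Lambda> \<times> (\<int> :: real set)"
      let ?d = "\<lambda>x. f x - ?h x"
      have h: "?h \<in> L2_functions" by (rule truncate_L2[OF f])
      have d: "?d \<in> L2_functions" by (rule L2_diff[OF f h])
      note sf = energy_bessel(1)[OF \<Lambda> f] and sh = energy_bessel(1)[OF \<Lambda> h] and sd = energy_bessel(1)[OF \<Lambda> d]
      have "a * (L2_norm ?h)\<^sup>2 \<le> infsum (gabor_energy ?h) ?S"
        by (rule low[OF h, of N]) (auto simp: truncate_def indicator_def)
      also have "\<dots> \<le> infsum (\<lambda>p. 2 * gabor_energy f p + 2 * gabor_energy ?d p) ?S"
        by (intro infsum_mono sh summable_on_add summable_on_cmult_right sf sd gabor_energy_diff f h)
      also have "\<dots> = 2 * infsum (gabor_energy f) ?S + 2 * infsum (gabor_energy ?d) ?S"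
        by (simp add: infsum_add summable_on_cmult_right infsum_cmult_right sf sd)
      also have "\<dots> \<le> 2 * infsum (gabor_energy f) ?S + 2 * (?B * (L2_norm ?d)\<^sup>2)"
        using energy_bessel(2)[OF \<Lambda> d] by simp
      finally show ?thesis by (simp only: truncate_remainder_norm[OF f])
    qed
    have "(\<lambda>N. a * (L2_norm (truncate N f))\<^sup>2) \<longlonglongrightarrow> a * (L2_norm f)\<^sup>2"
      by (intro tendsto_mult tendsto_const truncate_norm_tendsto f)
    moreover have "(\<lambda>N. 2 * infsum (gabor_energy f) (\<Lambda> \<times> \<int>) + 2 * (?B * ((L2_norm f)\<^sup>2 - (L2_norm (truncate N f))\<^sup>2)))
        \<longlonglongrightarrow> 2 * infsum (gabor_energy f) (\<Lambda> \<times> \<int>) + 2 * (?B * ((L2_norm f)\<^sup>2 - (L2_norm f)\<^sup>2))"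
      by (intro tendsto_intros truncate_norm_tendsto f)
    ultimately have "a * (L2_norm f)\<^sup>2 \<le> 2 * infsum (gabor_energy f) (\<Lambda> \<times> \<int>) + 2 * (?B * ((L2_norm f)\<^sup>2 - (L2_norm f)\<^sup>2))"
      using fin by (intro LIMSEQ_le) auto
    then show ?thesis by simp
  qed
  show ?thesis
    unfolding gabor_frame_def gabor_energy_def[symmetric]
  proof (rule exI[of _ "a / 2"], rule exI[of _ "?B + 1"], intro conjI ballI)
    show "0 < a / 2" "0 < ?B + 1" using a B0 by auto
    fix f assume f: "f \<in> L2_functions"
    show "gabor_energy f summable_on \<Lambda> \<times> \<int>" by (rule energy_bessel(1)[OF \<Lambda> f])
    show "a / 2 * (L2_norm f)\<^sup>2 \<le> infsum (gabor_energy f) (\<Lambda> \<times> \<int>)" using lower[OF f] by simp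
    have "?B * (L2_norm f)\<^sup>2 \<le> (?B + 1) * (L2_norm f)\<^sup>2" by (intro mult_right_mono) auto
    then show "infsum (gabor_energy f) (\<Lambda> \<times> \<int>) \<le> (?B + 1) * (L2_norm f)\<^sup>2"
      using energy_bessel(2)[OF \<Lambda> f] by linarith
  qed
qed

end

section \<open>Generators of the two classes\<close>

lemma max_one_exp:
  fixes \<alpha> y :: real
  assumes "\<alpha> > 0"
  shows "max 1 (exp (\<alpha> * y)) ^ q = exp (\<alpha> * q * max 0 y)"
proof -
  have "max 1 (exp (\<alpha> * y)) = exp (\<alpha> * max 0 y)"
    using assms by (cases "y \<ge> 0") (auto simp: max_def mult_le_0_iff not_le intro: mult_pos_neg)
  then show ?thesis by (simp add: exp_of_nat_mult[symmetric] mult_ac)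
qed

lemma poly_upper_bound:
  fixes Q :: "complex poly"
  shows "\<exists>B>0. \<forall>u. norm (poly Q u) \<le> B * max 1 (norm u) ^ degree Q"
proof (intro exI conjI allI)
  let ?B = "(\<Sum>i\<le>degree Q. norm (coeff Q i)) + 1"
  show "?B > 0" by (intro add_nonneg_pos sum_nonneg) auto
  fix u
  have "norm (poly Q u) \<le> (\<Sum>i\<le>degree Q. norm (coeff Q i) * max 1 (norm u) ^ degree Q)"
    unfolding poly_altdef
  proof (rule sum_norm_le)
    fix i assume "i \<in> {..degree Q}"
    then have "norm u ^ i \<le> max 1 (norm u) ^ i" "max 1 (norm u) ^ i \<le> max 1 (norm u) ^ degree Q"
      by (auto intro: power_mono power_increasing)
    then show "norm (coeff Q i * u ^ i) \<le> norm (coeff Q i) * max 1 (norm u) ^ degree Q"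
      unfolding norm_mult norm_power by (intro mult_left_mono) auto
  qed
  also have "\<dots> \<le> ?B * max 1 (norm u) ^ degree Q"
    unfolding sum_distrib_right[symmetric] by (intro mult_right_mono) auto
  finally show "norm (poly Q u) \<le> ?B * max 1 (norm u) ^ degree Q" .
qed

lemma poly_lower_near_0:
  fixes p :: "complex poly"
  assumes "poly p 0 \<noteq> 0"
  obtains r where "r > 0" "\<And>v. norm v < r \<Longrightarrow> norm (poly p 0) / 2 \<le> norm (poly p v)"
proof -
  have "isCont (\<lambda>v. norm (poly p v)) 0" by (intro continuous_intros)
  moreover have "norm (poly p 0) / 2 > 0" using assms by simp
  ultimately obtain r where r: "r > 0" "\<And>v. dist v 0 < r \<Longrightarrow> dist (norm (poly p v)) (norm (poly p 0)) < norm (poly p 0) / 2"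
    unfolding continuous_at_eps_delta by blast
  have "norm (poly p 0) / 2 \<le> norm (poly p v)" if "norm v < r" for v
  proof -
    have "dist (norm (poly p v)) (norm (poly p 0)) < norm (poly p 0) / 2" by (rule r(2)) (use that in simp)
    then show ?thesis unfolding dist_real_def by linarith
  qed
  then show ?thesis using that[of r] r(1) by blast
qed

text \<open>Near 0 by continuity; near infinity by continuity of the reflected polynomial at 0, whose value is the
leading coefficient; on the remaining compact part of the half-line because there is no zero.\<close>

lemma poly_lower_bounds:
  fixes Q :: "complex poly"
  assumes Q: "\<And>x::real. x \<ge> 0 \<Longrightarrow> poly Q (of_real x) \<noteq> 0"
  obtains b r where "b > 0" "0 < r" "r < 1"
    "\<And>u. norm u < r \<or> 1 / r < norm u \<Longrightarrow> b * max 1 (norm u) ^ degree Q \<le> norm (poly Q u)"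
    "\<And>x::real. x > 0 \<Longrightarrow> b * max 1 x ^ degree Q \<le> norm (poly Q (of_real x))"
proof -
  have Q0: "poly Q 0 \<noteq> 0" using Q[of 0] by simp
  then have Qnz: "Q \<noteq> 0" by auto
  let ?R = "reflect_poly Q"
  have R0: "poly ?R 0 \<noteq> 0" using Qnz by (simp add: poly_reflect_poly_0)
  obtain r1 where r1: "r1 > 0" "\<And>v. norm v < r1 \<Longrightarrow> norm (poly Q 0) / 2 \<le> norm (poly Q v)"
    using poly_lower_near_0[OF Q0] by blast
  obtain r2 where r2: "r2 > 0" "\<And>v. norm v < r2 \<Longrightarrow> norm (poly ?R 0) / 2 \<le> norm (poly ?R v)"
    using poly_lower_near_0[OF R0] by blast
  define r where "r = min (1/2) (min r1 r2)"
  have r: "0 < r" "r < 1" "r \<le> r1" "r \<le> r2" using r1 r2 by (auto simp: r_def)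
  let ?K = "{r..1 / r}"
  have rr: "r \<le> 1 / r"
  proof -
    have "r * r \<le> 1 * 1" using r by (intro mult_mono) auto
    then show ?thesis using r by (simp add: field_simps)
  qed
  have "continuous_on ?K (\<lambda>x. norm (poly Q (of_real x)) / max 1 x ^ degree Q)"
    by (intro continuous_intros) (auto simp: max_def)
  then obtain x0 where x0: "x0 \<in> ?K" "\<And>x. x \<in> ?K \<Longrightarrow> norm (poly Q (of_real x0)) / max 1 x0 ^ degree Q \<le> norm (poly Q (of_real x)) / max 1 x ^ degree Q"
    using continuous_attains_inf[of ?K "\<lambda>x. norm (poly Q (of_real x)) / max 1 x ^ degree Q"] rr by auto
  define b3 where "b3 = norm (poly Q (of_real x0)) / max 1 x0 ^ degree Q"
  define b where "b = min (norm (poly Q 0) / 2) (min (norm (poly ?R 0) / 2) b3)"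
  have "poly Q (of_real x0) \<noteq> 0" using Q[of x0] x0(1) r by auto
  then have b3: "b3 > 0" unfolding b3_def by (intro divide_pos_pos zero_less_power) auto
  have b: "b > 0" using Q0 R0 b3 by (simp add: b_def)
  have far: "b * max 1 (norm u) ^ degree Q \<le> norm (poly Q u)" if "norm u < r \<or> 1 / r < norm u" for u
    using that
  proof
    assume u: "norm u < r"
    then have "b \<le> norm (poly Q u)" using r1(2)[of u] r by (simp add: b_def)
    then show ?thesis using u r by (simp add: max_def)
  next
    assume u: "1 / r < norm u"
    have "1 < 1 / r" using r by simp
    then have u1: "1 < norm u" using u by linarith
    then have u0: "u \<noteq> 0" by auto
    have "inverse (norm u) < inverse (1 / r)" using u r by (intro less_imp_inverse_less) auto
    then have "norm (inverse u) < r" using r by (simp add: norm_inverse)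
    then have "b \<le> norm (poly ?R (inverse u))" using r2(2)[of "inverse u"] r by (simp add: b_def)
    moreover have "poly ?R (inverse u) = inverse u ^ degree Q * poly Q u"
      using u0 poly_reflect_poly_nz[of "inverse u" Q] by simp
    ultimately have "b \<le> norm (poly Q u) / norm u ^ degree Q"
      by (simp add: norm_mult norm_power norm_inverse divide_inverse power_inverse mult.commute)
    moreover have "0 < norm u ^ degree Q" using u1 by (intro zero_less_power) linarith
    ultimately show ?thesis using u1 by (simp add: max_def pos_le_divide_eq)
  qed
  have "b * max 1 x ^ degree Q \<le> norm (poly Q (of_real x))" if x: "x > 0" for x :: real
  proof (cases "x \<in> ?K")
    case True
    have "b \<le> norm (poly Q (of_real x)) / max 1 x ^ degree Q"
      using x0(2)[OF True] by (simp add: b_def b3_def)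
    moreover have "0 < max 1 x ^ degree Q" by (intro zero_less_power) auto
    ultimately show ?thesis by (simp add: pos_le_divide_eq)
  next
    case False
    then show ?thesis using far[of "of_real x"] x by auto
  qed
  then show ?thesis using that[of b r] b r far by blast
qed

lemma exp_rational_denominator:
  fixes Q :: "complex poly"
  assumes \<alpha>: "\<alpha> > 0" and Q: "\<And>x::real. x \<ge> 0 \<Longrightarrow> poly Q (of_real x) \<noteq> 0"
  obtains A0 and h :: nat where
    "\<And>A u y. A \<ge> A0 \<Longrightarrow> norm u = exp (\<alpha> * y) \<Longrightarrow> norm (poly Q u) \<le> exp (A + \<alpha> * degree Q * max 0 y)"
    "\<And>A y. A \<ge> A0 \<Longrightarrow> exp (- A + \<alpha> * degree Q * max 0 y) \<le> norm (poly Q (of_real (exp (\<alpha> * y))))"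
    "\<And>A u y. A \<ge> A0 \<Longrightarrow> norm u = exp (\<alpha> * y) \<Longrightarrow> real h \<le> \<bar>y\<bar> \<Longrightarrow> exp (- A + \<alpha> * degree Q * max 0 y) \<le> norm (poly Q u)"
proof -
  obtain B where B: "B > 0" "\<And>u. norm (poly Q u) \<le> B * max 1 (norm u) ^ degree Q"
    using poly_upper_bound[of Q] by blast
  obtain b r where b: "b > 0" "0 < r" "r < 1"
    and far: "\<And>u. norm u < r \<or> 1 / r < norm u \<Longrightarrow> b * max 1 (norm u) ^ degree Q \<le> norm (poly Q u)"
    and pos: "\<And>x::real. x > 0 \<Longrightarrow> b * max 1 x ^ degree Q \<le> norm (poly Q (of_real x))"
    using poly_lower_bounds[OF Q] by metis
  define A0 where "A0 = max (ln B) (- ln b)"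
  have AB: "B \<le> exp A" "exp (- A) \<le> b" if "A \<ge> A0" for A
  proof -
    have "ln B \<le> A" "- A \<le> ln b" using that by (auto simp: A0_def)
    then show "B \<le> exp A" "exp (- A) \<le> b" using B(1) b(1) by (metis exp_le_cancel_iff exp_ln)+
  qed
  obtain h :: nat where h: "- ln r / \<alpha> < real h" using reals_Archimedean2 by blast
  then have hr: "- ln r < \<alpha> * real h" using \<alpha> by (simp add: field_simps)
  note me = max_one_exp[OF \<alpha>]
  show ?thesis
  proof (rule that[of A0 h])
    fix A y :: real and u :: complex assume A: "A \<ge> A0" and u: "norm u = exp (\<alpha> * y)"
    have "norm (poly Q u) \<le> B * exp (\<alpha> * degree Q * max 0 y)" using B(2)[of u] by (simp only: u me)
    also have "\<dots> \<le> exp A * exp (\<alpha> * degree Q * max 0 y)" by (intro mult_right_mono AB A) simp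
    finally show "norm (poly Q u) \<le> exp (A + \<alpha> * degree Q * max 0 y)" by (simp only: exp_add)
  next
    fix A y :: real assume A: "A \<ge> A0"
    have "exp (- A + \<alpha> * degree Q * max 0 y) = exp (- A) * exp (\<alpha> * degree Q * max 0 y)" by (rule exp_add)
    also have "\<dots> \<le> b * exp (\<alpha> * degree Q * max 0 y)" by (intro mult_right_mono AB A) simp
    also have "\<dots> \<le> norm (poly Q (of_real (exp (\<alpha> * y))))" using pos[of "exp (\<alpha> * y)"] by (simp only: me exp_gt_zero)
    finally show "exp (- A + \<alpha> * degree Q * max 0 y) \<le> norm (poly Q (of_real (exp (\<alpha> * y))))" .
  next
    fix A y :: real and u :: complex assume A: "A \<ge> A0" and u: "norm u = exp (\<alpha> * y)" and y: "real h \<le> \<bar>y\<bar>"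
    have "- ln r < \<alpha> * \<bar>y\<bar>" using hr mult_left_mono[OF y, of \<alpha>] \<alpha> by linarith
    then have "\<alpha> * y < ln r \<or> - ln r < \<alpha> * y" by (auto simp: abs_real_def split: if_splits)
    then have "norm u < r \<or> 1 / r < norm u"
    proof
      assume "\<alpha> * y < ln r"
      then have "exp (\<alpha> * y) < exp (ln r)" by (simp only: exp_less_cancel_iff)
      then show ?thesis using b u by simp
    next
      assume "- ln r < \<alpha> * y"
      then have "exp (- ln r) < exp (\<alpha> * y)" by (simp only: exp_less_cancel_iff)
      then show ?thesis using b u by (simp add: exp_minus divide_inverse)
    qed
    from far[OF this] have "b * exp (\<alpha> * degree Q * max 0 y) \<le> norm (poly Q u)" by (simp only: u me)
    moreover have "exp (- A) * exp (\<alpha> * degree Q * max 0 y) \<le> b * exp (\<alpha> * degree Q * max 0 y)" by (intro mult_right_mono AB A) simp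
    ultimately show "exp (- A + \<alpha> * degree Q * max 0 y) \<le> norm (poly Q u)" by (simp only: exp_add)
  qed
qed

text \<open>The Gaussian factor dominates any exponential, so the required decay of P has any rate; rate 1 is chosen.\<close>

lemma class_C_exp_rational:
  assumes \<alpha>: "\<alpha> > 0" and G: "C_repr \<alpha> G P Q"
  shows "\<exists>A h. exp_rational \<alpha> 0 1 A 1 (degree Q) h P Q (on_reals G)"
proof -
  have Q: "\<And>x::real. x \<ge> 0 \<Longrightarrow> poly Q (of_real x) \<noteq> 0" using G by (simp add: C_repr_def)
  obtain A0 and h :: nat where den:
    "\<And>A u y. A \<ge> A0 \<Longrightarrow> norm u = exp (\<alpha> * y) \<Longrightarrow> norm (poly Q u) \<le> exp (A + \<alpha> * degree Q * max 0 y)"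
    "\<And>A y. A \<ge> A0 \<Longrightarrow> exp (- A + \<alpha> * degree Q * max 0 y) \<le> norm (poly Q (of_real (exp (\<alpha> * y))))"
    "\<And>A u y. A \<ge> A0 \<Longrightarrow> norm u = exp (\<alpha> * y) \<Longrightarrow> real h \<le> \<bar>y\<bar> \<Longrightarrow> exp (- A + \<alpha> * degree Q * max 0 y) \<le> norm (poly Q u)"
    using exp_rational_denominator[OF \<alpha> Q] by metis
  obtain B where B: "B > 0" "\<And>u. norm (poly P u) \<le> B * max 1 (norm u) ^ degree P"
    using poly_upper_bound[of P] by blast
  define t where "t = \<alpha> * degree P + 1"
  define A where "A = max A0 (ln B + t\<^sup>2 / (2 * \<alpha>))"
  have up: "exp (0 * y - real 1 * \<alpha> * y\<^sup>2 / 2) * norm (poly P u) \<le> exp (A + \<alpha> * degree Q * max 0 y - 1 * \<bar>y\<bar>)"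
    if u: "norm u = exp (\<alpha> * y)" for u y
  proof -
    have "norm (poly P u) \<le> B * exp (\<alpha> * degree P * max 0 y)" using B(2)[of u] by (simp only: u max_one_exp[OF \<alpha>])
    also have "\<dots> = exp (ln B + \<alpha> * degree P * max 0 y)" using B(1) by (simp add: exp_add)
    finally have "exp (- (\<alpha> * y\<^sup>2 / 2)) * norm (poly P u) \<le> exp (- (\<alpha> * y\<^sup>2 / 2)) * exp (ln B + \<alpha> * degree P * max 0 y)"
      by (intro mult_left_mono) auto
    also have "\<dots> = exp (- (\<alpha> * y\<^sup>2 / 2) + (ln B + \<alpha> * degree P * max 0 y))" by (rule exp_add[symmetric])
    also have "\<dots> \<le> exp (A + \<alpha> * degree Q * max 0 y - 1 * \<bar>y\<bar>)"
    proof -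
      \<comment> \<open>Completing the square bounds the linear exponent t|y| by the Gaussian one up to a constant.\<close>
      have "0 \<le> (t - \<alpha> * \<bar>y\<bar>)\<^sup>2 / (2 * \<alpha>)" using \<alpha> by simp
      also have "(t - \<alpha> * \<bar>y\<bar>)\<^sup>2 / (2 * \<alpha>) = t\<^sup>2 / (2 * \<alpha>) - t * \<bar>y\<bar> + \<alpha> * y\<^sup>2 / 2"
      proof -
        have "\<bar>y\<bar> * \<bar>y\<bar> = y\<^sup>2" by (simp add: power2_eq_square)
        then have "(t - \<alpha> * \<bar>y\<bar>)\<^sup>2 = t\<^sup>2 - 2 * \<alpha> * (t * \<bar>y\<bar>) + (2 * \<alpha>) * (\<alpha> * y\<^sup>2 / 2)"
          by (simp add: power2_eq_square algebra_simps)
        then show ?thesis using \<alpha> by (simp add: add_divide_distrib diff_divide_distrib)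
      qed
      finally have 1: "t * \<bar>y\<bar> - \<alpha> * y\<^sup>2 / 2 \<le> t\<^sup>2 / (2 * \<alpha>)" by linarith
      have "\<alpha> * degree P * max 0 y \<le> \<alpha> * degree P * \<bar>y\<bar>" using \<alpha> by (intro mult_left_mono) auto
      then have 2: "\<alpha> * degree P * max 0 y + \<bar>y\<bar> \<le> t * \<bar>y\<bar>" by (simp add: t_def algebra_simps)
      have 3: "0 \<le> \<alpha> * degree Q * max 0 y" using \<alpha> by (intro mult_nonneg_nonneg) auto
      have 4: "ln B + t\<^sup>2 / (2 * \<alpha>) \<le> A" by (simp add: A_def)
      show ?thesis unfolding exp_le_cancel_iff using 1 2 3 4 by linarith
    qed
    finally show ?thesis by simp
  qed
  have A: "A \<ge> A0" by (simp add: A_def)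
  have "exp_rational \<alpha> 0 1 A 1 (degree Q) h P Q (on_reals G)"
  proof
    show "on_reals G x = of_real (exp (0 * x - real 1 * \<alpha> * x\<^sup>2 / 2)) *
        (poly P (of_real (exp (\<alpha> * x))) / poly Q (of_real (exp (\<alpha> * x))))" for x
      by (simp add: on_reals_def C_repr_eval[OF G] exp_of_real[symmetric])
  qed (use \<alpha> up den A in auto)
  then show ?thesis by blast
qed

lemma poly_in_power:
  fixes p :: "complex poly"
  assumes k: "k \<ge> 1" and supp: "\<And>j. coeff p j \<noteq> 0 \<Longrightarrow> s \<le> j \<and> k dvd (j - s)"
  obtains p0 where "\<And>u. poly p u = u ^ s * poly p0 (u ^ k)"
proof -
  let ?n = "degree p"
  let ?p0 = "\<Sum>i\<le>?n. monom (coeff p (s + k * i)) i"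
  have "poly p u = u ^ s * poly ?p0 (u ^ k)" for u
  proof -
    let ?f = "\<lambda>j. coeff p j * u ^ j" and ?e = "\<lambda>i. s + k * i"
    let ?S = "?e ` {..?n} \<union> {..?n}"
    have inj: "inj_on ?e {..?n}" using k by (auto intro!: inj_onI)
    have "u ^ s * poly ?p0 (u ^ k) = (\<Sum>i\<le>?n. ?f (?e i))"
      unfolding poly_sum poly_monom sum_distrib_left power_add power_mult
      by (intro sum.cong refl) (simp add: mult_ac)
    also have "\<dots> = sum ?f (?e ` {..?n})" by (simp add: sum.reindex[OF inj])
    also have "\<dots> = sum ?f ?S"
    proof (rule sum.mono_neutral_left)
      show "\<forall>j\<in>?S - ?e ` {..?n}. ?f j = 0"
      proof
        fix j assume j: "j \<in> ?S - ?e ` {..?n}"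
        have "coeff p j = 0"
        proof (rule ccontr)
          assume "coeff p j \<noteq> 0"
          then obtain i where i: "s \<le> j" "j - s = k * i" using supp[of j] by (auto elim: dvdE)
          then have "j = ?e i" by simp
          moreover have "i \<le> j" using i k by (cases k) auto
          then have "i \<le> ?n" using j by auto
          ultimately show False using j by auto
        qed
        then show "?f j = 0" by simp
      qed
    qed auto
    also have "\<dots> = sum ?f {..?n}"
      by (rule sum.mono_neutral_right) (auto simp: coeff_eq_0)
    finally show ?thesis by (simp add: poly_altdef)
  qed
  then show ?thesis using that by blast
qed

lemma degree_in_power:
  fixes p p0 :: "complex poly"
  assumes "\<And>u. poly p u = poly p0 (u ^ k)"
  shows "degree p = k * degree p0"
proof -
  have "poly p = poly (pcompose p0 (monom 1 k))" by (auto simp: poly_pcompose poly_monom assms)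
  then have "p = pcompose p0 (monom 1 k)" by (simp only: poly_eq_poly_eq_iff)
  then show ?thesis by (simp add: degree_pcompose degree_monom_eq)
qed

lemma coprime_of_no_common_zero:
  fixes P Q :: "complex poly"
  assumes "Q \<noteq> 0" "\<And>z. \<not> (poly P z = 0 \<and> poly Q z = 0)"
  shows "coprime Q P"
proof (rule coprimeI)
  fix c assume c: "c dvd Q" "c dvd P"
  then have "poly c z \<noteq> 0" for z using assms(2)[of z] by (auto simp: dvd_def)
  then have "constant (poly c)" using Fundamental_Theorem_Algebra.fundamental_theorem_of_algebra[of c] by auto
  then have "degree c = 0" by (simp only: constant_degree)
  moreover have "c \<noteq> 0" using c assms(1) by auto
  ultimately show "is_unit c" using is_unit_iff_degree by blast
qed

lemma coeff_scaled: "coeff (pcompose p [:0, a:]) n = a ^ n * coeff (p :: complex poly) n"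
  by (rule coeff_pcompose_linear)

text \<open>Cross-multiplication gives P(wu) Q(u) = c P(u) Q(wu). Since Q is coprime to P, it divides Q(wu), which has the
same degree and the same nonzero value at 0.\<close>

lemma rotation_of_fraction:
  fixes P Q :: "complex poly"
  assumes P: "P \<noteq> 0" and Q0: "poly Q 0 \<noteq> 0" and cop: "\<And>z. \<not> (poly P z = 0 \<and> poly Q z = 0)"
    and w: "w \<noteq> 0"
    and rot: "\<And>u. u \<noteq> 0 \<Longrightarrow> poly P (w * u) / poly Q (w * u) = c * (poly P u / poly Q u)"
  shows "pcompose Q [:0, w:] = Q" "pcompose P [:0, w:] = smult c P"
proof -
  let ?s = "[:0, w:]"
  let ?Pw = "pcompose P ?s" and ?Qw = "pcompose Q ?s"
  have Qnz: "Q \<noteq> 0" using Q0 by auto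
  have sd: "degree ?s > 0" using w by simp
  have Qw0: "poly ?Qw 0 \<noteq> 0" using Q0 by (simp add: poly_pcompose)
  have Qwnz: "?Qw \<noteq> 0" using Qw0 by force
  have Pwnz: "?Pw \<noteq> 0"
  proof
    assume "?Pw = 0"
    then have "w ^ n * coeff P n = 0" for n using coeff_scaled[of P w n] by simp
    then have "coeff P n = 0" for n using w by simp
    then show False using P by (simp add: poly_eq_iff)
  qed
  \<comment> \<open>The identity holds off the zeros of the denominators and 0; multiplying by these factors makes it hold everywhere.\<close>
  have "poly ((?Pw * Q - smult c (P * ?Qw)) * (Q * ?Qw * [:0, 1:])) u = 0" for u
  proof (cases "u = 0 \<or> poly Q u = 0 \<or> poly ?Qw u = 0")
    case False
    then have "poly P (w * u) * poly Q u = c * poly P u * poly Q (w * u)"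
      using rot[of u] by (simp add: frac_eq_eq poly_pcompose mult.commute)
    then show ?thesis by (simp add: poly_pcompose mult.commute)
  qed auto
  then have "(?Pw * Q - smult c (P * ?Qw)) * (Q * ?Qw * [:0, 1:]) = 0"
    using poly_all_0_iff_0 by blast
  moreover have "Q * ?Qw * [:0, 1:] \<noteq> 0" using Qnz Qwnz by (simp del: mult_pCons_right)
  ultimately have D: "?Pw * Q = smult c (P * ?Qw)" by (metis mult_eq_0_iff right_minus_eq)
  have c: "c \<noteq> 0" using D Pwnz Qnz by auto
  have "Q dvd smult c (P * ?Qw)" unfolding D[symmetric] by simp
  then have "Q dvd P * ?Qw" using c by (simp add: dvd_smult_iff)
  then have "Q dvd ?Qw" using coprime_of_no_common_zero[OF Qnz cop] by (simp add: coprime_dvd_mult_right_iff)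
  then obtain d where d: "?Qw = Q * d" by (auto elim: dvdE)
  have dnz: "d \<noteq> 0" using d Qwnz by auto
  have "degree ?Qw = degree Q" using w by (simp add: degree_pcompose)
  then have "degree d = 0" using d dnz Qnz by (simp add: degree_mult_eq)
  then obtain e where e: "d = [:e:]" by (rule degree_eq_zeroE)
  have "poly ?Qw 0 = poly Q 0" by (simp add: poly_pcompose)
  then have "e = 1" using d e Q0 by simp
  then show QQ: "?Qw = Q" using d e by simp
  have "?Pw * Q = smult c P * Q" using D unfolding QQ by simp
  then show "?Pw = smult c P" by (rule iffD1[OF mult_right_cancel[OF Qnz]])
qed

definition root_of_unity :: "nat \<Rightarrow> complex" where
  "root_of_unity k = exp (2 * of_real pi * \<i> / of_nat k)"

lemma root_of_unity_power_eq_1: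
  assumes k: "k \<ge> 1" and "root_of_unity k ^ j = 1"
  shows "k dvd j"
proof -
  have "exp (of_nat j * (2 * of_real pi * \<i> / of_nat k)) = 1"
    using assms(2) by (simp only: root_of_unity_def exp_of_nat_mult)
  then obtain n :: int where n: "Im (of_nat j * (2 * of_real pi * \<i> / of_nat k)) = of_int (2 * n) * pi"
    unfolding exp_eq_1 by blast
  have "Im (of_nat j * (2 * of_real pi * \<i> / of_nat k)) = real j * (2 * pi / real k)"
    by simp
  then have "real j * (2 * pi / real k) = 2 * of_int n * pi" using n by simp
  then have "real j * (2 * pi / real k) * real k = 2 * of_int n * pi * real k" by (simp only:)
  moreover have "real j * (2 * pi / real k) * real k = (2 * pi) * real j" using k by simp
  moreover have "2 * of_int n * pi * real k = (2 * pi) * (of_int n * real k)" by simp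
  ultimately have "(2 * pi) * real j = (2 * pi) * (of_int n * real k)" by (simp only:)
  then have "real j = of_int n * real k" by (subst (asm) mult_left_cancel) simp_all
  then have "real_of_int (int j) = real_of_int (n * int k)" by simp
  then have "int j = n * int k" by (simp only: of_int_eq_iff)
  then have "int k dvd int j" by simp
  then show ?thesis by (simp only: int_dvd_int_iff)
qed

text \<open>Comparing coefficients under multiplication of the variable by a primitive k-th root of unity. In particular k
divides the degree of Q, which bounds the possible orders of symmetry.\<close>

lemma symmetry_structure:
  assumes \<alpha>: "\<alpha> > 0" and G: "K_repr \<alpha> G P Q" and k: "k \<ge> 1"
    and sym: "\<And>z. G (z + 2 * of_real pi * \<i> / (of_nat k * of_real \<alpha>)) = c * G z"
  shows "\<And>j. coeff Q j \<noteq> 0 \<Longrightarrow> k dvd j" "\<And>i j. coeff P i \<noteq> 0 \<Longrightarrow> coeff P j \<noteq> 0 \<Longrightarrow> i \<le> j \<Longrightarrow> k dvd (j - i)"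
proof -
  let ?w = "root_of_unity k"
  have w: "?w \<noteq> 0" by (simp add: root_of_unity_def)
  have rot: "poly P (?w * u) / poly Q (?w * u) = c * (poly P u / poly Q u)" if u: "u \<noteq> 0" for u
  proof -
    obtain z where z: "exp (of_real \<alpha> * z) = u" by (rule exp_scaled_surj[OF \<alpha> u])
    have "of_real \<alpha> * (z + 2 * of_real pi * \<i> / (of_nat k * of_real \<alpha>)) = 2 * of_real pi * \<i> / of_nat k + of_real \<alpha> * z"
      using \<alpha> by (simp add: distrib_left)
    then have "exp (of_real \<alpha> * (z + 2 * of_real pi * \<i> / (of_nat k * of_real \<alpha>))) = ?w * u"
      by (simp only: exp_add z root_of_unity_def)
    then show ?thesis using sym[of z] unfolding K_repr_eval[OF G] by (simp only: z)
  qed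
  have "P \<noteq> 0" "poly Q 0 \<noteq> 0" "\<And>z. \<not> (poly P z = 0 \<and> poly Q z = 0)"
    using G unfolding K_repr_def by (auto dest: spec[of _ "0::real"])
  note R = rotation_of_fraction[OF this w rot]
  show "k dvd j" if "coeff Q j \<noteq> 0" for j
  proof (rule root_of_unity_power_eq_1[OF k])
    have "?w ^ j * coeff Q j = coeff Q j" using R(1) coeff_scaled[of Q ?w j] by simp
    then show "?w ^ j = 1" using that by simp
  qed
  show "k dvd (j - i)" if ij: "coeff P i \<noteq> 0" "coeff P j \<noteq> 0" "i \<le> j" for i j
  proof (rule root_of_unity_power_eq_1[OF k])
    have "?w ^ j * coeff P j = c * coeff P j" "?w ^ i * coeff P i = c * coeff P i"
      using R(2) coeff_scaled[of P ?w] by (metis coeff_smult)+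
    then have "?w ^ j = ?w ^ i" using ij by simp
    then have "?w ^ i * ?w ^ (j - i) = ?w ^ i * 1" using ij(3) by (simp add: power_add[symmetric])
    then show "?w ^ (j - i) = 1" using w by (subst (asm) mult_left_cancel) auto
  qed
qed

lemma K_symmetry_spec:
  assumes \<alpha>: "\<alpha> > 0" and G: "K_repr \<alpha> G P Q"
  shows "K_symmetry \<alpha> G \<ge> 1 \<and>
    (\<exists>c. \<forall>z. G (z + 2 * of_real pi * \<i> / (of_nat (K_symmetry \<alpha> G) * of_real \<alpha>)) = c * G z)"
  unfolding K_symmetry_def
proof (rule GreatestI_nat[where b = "degree Q"])
  have "exp (of_real \<alpha> * (z + 2 * of_real pi * \<i> / (of_nat 1 * of_real \<alpha>))) = exp (of_real \<alpha> * z)" for z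
  proof -
    have "of_real \<alpha> * (z + 2 * of_real pi * \<i> / (of_nat 1 * of_real \<alpha>)) = of_real \<alpha> * z + 2 * of_real pi * \<i>"
      using \<alpha> by (simp add: distrib_left)
    then show ?thesis by (simp add: exp_add)
  qed
  then have "\<forall>z. G (z + 2 * of_real pi * \<i> / (of_nat 1 * of_real \<alpha>)) = 1 * G z"
    unfolding K_repr_eval[OF G] by simp
  then show "1 \<le> (1::nat) \<and> (\<exists>c. \<forall>z. G (z + 2 * of_real pi * \<i> / (of_nat 1 * of_real \<alpha>)) = c * G z)" by blast
next
  fix k assume k: "1 \<le> k \<and> (\<exists>c. \<forall>z. G (z + 2 * of_real pi * \<i> / (of_nat k * of_real \<alpha>)) = c * G z)"
  have "Q \<noteq> 0" "degree Q > 0" using G by (auto simp: K_repr_def)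
  then have "k dvd degree Q" using symmetry_structure(1)[OF \<alpha> G, of k] k by (metis leading_coeff_neq_0)
  then show "k \<le> degree Q" using \<open>degree Q > 0\<close> by (rule dvd_imp_le)
qed

text \<open>With s the order of the zero of P at 0, all exponents in P are congruent to s modulo k and all exponents in Q
are divisible by k. Hence g(x) = e^(s\<alpha>x) P0(v)/Q0(v) with v = e^(k\<alpha>x).\<close>

lemma class_K_exp_rational:
  fixes \<alpha> :: real
  assumes \<alpha>: "\<alpha> > 0" and G: "K_repr \<alpha> G P Q"
  shows "\<exists>\<beta> A h P0 Q0 q0. exp_rational (K_symmetry \<alpha> G * \<alpha>) \<beta> \<alpha> A 0 q0 h P0 Q0 (on_reals G) \<and> degree Q = K_symmetry \<alpha> G * q0"
proof -
  define k where "k = K_symmetry \<alpha> G"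
  obtain c where k: "k \<ge> 1" and sym: "\<And>z. G (z + 2 * of_real pi * \<i> / (of_nat k * of_real \<alpha>)) = c * G z"
    using K_symmetry_spec[OF \<alpha> G] unfolding k_def by blast
  note S = symmetry_structure[OF \<alpha> G k sym]
  have P: "P \<noteq> 0" "poly P 0 = 0" "degree P < degree Q" and Q: "\<And>x::real. x \<ge> 0 \<Longrightarrow> poly Q (of_real x) \<noteq> 0"
    using G by (auto simp: K_repr_def)
  define s where "s = (LEAST j. coeff P j \<noteq> 0)"
  have ex: "\<exists>j. coeff P j \<noteq> 0" using P(1) leading_coeff_neq_0 by blast
  have s: "coeff P s \<noteq> 0" unfolding s_def by (rule LeastI_ex[OF ex])
  have sl: "s \<le> j" if "coeff P j \<noteq> 0" for j unfolding s_def by (rule Least_le[of "\<lambda>j. coeff P j \<noteq> 0", OF that])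
  obtain P0 where P0: "\<And>u. poly P u = u ^ s * poly P0 (u ^ k)"
    using poly_in_power[OF k, of P s] sl S(2)[OF s] by blast
  obtain Q0 where Q0': "\<And>u. poly Q u = u ^ 0 * poly Q0 (u ^ k)"
    using poly_in_power[OF k, of Q 0] S(1) by auto
  then have Q0: "\<And>u. poly Q u = poly Q0 (u ^ k)" by simp
  have deg: "degree Q = k * degree Q0" by (rule degree_in_power[OF Q0])
  have k\<alpha>: "real k * \<alpha> > 0" using k \<alpha> by simp
  have Q0nz: "poly Q0 (of_real x) \<noteq> 0" if "x \<ge> 0" for x :: real
  proof -
    have "x = root k x ^ k" using k that by simp
    then have "poly Q0 (of_real x) = poly Q (of_real (root k x))" by (simp add: Q0 flip: of_real_power)
    then show ?thesis using Q[of "root k x"] that k by simp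
  qed
  obtain A0 and h :: nat where den:
    "\<And>A u y. A \<ge> A0 \<Longrightarrow> norm u = exp ((k * \<alpha>) * y) \<Longrightarrow> norm (poly Q0 u) \<le> exp (A + (k * \<alpha>) * degree Q0 * max 0 y)"
    "\<And>A y. A \<ge> A0 \<Longrightarrow> exp (- A + (k * \<alpha>) * degree Q0 * max 0 y) \<le> norm (poly Q0 (of_real (exp ((k * \<alpha>) * y))))"
    "\<And>A u y. A \<ge> A0 \<Longrightarrow> norm u = exp ((k * \<alpha>) * y) \<Longrightarrow> real h \<le> \<bar>y\<bar> \<Longrightarrow> exp (- A + (k * \<alpha>) * degree Q0 * max 0 y) \<le> norm (poly Q0 u)"
    using exp_rational_denominator[OF k\<alpha> Q0nz] by metis
  define B where "B = (\<Sum>i\<le>degree P. norm (coeff P i)) + 1"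
  have B: "B > 0" unfolding B_def by (intro add_nonneg_pos sum_nonneg) auto
  define A where "A = max A0 (ln B)"
  have Pb: "norm (poly P u) \<le> exp (A + \<alpha> * degree Q * max 0 y - \<alpha> * \<bar>y\<bar>)" if u: "norm u = exp (\<alpha> * y)" for u y
  proof -
    let ?E = "exp (\<alpha> * degree Q * max 0 y - \<alpha> * \<bar>y\<bar>)"
    have "norm (poly P u) \<le> (\<Sum>i\<le>degree P. norm (coeff P i) * ?E)"
      unfolding poly_altdef
    proof (rule sum_norm_le)
      fix i assume i: "i \<in> {..degree P}"
      show "norm (coeff P i * u ^ i) \<le> norm (coeff P i) * ?E"
      proof (cases "coeff P i = 0")
        case False
        then have i0: "i \<noteq> 0" using P(2) by (metis poly_0_coeff_0)
        \<comment> \<open>Every exponent in P lies strictly between 0 and the degree of Q.\<close>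
        have "real i * y \<le> degree Q * max 0 y - \<bar>y\<bar>"
        proof (cases "y \<ge> 0")
          case True
          have "real i + 1 \<le> degree Q" using i P(3) by simp
          then have "(real i + 1) * y \<le> degree Q * y" using True by (intro mult_right_mono) auto
          then show ?thesis using True by (simp add: algebra_simps)
        next
          case neg: False
          have "real i * (- y) \<ge> 1 * (- y)" using i0 neg by (intro mult_right_mono) auto
          then show ?thesis using neg by simp
        qed
        then have "\<alpha> * (real i * y) \<le> \<alpha> * (degree Q * max 0 y - \<bar>y\<bar>)" using \<alpha> by (intro mult_left_mono) auto
        then have "exp (real i * (\<alpha> * y)) \<le> ?E" unfolding exp_le_cancel_iff by (simp add: algebra_simps)
        then show ?thesis unfolding norm_mult norm_power u exp_of_nat_mult by (intro mult_left_mono) auto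
      qed simp
    qed
    also have "\<dots> \<le> B * ?E" unfolding sum_distrib_right[symmetric] B_def by (intro mult_right_mono) auto
    also have "\<dots> \<le> exp A * ?E"
    proof (intro mult_right_mono)
      have "ln B \<le> A" by (simp add: A_def)
      then show "B \<le> exp A" using B by (metis exp_le_cancel_iff exp_ln)
    qed simp
    also have "\<dots> = exp (A + \<alpha> * degree Q * max 0 y - \<alpha> * \<bar>y\<bar>)" by (simp add: exp_add[symmetric])
    finally show ?thesis .
  qed
  have A: "A \<ge> A0" by (simp add: A_def)
  have "exp_rational (k * \<alpha>) (s * \<alpha>) \<alpha> A 0 (degree Q0) h P0 Q0 (on_reals G)"
  proof
    show "0 < k * \<alpha>" by (rule k\<alpha>)
    show "0 < \<alpha>" by (rule \<alpha>)
    fix x :: real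
    have e: "(complex_of_real (exp (\<alpha> * x))) ^ k = of_real (exp (k * \<alpha> * x))"
      "(complex_of_real (exp (\<alpha> * x))) ^ s = of_real (exp (s * \<alpha> * x))"
      by (simp_all add: exp_of_nat_mult[symmetric] mult.assoc flip: of_real_power)
    have "on_reals G x = poly P (of_real (exp (\<alpha> * x))) / poly Q (of_real (exp (\<alpha> * x)))"
      by (simp add: on_reals_def K_repr_eval[OF G] exp_of_real[symmetric])
    then show "on_reals G x = of_real (exp (s * \<alpha> * x - real 0 * (k * \<alpha>) * x\<^sup>2 / 2)) *
        (poly P0 (of_real (exp (k * \<alpha> * x))) / poly Q0 (of_real (exp (k * \<alpha> * x))))"
      unfolding P0 Q0 e by simp
  next
    fix v :: complex and y :: real assume v: "norm v = exp (k * \<alpha> * y)"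
    have v0: "v \<noteq> 0" using v by (metis exp_not_eq_zero norm_zero)
    \<comment> \<open>A k-th root of v carries the bound on P over to P0.\<close>
    define u where "u = exp (Ln v / of_nat k)"
    have uk: "u ^ k = v" using k v0 by (simp add: u_def exp_of_nat_mult[symmetric])
    have "norm u ^ k = norm v" unfolding uk[symmetric] by (rule norm_power[symmetric])
    also have "\<dots> = exp (\<alpha> * y) ^ k" unfolding v exp_of_nat_mult[symmetric] by (simp add: mult.assoc)
    finally have "norm u ^ k = exp (\<alpha> * y) ^ k" .
    then have nu: "norm u = exp (\<alpha> * y)" by (rule power_eq_imp_eq_base) (use k in auto)
    have "exp (s * \<alpha> * y) = norm u ^ s" unfolding nu by (simp add: exp_of_nat_mult[symmetric] mult.assoc)
    then have "exp (s * \<alpha> * y - real 0 * (k * \<alpha>) * y\<^sup>2 / 2) * norm (poly P0 v) = norm (poly P u)"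
      by (simp add: P0 uk norm_mult norm_power)
    also have "\<dots> \<le> exp (A + \<alpha> * degree Q * max 0 y - \<alpha> * \<bar>y\<bar>)" by (rule Pb[OF nu])
    finally show "exp (s * \<alpha> * y - real 0 * (k * \<alpha>) * y\<^sup>2 / 2) * norm (poly P0 v) \<le> exp (A + k * \<alpha> * degree Q0 * max 0 y - \<alpha> * \<bar>y\<bar>)"
      by (simp add: deg mult_ac)
  qed (use den A in \<open>auto\<close>)
  then show ?thesis using deg unfolding k_def by blast
qed

section \<open>The lower density of a separated set\<close>

definition count_in :: "real set \<Rightarrow> real \<Rightarrow> real \<Rightarrow> real" where
  "count_in \<Lambda> R x = real (card (\<Lambda> \<inter> {x - R..x + R}))"

text \<open>The function whose limit at infinity is the lower density. Since a limit is a definite description, nothing can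
be said about the lower density before convergence is known.\<close>

definition min_density :: "real set \<Rightarrow> real \<Rightarrow> real" where
  "min_density \<Lambda> R = (INF x. count_in \<Lambda> R x / (2 * R))"

lemma lower_density_eq: "lower_density \<Lambda> = Lim at_top (min_density \<Lambda>)"
  unfolding lower_density_def min_density_def[abs_def] count_in_def ..

lemma min_density_le: "R > 0 \<Longrightarrow> min_density \<Lambda> R \<le> count_in \<Lambda> R x / (2 * R)"
  unfolding min_density_def
  by (rule cINF_lower) (auto intro!: bdd_belowI2[where m = 0] simp: count_in_def)

lemma min_density_ge: "(\<And>x. b \<le> count_in \<Lambda> R x / (2 * R)) \<Longrightarrow> b \<le> min_density \<Lambda> R"
  unfolding min_density_def by (rule cINF_greatest) auto

lemma min_density_nonneg: "R > 0 \<Longrightarrow> 0 \<le> min_density \<Lambda> R"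
  by (rule min_density_ge) (simp add: count_in_def)

lemma gap_count_upper:
  assumes \<Lambda>: "gap s \<Lambda>" and R: "R > 0"
  shows "count_in \<Lambda> R x \<le> 2 * R / s + 2"
proof -
  have s: "s > 0" using \<Lambda> by (simp add: gap_def)
  let ?h = "\<lambda>y. \<lfloor>(y - x) / s\<rfloor>" and ?X = "\<Lambda> \<inter> {x - R..x + R}"
  have inj: "inj_on ?h ?X" by (rule gap_inj_floor[OF gap_subset[OF \<Lambda>]]) simp
  have sub: "?h ` ?X \<subseteq> {\<lfloor>- R / s\<rfloor>..\<lfloor>R / s\<rfloor>}"
  proof
    fix j assume "j \<in> ?h ` ?X"
    then obtain y where y: "j = ?h y" "x - R \<le> y" "y \<le> x + R" by auto
    have "- R / s \<le> (y - x) / s" "(y - x) / s \<le> R / s" using divide_right_mono[of "- R" "y - x" s] divide_right_mono[of "y - x" R s] y s by auto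
    then show "j \<in> {\<lfloor>- R / s\<rfloor>..\<lfloor>R / s\<rfloor>}" unfolding y(1) by (auto intro: floor_mono)
  qed
  have "card ?X = card (?h ` ?X)" by (rule card_image[OF inj, symmetric])
  also have "\<dots> \<le> card {\<lfloor>- R / s\<rfloor>..\<lfloor>R / s\<rfloor>}" by (intro card_mono sub) simp
  finally have "count_in \<Lambda> R x \<le> real (nat (\<lfloor>R / s\<rfloor> - \<lfloor>- R / s\<rfloor> + 1))" by (simp add: count_in_def)
  also have "\<dots> \<le> R / s - (- R / s - 1) + 1"
  proof -
    have "0 \<le> R / s" using R s by simp
    then have "0 \<le> \<lfloor>R / s\<rfloor>" "\<lfloor>- R / s\<rfloor> \<le> 0" by auto
    then show ?thesis by simp linarith
  qed
  finally show ?thesis by simp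
qed

text \<open>An interval of half-length m r' contains m disjoint closed intervals of half-length r < r'. The strict
inequality keeps the closed intervals from sharing end points.\<close>

lemma count_superadditive:
  assumes \<Lambda>: "gap s \<Lambda>" and r: "0 < r" "r < r'"
  shows "real m * (2 * r * min_density \<Lambda> r) \<le> count_in \<Lambda> (real m * r') x"
proof -
  \<comment> \<open>Centres of the m intervals of half-length r' that tile the large interval.\<close>
  let ?c = "\<lambda>i. x - real m * r' + (2 * real i + 1) * r'"
  let ?Y = "\<lambda>i. \<Lambda> \<inter> {?c i - r..?c i + r}"
  have fin: "finite (?Y i)" for i by (rule gap_finite_Int[OF \<Lambda>]) simp
  have disj: "?Y i \<inter> ?Y j = {}" if "i \<noteq> j" for i j
  proof -
    have *: "?Y i \<inter> ?Y j = {}" if "i < j" for i j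
    proof -
      have "real i + 1 \<le> real j" using that by linarith
      then have "2 * (real i + 1) * r' \<le> 2 * real j * r'" using r by (intro mult_right_mono) auto
      then have "?c i + r < ?c j - r" using r by (simp add: algebra_simps)
      then show ?thesis by auto
    qed
    show ?thesis using *[of i j] *[of j i] that by (metis inf_commute linorder_neqE_nat)
  qed
  have sub: "(\<Union>i<m. ?Y i) \<subseteq> \<Lambda> \<inter> {x - real m * r'..x + real m * r'}"
  proof
    fix y assume "y \<in> (\<Union>i<m. ?Y i)"
    then obtain i where i: "i < m" "y \<in> ?Y i" by blast
    define p where "p = real i * r'"
    define q where "q = real m * r'"
    have "(real i + 1) * r' \<le> real m * r'" using i r by (intro mult_right_mono) auto
    then have "p + r' \<le> q" by (simp add: p_def q_def algebra_simps)
    moreover have "0 \<le> p" using r by (simp add: p_def)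
    moreover have "?c i = x - q + 2 * p + r'" by (simp add: p_def q_def algebra_simps)
    ultimately show "y \<in> \<Lambda> \<inter> {x - real m * r'..x + real m * r'}"
      using i(2) r unfolding q_def[symmetric] by auto
  qed
  have "real m * (2 * r * min_density \<Lambda> r) = (\<Sum>i<m. 2 * r * min_density \<Lambda> r)" by simp
  also have "\<dots> \<le> (\<Sum>i<m. real (card (?Y i)))"
  proof (rule sum_mono)
    fix i
    show "2 * r * min_density \<Lambda> r \<le> real (card (?Y i))"
      using min_density_le[of r \<Lambda> "?c i"] r by (simp add: count_in_def field_simps)
  qed
  also have "\<dots> = real (card (\<Union>i<m. ?Y i))"
    using fin disj by (subst card_UN_disjoint) auto
  also have "\<dots> \<le> count_in \<Lambda> (real m * r') x"
    unfolding count_in_def using sub by (intro of_nat_mono card_mono gap_finite_Int[OF \<Lambda>]) auto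
  finally show ?thesis .
qed

lemma count_mono: "gap s \<Lambda> \<Longrightarrow> R \<le> R' \<Longrightarrow> count_in \<Lambda> R x \<le> count_in \<Lambda> R' x"
  unfolding count_in_def by (intro of_nat_mono card_mono gap_finite_Int[of s]) auto

lemma min_density_lower:
  assumes \<Lambda>: "gap s \<Lambda>" and r: "0 < r" "r < r'" "r' < R"
  shows "min_density \<Lambda> r * (r / r' - r / R) \<le> min_density \<Lambda> R"
proof (rule min_density_ge)
  fix x
  define m where "m = nat \<lfloor>R / r'\<rfloor>"
  have m: "R / r' - 1 \<le> real m" "real m \<le> R / r'" using r by (auto simp: m_def)
  have mR: "real m * r' \<le> R" using m(2) r by (simp add: field_simps)
  have v: "0 \<le> 2 * r * min_density \<Lambda> r" using r min_density_nonneg[of r \<Lambda>] by simp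
  have "(R / r' - 1) * (2 * r * min_density \<Lambda> r) \<le> real m * (2 * r * min_density \<Lambda> r)"
    by (intro mult_right_mono m v)
  also have "\<dots> \<le> count_in \<Lambda> (real m * r') x" by (rule count_superadditive[OF \<Lambda> r(1,2)])
  also have "\<dots> \<le> count_in \<Lambda> R x" by (rule count_mono[OF \<Lambda> mR])
  finally have "(R / r' - 1) * (2 * r * min_density \<Lambda> r) / (2 * R) \<le> count_in \<Lambda> R x / (2 * R)"
    using r by (intro divide_right_mono) auto
  moreover have "(R / r' - 1) * (2 * r * min_density \<Lambda> r) / (2 * R) = min_density \<Lambda> r * (r / r' - r / R)"
    using r by (simp add: field_simps)
  ultimately show "min_density \<Lambda> r * (r / r' - r / R) \<le> count_in \<Lambda> R x / (2 * R)" by simp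
qed

text \<open>As in Fekete's lemma, superadditivity makes the limit equal to the supremum.\<close>

lemma min_density_tendsto:
  assumes \<Lambda>: "gap s \<Lambda>"
  shows "(min_density \<Lambda> \<longlongrightarrow> lower_density \<Lambda>) at_top"
proof -
  have s: "s > 0" using \<Lambda> by (simp add: gap_def)
  define V where "V = (SUP R\<in>{1..}. min_density \<Lambda> R)"
  have bdd: "bdd_above (min_density \<Lambda> ` {1..})"
  proof (rule bdd_aboveI2)
    fix R :: real assume R: "R \<in> {1..}"
    have "min_density \<Lambda> R \<le> count_in \<Lambda> R 0 / (2 * R)" using R by (intro min_density_le) auto
    also have "\<dots> \<le> (2 * R / s + 2) / (2 * R)" using R by (intro divide_right_mono gap_count_upper[OF \<Lambda>]) auto
    also have "\<dots> = 1 / s + 1 / R" using R s by (simp add: add_divide_distrib)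
    also have "\<dots> \<le> 1 / s + 1" using R by simp
    finally show "min_density \<Lambda> R \<le> 1 / s + 1" .
  qed
  have "(min_density \<Lambda> \<longlongrightarrow> V) at_top"
  proof (rule order_tendstoI)
    fix a assume "V < a"
    moreover have "min_density \<Lambda> R \<le> V" if "R \<ge> 1" for R
      unfolding V_def by (rule cSUP_upper[OF _ bdd]) (use that in auto)
    ultimately show "\<forall>\<^sub>F R in at_top. min_density \<Lambda> R < a"
      by (intro eventually_mono[OF eventually_ge_at_top[of 1]]) (meson le_less_trans)
  next
    fix a assume a: "a < V"
    show "\<forall>\<^sub>F R in at_top. a < min_density \<Lambda> R"
    proof (cases "a < 0")
      case True
      then show ?thesis
        by (intro eventually_mono[OF eventually_gt_at_top[of 0]]) (meson less_le_trans min_density_nonneg)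
    next
      case False
      obtain r where r: "r \<in> {1..}" "a < min_density \<Lambda> r"
        using a less_cSUP_iff[OF _ bdd, of a] unfolding V_def by auto
      define v where "v = min_density \<Lambda> r"
      \<comment> \<open>With intervals of half-length (1 + \<eta>)r as tiles the loss factor 1/(1 + \<eta>) still leaves v/(1 + \<eta>) > a.\<close>
      define \<eta> where "\<eta> = (v - a) / (2 * (a + 1))"
      have \<eta>: "\<eta> > 0" using r False by (simp add: \<eta>_def v_def)
      have half_less: "(v - a) / 2 < v - a \<longleftrightarrow> a < v" by auto
      have "t / (2 * b) * b = t / 2" if "b \<noteq> 0" for t b :: real using that by simp
      from this[of "a + 1" "v - a"] have "\<eta> * (a + 1) = (v - a) / 2" using False unfolding \<eta>_def by simp
      moreover have "v > a" using r(2) by (simp add: v_def)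
      ultimately have "\<eta> * (a + 1) < v - a" by (simp only: half_less)
      then have "a * (1 + \<eta>) < v" using \<eta> by (simp add: algebra_simps)
      then have lim: "a < v * (1 / (1 + \<eta>) - 0)" using \<eta> by (simp add: field_simps)
      have "((\<lambda>R. r / R) \<longlongrightarrow> 0) at_top"
        by (rule tendsto_divide_0[OF tendsto_const]) (rule filterlim_at_top_imp_at_infinity[OF filterlim_ident])
      then have "((\<lambda>R. v * (1 / (1 + \<eta>) - r / R)) \<longlongrightarrow> v * (1 / (1 + \<eta>) - 0)) at_top"
        by (intro tendsto_mult tendsto_diff tendsto_const)
      from order_tendstoD(1)[OF this lim] eventually_gt_at_top[of "r * (1 + \<eta>)"]
      show ?thesis
      proof eventually_elim
        case (elim R)
        have "min_density \<Lambda> r * (r / (r * (1 + \<eta>)) - r / R) \<le> min_density \<Lambda> R"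
          using r \<eta> elim by (intro min_density_lower[OF \<Lambda>]) auto
        moreover have "r / (r * (1 + \<eta>)) = 1 / (1 + \<eta>)" using r by simp
        ultimately show ?case using elim by (simp add: v_def)
      qed
    qed
  qed
  then show ?thesis unfolding lower_density_eq by (simp add: tendsto_Lim)
qed

text \<open>A density strictly above d provides one point more than dL in every sufficiently long block; this surplus
point is what the local sampling inequality lives on.\<close>

lemma dense_blocks_of_density:
  assumes \<Lambda>: "gap s \<Lambda>" and D: "lower_density \<Lambda> > real d"
  shows "\<exists>L\<ge>1. dense_blocks L (d * L + 1) \<Lambda>"
proof -
  obtain d' where d': "real d < d'" "d' < lower_density \<Lambda>" using D dense by blast
  obtain R0 where R0: "\<And>R. R \<ge> R0 \<Longrightarrow> d' < min_density \<Lambda> R"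
    using order_tendstoD(1)[OF min_density_tendsto[OF \<Lambda>] d'(2)] unfolding eventually_at_top_linorder by blast
  \<comment> \<open>Blocks so long that the surplus density d' - d outweighs the length 1 missing from the closed interval.\<close>
  obtain L0 :: nat where L0: "max (2 * \<bar>R0\<bar> + 2) (d' / (d' - d)) < L0" using reals_Archimedean2 by blast
  have L1: "L0 \<ge> 1" using L0 by (simp add: max_def split: if_splits)
  define R where "R = (real L0 - 1) / 2"
  have R: "R \<ge> R0" "R > 0" using L0 by (auto simp: R_def)
  have big: "d' * (real L0 - 1) > real d * real L0"
  proof -
    have "d' / (d' - d) < L0" using L0 by simp
    then have "d' < L0 * (d' - d)" using d' by (simp add: field_simps)
    then show ?thesis by (simp add: algebra_simps)
  qed
  have "d * L0 + 1 \<le> card (\<Lambda> \<inter> {a..a + (real L0 - 1)})" for a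
  proof -
    have "d' < min_density \<Lambda> R" by (rule R0[OF R(1)])
    also have "\<dots> \<le> count_in \<Lambda> R (a + R) / (2 * R)" by (rule min_density_le[OF R(2)])
    finally have "d' * (2 * R) < count_in \<Lambda> R (a + R)" using R by (simp add: field_simps)
    moreover have "a + R - R = a" "a + R + R = a + (real L0 - 1)" "2 * R = real L0 - 1" by (simp_all add: R_def)
    ultimately have "d' * (real L0 - 1) < real (card (\<Lambda> \<inter> {a..a + (real L0 - 1)}))"
      by (simp only: count_in_def)
    then have "real (d * L0) < real (card (\<Lambda> \<inter> {a..a + (real L0 - 1)}))" using big by simp
    then show ?thesis by (simp only: of_nat_less_iff)
  qed
  then show ?thesis using L1 unfolding dense_blocks_def by blast
qed

lemma card_Ints_interval:
  fixes a b :: real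
  shows "real (card (\<int> \<inter> {a..b})) = real (nat (\<lfloor>b\<rfloor> - \<lceil>a\<rceil> + 1))"
proof -
  have "(\<int> \<inter> {a..b}) = real_of_int ` {\<lceil>a\<rceil>..\<lfloor>b\<rfloor>}"
    by (auto simp: Ints_def ceiling_le_iff le_floor_iff)
  then show ?thesis by (simp add: card_image[OF inj_of_int_real])
qed

lemma lower_density_Ints: "lower_density \<int> = 1"
proof -
  have b: "(2 * R - 1) / (2 * R) \<le> min_density \<int> R" "min_density \<int> R \<le> (2 * R + 1) / (2 * R)" if R: "R \<ge> 1" for R
  proof -
    show "(2 * R - 1) / (2 * R) \<le> min_density \<int> R"
    proof (rule min_density_ge, rule divide_right_mono)
      show "2 * R - 1 \<le> count_in \<int> R x" for x
        unfolding count_in_def card_Ints_interval by linarith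
    qed (use R in simp)
    have "count_in \<int> R 0 \<le> 2 * R + 1"
      unfolding count_in_def card_Ints_interval using R by linarith
    then show "min_density \<int> R \<le> (2 * R + 1) / (2 * R)"
      using R by (intro order_trans[OF min_density_le divide_right_mono]) auto
  qed
  have z: "((\<lambda>R::real. 1 / (2 * R)) \<longlongrightarrow> 0) at_top"
  proof (rule tendsto_divide_0[OF tendsto_const], rule filterlim_at_top_imp_at_infinity)
    show "filterlim (\<lambda>R::real. 2 * R) at_top at_top"
      by (intro filterlim_tendsto_pos_mult_at_top[OF tendsto_const]) (auto intro: filterlim_ident)
  qed
  have "(min_density \<int> \<longlongrightarrow> 1) at_top"
  proof (rule tendsto_sandwich)
    show "((\<lambda>R::real. 1 - 1 / (2 * R)) \<longlongrightarrow> 1) at_top" using tendsto_diff[OF tendsto_const z, of 1] by simp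
    show "((\<lambda>R::real. 1 + 1 / (2 * R)) \<longlongrightarrow> 1) at_top" using tendsto_add[OF tendsto_const z, of 1] by simp
    show "\<forall>\<^sub>F R in at_top. 1 - 1 / (2 * R) \<le> min_density \<int> R"
      using eventually_ge_at_top[of "1::real"] by eventually_elim (use b in \<open>simp add: diff_divide_distrib\<close>)
    show "\<forall>\<^sub>F R in at_top. min_density \<int> R \<le> 1 + 1 / (2 * R)"
      using eventually_ge_at_top[of "1::real"] by eventually_elim (use b in \<open>simp add: add_divide_distrib\<close>)
  qed
  then show ?thesis unfolding lower_density_eq by (simp add: tendsto_Lim)
qed

lemma separated_set_Ints: "separated_set \<int>"
proof -
  have "countable (\<int> :: real set)" unfolding Ints_def by simp
  moreover have "1 \<le> (INF p\<in>{(x::real, y). x \<in> \<int> \<and> y \<in> \<int> \<and> x \<noteq> y}. ereal \<bar>fst p - snd p\<bar>)"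
    using gap_Ints by (intro INF_greatest) (auto simp: gap_def)
  ultimately show ?thesis unfolding separated_set_def
    using less_le_trans[of 0 "1::ereal"] by simp
qed

section \<open>Frames above the critical density\<close>

lemma frame_of_lower_density:
  assumes er: "exp_rational \<alpha> \<beta> \<delta> A \<gamma> q h P Q g" and nv: "fourier_nonvanishing g"
    and \<Lambda>: "separated_set \<Lambda>" and D: "lower_density \<Lambda> > real (q + \<gamma>)"
  shows "gabor_frame g (\<Lambda> \<times> \<int>)"
proof -
  interpret exp_rational \<alpha> \<beta> \<delta> A \<gamma> q h P Q g by (rule er)
  obtain s where s: "gap s \<Lambda>" using separated_set_imp_gap[OF \<Lambda>] .
  obtain L where L: "L \<ge> 1" "dense_blocks L ((q + \<gamma>) * L + 1) \<Lambda>"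
    using dense_blocks_of_density[OF s D] by blast
  have s0: "s > 0" using s by (simp add: gap_def)
  obtain a where a: "a > 0" and samp: "\<forall>N::nat. \<exists>R. \<forall>\<Gamma> c I. gap s \<Gamma> \<longrightarrow> dense_blocks L ((q + \<gamma>) * L + 1) \<Gamma> \<longrightarrow> I \<subseteq> {- int N..int N} \<longrightarrow>
     a * (\<Sum>k\<in>I. (norm (c k))\<^sup>2) \<le> (\<Sum>y\<in>\<Gamma> \<inter> {- R..R}. (norm (shift_sum g c I y))\<^sup>2)"
    using sampling_inequality[OF nv L(1) s0] by (elim exE conjE)
  show ?thesis
  proof (rule gabor_frame_of_sampling[OF s a])
    fix N :: nat
    obtain R where R: "\<forall>\<Gamma> c I. gap s \<Gamma> \<longrightarrow> dense_blocks L ((q + \<gamma>) * L + 1) \<Gamma> \<longrightarrow> I \<subseteq> {- int N..int N} \<longrightarrow>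
     a * (\<Sum>k\<in>I. (norm (c k))\<^sup>2) \<le> (\<Sum>y\<in>\<Gamma> \<inter> {- R..R}. (norm (shift_sum g c I y))\<^sup>2)"
      using samp by (elim allE[of _ N] exE)
    show "\<exists>R. \<forall>x c I. 0 \<le> x \<longrightarrow> x < 1 \<longrightarrow> I \<subseteq> {- int N..int N} \<longrightarrow>
       a * (\<Sum>k\<in>I. (norm (c k))\<^sup>2) \<le> (\<Sum>y\<in>(\<lambda>l. x - l) ` \<Lambda> \<inter> {- R..R}. (norm (shift_sum g c I y))\<^sup>2)"
      by (intro exI[of _ R] allI impI R[rule_format] gap_reflect s dense_blocks_reflect L(2))
  qed
qed

theorem class_K_frame:
  assumes \<alpha>: "\<alpha> > 0" and G: "G \<in> class_K \<alpha>" and nv: "fourier_nonvanishing (on_reals G)"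
    and \<Lambda>: "separated_set \<Lambda>" and D: "lower_density \<Lambda> > real (K_degree \<alpha> G) / real (K_symmetry \<alpha> G)"
  shows "gabor_frame (on_reals G) (\<Lambda> \<times> \<int>)"
proof -
  obtain P Q where PQ: "K_repr \<alpha> G P Q" using G by (auto simp: class_K_def)
  obtain \<beta> A h P0 Q0 q0 where er: "exp_rational (K_symmetry \<alpha> G * \<alpha>) \<beta> \<alpha> A 0 q0 h P0 Q0 (on_reals G)"
    and deg: "degree Q = K_symmetry \<alpha> G * q0"
    using class_K_exp_rational[OF \<alpha> PQ] by (elim exE conjE)
  have "real (K_degree \<alpha> G) / real (K_symmetry \<alpha> G) = real (q0 + 0)"
    using K_symmetry_spec[OF \<alpha> PQ] by (simp add: K_degree_eq[OF \<alpha> PQ] deg)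
  then show ?thesis using frame_of_lower_density[OF er nv \<Lambda>] D by simp
qed

theorem class_C_frame:
  assumes \<alpha>: "\<alpha> > 0" and G: "G \<in> class_C \<alpha>" and nv: "fourier_nonvanishing (on_reals G)"
    and \<Lambda>: "separated_set \<Lambda>" and D: "lower_density \<Lambda> > real (C_degree \<alpha> G) + 1"
  shows "gabor_frame (on_reals G) (\<Lambda> \<times> \<int>)"
proof -
  obtain P Q where PQ: "C_repr \<alpha> G P Q" using G by (auto simp: class_C_def)
  obtain A h where er: "exp_rational \<alpha> 0 1 A 1 (degree Q) h P Q (on_reals G)"
    using class_C_exp_rational[OF \<alpha> PQ] by (elim exE)
  show ?thesis using frame_of_lower_density[OF er nv \<Lambda>] D by (simp add: C_degree_eq[OF \<alpha> PQ])
qed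


section \<open>Failure of the frame property for even generators at density one\<close>

context decaying_generator
begin

text \<open>The numbers character j (1/2) are the signs (-1)^j.\<close>

definition alternating_sum :: "int set \<Rightarrow> real \<Rightarrow> complex" where
  "alternating_sum K x = (\<Sum>j\<in>K. character j (1/2) * cnj (g (x + of_int j)))"

lemma character_half_reflect: "character (- 1 - j) (1/2) = - character j (1/2)"
proof -
  have "character (- j) (1/2) = character j (1/2) * character (- 2 * j) (1/2)"
    by (simp add: character_add[symmetric])
  also have "character (- 2 * j) (1/2) = 1"
    using character_periodic[of 1 0 "- j"] by (simp add: character_def mult.assoc)
  finally have "character (- j) (1/2) = character j (1/2)" by simp
  moreover have "character (- 1) (1/2) = - 1" by (simp add: character_def cis_conv_exp[symmetric] complex_eq_iff)
  ultimately show ?thesis using character_add[of "- 1" "- j" "1/2"] by simp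
qed

text \<open>At x = 1/2 the reflection j \<mapsto> -1-j preserves the values of an even generator and reverses the signs.\<close>

lemma alternating_sum_centre:
  assumes even: "\<And>x. g (- x) = g x"
  shows "alternating_sum {- int J..int J - 1} (1/2) = 0"
proof -
  have "alternating_sum {- int J..int J - 1} (1/2) = (\<Sum>j\<in>{- int J..int J - 1}. - (character j (1/2) * cnj (g (1/2 + of_int j))))"
    unfolding alternating_sum_def
  proof (rule sum.reindex_bij_witness[of _ "\<lambda>j. - 1 - j" "\<lambda>j. - 1 - j"])
    fix j :: int assume "j \<in> {- int J..int J - 1}"
    have "g (1/2 + of_int (- 1 - j)) = g (- (1/2 + of_int j))" by (rule arg_cong[of _ _ g]) simp
    also have "\<dots> = g (1/2 + of_int j)" by (rule even)
    finally have e: "g (1/2 + of_int (- 1 - j)) = g (1/2 + of_int j)" .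
    show "- (character (- 1 - j) (1/2) * cnj (g (1/2 + of_int (- 1 - j)))) = character j (1/2) * cnj (g (1/2 + of_int j))"
      unfolding e character_half_reflect by simp
  qed auto
  also have "\<dots> = - alternating_sum {- int J..int J - 1} (1/2)" by (simp add: alternating_sum_def sum_negf)
  finally show ?thesis by simp
qed

lemma alternating_sum_norm:
  assumes "0 \<le> x" "x \<le> 1"
  shows "norm (alternating_sum K x) \<le> (\<Sum>j\<in>K. C * exp \<delta> * exp (- \<delta> * \<bar>real_of_int j\<bar>))"
  unfolding alternating_sum_def
proof (rule sum_norm_le)
  fix j
  show "norm (character j (1/2) * cnj (g (x + of_int j))) \<le> C * exp \<delta> * exp (- \<delta> * \<bar>real_of_int j\<bar>)"
    using g_decay_shift[OF assms, of "of_int j"] by (simp add: norm_mult)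
qed

lemma alternating_sum_continuous: "continuous_on UNIV (alternating_sum K)"
  unfolding alternating_sum_def[abs_def]
  by (intro continuous_intros continuous_on_cnj continuous_on_compose2[OF g_cont]) auto

lemma exp_half_split:
  assumes "a \<le> (t::real)"
  shows "exp (- \<delta> * t) \<le> exp (- (\<delta> / 2) * a) * exp (- (\<delta> / 2) * t)"
proof -
  have "\<delta> * a \<le> \<delta> * t" using assms \<delta>_pos by (intro mult_left_mono) auto
  then show ?thesis unfolding exp_add[symmetric] exp_le_cancel_iff by (simp add: algebra_simps)
qed

lemma int_sum_exp: "finite K \<Longrightarrow> d > 0 \<Longrightarrow> (\<Sum>j\<in>K. exp (- d * \<bar>real_of_int j - y\<bar>)) \<le> tail_const 1 d"
  using gap_sum_exp[OF gap_of_int[of K], of d y] by (simp add: sum.reindex[OF inj_of_int_real])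

text \<open>The full alternating sum vanishes at 1/2 and is continuous. To stay with finite sums, this is expressed for
all finite ranges that contain a fixed symmetric one.\<close>

lemma alternating_sum_small:
  assumes even: "\<And>x. g (- x) = g x" and \<eta>: "\<eta> > 0"
  obtains J :: nat and \<epsilon> where "0 < \<epsilon>" "\<epsilon> < 1/2"
    "\<And>K x. finite K \<Longrightarrow> {- int J..int J - 1} \<subseteq> K \<Longrightarrow> \<bar>x - 1/2\<bar> \<le> \<epsilon> \<Longrightarrow> norm (alternating_sum K x) \<le> \<eta>"
proof -
  let ?D = "C * exp \<delta>" and ?T = "tail_const 1 (\<delta> / 2)"
  have T: "?T > 0" using tail_const_pos[of 1 "\<delta> / 2"] \<delta>_pos by simp
  obtain n :: nat where n: "(?D * ?T) * exp (- \<delta> * n) \<le> \<eta> / 2"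
    using exp_decay_small[of "?D * ?T" "\<eta> / 2"] T C_nonneg \<eta> by auto
  define J where "J = 2 * n"
  let ?I = "{- int J..int J - 1}"
  have tail: "norm (alternating_sum K x) \<le> \<eta> / 2" if K: "finite K" "K \<inter> ?I = {}" and x: "0 \<le> x" "x \<le> 1" for K x
  proof -
    have "norm (alternating_sum K x) \<le> (\<Sum>j\<in>K. ?D * exp (- \<delta> * \<bar>real_of_int j\<bar>))" by (rule alternating_sum_norm[OF x])
    also have "\<dots> \<le> (\<Sum>j\<in>K. ?D * (exp (- (\<delta> / 2) * real J) * exp (- (\<delta> / 2) * \<bar>real_of_int j - 0\<bar>)))"
    proof (rule sum_mono)
      fix j assume "j \<in> K"
      then have "j \<notin> ?I" using K by blast
      then have "int J \<le> \<bar>j\<bar>" by auto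
      then have "real J \<le> \<bar>real_of_int j\<bar>" by linarith
      from mult_left_mono[OF exp_half_split[OF this], of ?D]
      show "?D * exp (- \<delta> * \<bar>real_of_int j\<bar>) \<le> ?D * (exp (- (\<delta> / 2) * real J) * exp (- (\<delta> / 2) * \<bar>real_of_int j - 0\<bar>))"
        using C_nonneg by simp
    qed
    also have "\<dots> = ?D * exp (- (\<delta> / 2) * real J) * (\<Sum>j\<in>K. exp (- (\<delta> / 2) * \<bar>real_of_int j - 0\<bar>))"
      by (simp only: sum_distrib_left mult.assoc)
    also have "\<dots> \<le> ?D * exp (- (\<delta> / 2) * real J) * ?T"
      using K \<delta>_pos C_nonneg by (intro mult_left_mono int_sum_exp) auto
    also have "\<dots> = (?D * ?T) * exp (- \<delta> * n)" by (simp add: J_def)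
    finally show ?thesis using n by linarith
  qed
  have "continuous (at (1/2)) (alternating_sum ?I)"
    using alternating_sum_continuous continuous_on_eq_continuous_at open_UNIV by blast
  then obtain r where r: "r > 0" "\<And>x. dist x (1/2) < r \<Longrightarrow> dist (alternating_sum ?I x) (alternating_sum ?I (1/2)) < \<eta> / 2"
    unfolding continuous_at_eps_delta using \<eta> by (metis half_gt_zero)
  \<comment> \<open>The bound 1/4 keeps the bump inside the unit interval.\<close>
  define \<epsilon> where "\<epsilon> = min (1/4) (r / 2)"
  have \<epsilon>: "0 < \<epsilon>" "\<epsilon> < 1/2" "\<epsilon> < r" "\<epsilon> \<le> 1/4" using r(1) by (auto simp: \<epsilon>_def)
  have "norm (alternating_sum K x) \<le> \<eta>" if K: "finite K" "?I \<subseteq> K" and x: "\<bar>x - 1/2\<bar> \<le> \<epsilon>" for K x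
  proof -
    have x01: "0 \<le> x" "x \<le> 1" using x \<epsilon> by linarith+
    have "dist x (1/2) < r" using x \<epsilon> by (simp add: dist_real_def)
    from r(2)[OF this] have "norm (alternating_sum ?I x) < \<eta> / 2"
      unfolding alternating_sum_centre[OF even] by simp
    moreover have "norm (alternating_sum (K - ?I) x) \<le> \<eta> / 2" using K by (intro tail x01) auto
    moreover have "alternating_sum K x = alternating_sum (K - ?I) x + alternating_sum ?I x"
      unfolding alternating_sum_def by (rule sum.subset_diff[OF K(2,1)])
    ultimately show ?thesis using norm_triangle_ineq[of "alternating_sum (K - ?I) x" "alternating_sum ?I x"] by simp
  qed
  then show ?thesis using that[of \<epsilon> J] \<epsilon> by blast
qed

definition bumps :: "nat \<Rightarrow> real \<Rightarrow> real \<Rightarrow> complex" where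
  "bumps N \<epsilon> y = (\<Sum>k\<in>{- int N..int N}. character k (1/2) * indicator {1/2 - \<epsilon>..1/2 + \<epsilon>} (y - of_int k))"

context
  fixes N :: nat and \<epsilon> :: real and E :: "real set"
  assumes \<epsilon>: "0 < \<epsilon>" "\<epsilon> < 1/2" and E: "E = {1/2 - \<epsilon>..1/2 + \<epsilon>}"
begin

lemma bumps_at:
  assumes x: "x \<in> {0..<1}"
  shows "bumps N \<epsilon> (x + of_int j) = (if \<bar>j\<bar> \<le> int N then character j (1/2) * indicator E x else 0)"
proof -
  have "indicator {1/2 - \<epsilon>..1/2 + \<epsilon>} (x + of_int j - of_int k) = (if k = j then indicator E x else (0::complex))" for k
  proof (cases "k = j")
    case False
    then have "j - k \<le> - 1 \<or> 1 \<le> j - k" by linarith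
    then have "real_of_int (j - k) \<le> - 1 \<or> 1 \<le> real_of_int (j - k)" by linarith
    then show ?thesis using x \<epsilon> False by (auto simp: indicator_def)
  qed (simp add: E)
  then have "bumps N \<epsilon> (x + of_int j) = (\<Sum>k\<in>{- int N..int N}. if k = j then character j (1/2) * indicator E x else 0)"
    unfolding bumps_def by (intro sum.cong refl) simp
  also have "\<dots> = (if j \<in> {- int N..int N} then character j (1/2) * indicator E x else 0)"
    by (simp add: sum.delta')
  finally show ?thesis by (auto simp: abs_le_iff)
qed

lemma bumps_support: "real (N + 1) < \<bar>y\<bar> \<Longrightarrow> bumps N \<epsilon> y = 0"
proof -
  assume y: "real (N + 1) < \<bar>y\<bar>"
  have "\<not> \<bar>\<lfloor>y\<rfloor>\<bar> \<le> int N" using y by linarith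
  moreover have "bumps N \<epsilon> (frac y + of_int \<lfloor>y\<rfloor>) = bumps N \<epsilon> y" by (simp add: frac_def)
  ultimately show ?thesis using bumps_at[of "frac y" "\<lfloor>y\<rfloor>"] by (simp add: frac_lt_1)
qed

lemma bumps_L2: "bumps N \<epsilon> \<in> L2_functions"
proof -
  have "(\<lambda>y. indicator {1/2 - \<epsilon>..1/2 + \<epsilon>} (y - of_int k) :: complex) \<in> borel_measurable borel" for k :: int
  proof -
    have "(indicator {1/2 - \<epsilon>..1/2 + \<epsilon>} :: real \<Rightarrow> complex) \<in> borel_measurable borel" by simp
    from measurable_compose[OF _ this] show ?thesis by simp
  qed
  then have m: "bumps N \<epsilon> \<in> borel_measurable borel"
    unfolding bumps_def[abs_def] by (intro borel_measurable_sum borel_measurable_times) auto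
  have b: "norm (bumps N \<epsilon> y) \<le> indicator {- real (N + 1)..real (N + 1)} y" for y
  proof (cases "real (N + 1) < \<bar>y\<bar>")
    case True
    then show ?thesis by (simp add: bumps_support)
  next
    case False
    have "bumps N \<epsilon> (frac y + of_int \<lfloor>y\<rfloor>) = bumps N \<epsilon> y" by (simp add: frac_def)
    moreover have fr: "frac y \<in> {0..<1}" by (simp add: frac_lt_1)
    have "norm (bumps N \<epsilon> (frac y + of_int \<lfloor>y\<rfloor>)) \<le> 1"
      unfolding bumps_at[OF fr] by (auto simp: norm_mult indicator_def)
    ultimately have "norm (bumps N \<epsilon> y) \<le> 1" by simp
    then show ?thesis using False by (auto simp: indicator_def abs_le_iff not_less)
  qed
  have "integrable lborel (indicat_real {- real (N + 1)..real (N + 1)})" by simp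
  then have "integrable lborel (\<lambda>y. (norm (bumps N \<epsilon> y))\<^sup>2)"
  proof (rule Bochner_Integration.integrable_bound)
    have "(norm (bumps N \<epsilon> y))\<^sup>2 \<le> indicator {- real (N + 1)..real (N + 1)} y" for y
      by (rule order_trans[OF power_mono[OF b[of y] norm_ge_zero, of 2]]) (simp add: indicator_def)
    then show "AE y in lborel. norm ((norm (bumps N \<epsilon> y))\<^sup>2) \<le> norm (indicat_real {- real (N + 1)..real (N + 1)} y)"
      by (intro AE_I2) (simp add: indicator_def)
    show "(\<lambda>y. (norm (bumps N \<epsilon> y))\<^sup>2) \<in> borel_measurable lborel" using m by simp
  qed
  then show ?thesis using m by (simp add: L2_functions_def)
qed

definition "bump_range = {- int (N + 1 + 1)..int (N + 1 + 1)}"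

lemma E_sub: "E \<subseteq> {0..<1}" using \<epsilon> by (auto simp: E)

lemma integral_E: "(LINT x|\<U>. indicat_real E x * c) = 2 * \<epsilon> * c"
proof -
  have "(LINT x|\<U>. indicat_real E x * c) = (LINT x|lborel. indicat_real E x * c)"
  proof -
    have "indicat_real {0..<1} x *\<^sub>R (indicat_real E x * c) = indicat_real E x * c" for x
      using E_sub by (auto simp: indicator_def)
    moreover have "(LINT x|\<U>. indicat_real E x * c) = (LINT x|lborel. indicat_real {0..<1} x *\<^sub>R (indicat_real E x * c))"
      by (rule integral_restrict_space) auto
    ultimately show ?thesis by (simp only:)
  qed
  also have "\<dots> = 2 * \<epsilon> * c" using \<epsilon> by (simp add: E)
  finally show ?thesis .
qed

lemma bumps_norm: "(L2_norm (bumps N \<epsilon>))\<^sup>2 = 2 * \<epsilon> * (2 * real N + 1)"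
proof -
  have "(\<Sum>k\<in>bump_range. (norm (bumps N \<epsilon> (x + of_int k)))\<^sup>2) = indicat_real E x * (2 * real N + 1)" if x: "x \<in> {0..<1}" for x
  proof -
    have "(\<Sum>k\<in>bump_range. (norm (bumps N \<epsilon> (x + of_int k)))\<^sup>2) = (\<Sum>k\<in>bump_range. if k \<in> {- int N..int N} then indicat_real E x else 0)"
      by (intro sum.cong refl) (auto simp: bumps_at[OF x] norm_mult indicator_def)
    also have "\<dots> = (\<Sum>k\<in>{- int N..int N}. indicat_real E x)"
      by (rule sum.mono_neutral_cong_right) (auto simp: bump_range_def)
    finally show ?thesis by simp
  qed
  then have "(LINT x|\<U>. (\<Sum>k\<in>bump_range. (norm (bumps N \<epsilon> (x + of_int k)))\<^sup>2)) = (LINT x|\<U>. indicat_real E x * (2 * real N + 1))"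
    by (intro Bochner_Integration.integral_cong) auto
  moreover have "(L2_norm (bumps N \<epsilon>))\<^sup>2 = (LINT x|\<U>. (\<Sum>k\<in>bump_range. (norm (bumps N \<epsilon> (x + of_int k)))\<^sup>2))"
    by (rule compact_norm(2)[OF bumps_L2 bumps_support bump_range_def])
  ultimately show ?thesis by (simp only: integral_E)
qed

lemma bumps_fiber:
  assumes x: "x \<in> {0..<1}"
  shows "norm (fiber (bumps N \<epsilon>) bump_range (of_int l) x) = indicat_real E x * norm (alternating_sum {- int N - l..int N - l} x)"
proof -
  have "fiber (bumps N \<epsilon>) bump_range (of_int l) x =
     (\<Sum>k\<in>bump_range. if k \<in> {- int N..int N} then indicator E x * (character k (1/2) * cnj (g (x + of_int k - of_int l))) else 0)"
    unfolding fiber_def by (intro sum.cong refl) (auto simp: bumps_at[OF x])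
  also have "\<dots> = (\<Sum>k\<in>{- int N..int N}. indicator E x * (character k (1/2) * cnj (g (x + of_int k - of_int l))))"
    by (rule sum.mono_neutral_cong_right) (auto simp: bump_range_def)
  also have "\<dots> = (\<Sum>j\<in>{- int N - l..int N - l}. indicator E x * (character (j + l) (1/2) * cnj (g (x + of_int j))))"
    by (rule sum.reindex_bij_witness[of _ "\<lambda>j. j + l" "\<lambda>k. k - l"]) (auto simp: algebra_simps)
  also have "\<dots> = indicator E x * character l (1/2) * alternating_sum {- int N - l..int N - l} x"
    unfolding alternating_sum_def sum_distrib_left by (intro sum.cong refl) (simp add: character_add)
  finally show ?thesis by (simp add: norm_mult indicator_def)
qed

lemma bumps_energy:
  assumes T: "\<And>x K. x \<in> E \<Longrightarrow> finite K \<Longrightarrow> (\<Sum>l\<in>K. (norm (alternating_sum {- int N - l..int N - l} x))\<^sup>2) \<le> T"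
  shows "infsum (gabor_energy (bumps N \<epsilon>)) (\<int> \<times> \<int>) \<le> 2 * \<epsilon> * T"
proof (rule infsum_le_finite_sums)
  show "gabor_energy (bumps N \<epsilon>) summable_on \<int> \<times> \<int>"
    by (rule energy_bessel(1)[OF gap_Ints bumps_L2])
  fix S :: "(real \<times> real) set" assume S: "finite S" "S \<subseteq> \<int> \<times> \<int>"
  have "fst ` S \<subseteq> range real_of_int" using S by (auto simp: Ints_def)
  then obtain K where K: "finite K" "fst ` S = real_of_int ` K"
    using finite_subset_image[of "fst ` S" real_of_int UNIV] S by auto
  have "(\<Sum>p\<in>S. gabor_energy (bumps N \<epsilon>) p) \<le> (\<Sum>l\<in>fst ` S. LINT x|\<U>. (norm (fiber (bumps N \<epsilon>) bump_range l x))\<^sup>2)"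
    by (rule finite_energy_le_rows[OF bumps_L2 bumps_support bump_range_def S])
  also have "\<dots> = (LINT x|\<U>. (\<Sum>l\<in>fst ` S. (norm (fiber (bumps N \<epsilon>) bump_range l x))\<^sup>2))"
    by (rule rows_integral[OF bumps_L2 bumps_support bump_range_def]) (assumption, rule finite_imageI[OF S(1)])
  also have "\<dots> \<le> (LINT x|\<U>. indicat_real E x * T)"
  proof (rule integral_mono)
    show "integrable \<U> (\<lambda>x. \<Sum>l\<in>fst ` S. (norm (fiber (bumps N \<epsilon>) bump_range l x))\<^sup>2)"
      by (intro Bochner_Integration.integrable_sum fiber_square_integrable[OF bumps_L2 bumps_support bump_range_def])
    have "indicat_real E \<in> borel_measurable borel" by (simp add: E)
    then have "indicat_real E \<in> borel_measurable \<U>" by (rule measurable_U)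
    then have m: "(\<lambda>x. indicat_real E x * T) \<in> borel_measurable \<U>" by (intro borel_measurable_times) auto
    show "integrable \<U> (\<lambda>x. indicat_real E x * T)"
      by (rule integrable_bounded_U[OF m, of "\<bar>T\<bar>"]) (auto simp: indicator_def)
    fix x assume "x \<in> space \<U>"
    then have x: "x \<in> {0..<1}" by simp
    have "(\<Sum>l\<in>fst ` S. (norm (fiber (bumps N \<epsilon>) bump_range l x))\<^sup>2) = indicat_real E x * (\<Sum>l\<in>K. (norm (alternating_sum {- int N - l..int N - l} x))\<^sup>2)"
      unfolding K(2) sum.reindex[OF inj_of_int_real] o_def bumps_fiber[OF x]
      by (simp add: indicator_def)
    also have "\<dots> \<le> indicat_real E x * T" using T[OF _ K(1), of x] by (cases "x \<in> E") auto
    finally show "(\<Sum>l\<in>fst ` S. (norm (fiber (bumps N \<epsilon>) bump_range l x))\<^sup>2) \<le> indicat_real E x * T" .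
  qed
  also have "\<dots> = 2 * \<epsilon> * T" by (rule integral_E)
  finally show "(\<Sum>p\<in>S. gabor_energy (bumps N \<epsilon>) p) \<le> 2 * \<epsilon> * T" .
qed

end

text \<open>For translates beyond the ends of the train, or within distance J of an end, the range of summation misses the
symmetric core, and only decay in the distance to the ends is left.\<close>

lemma alternating_sum_edge:
  assumes x: "0 \<le> x" "x \<le> 1" and l: "\<bar>l\<bar> > int N - int J"
  shows "norm (alternating_sum {- int N - l..int N - l} x)
     \<le> C * exp \<delta> * tail_const 1 (\<delta> / 2) * exp (\<delta> / 2 * J) * exp (- (\<delta> / 2) * \<bar>\<bar>real_of_int l\<bar> - real N\<bar>)"
proof -
  let ?K = "{- int N - l..int N - l}" and ?m = "\<bar>\<bar>real_of_int l\<bar> - real N\<bar> - real J"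
  have D: "0 \<le> C * exp \<delta>" using C_nonneg by simp
  have "norm (alternating_sum ?K x) \<le> (\<Sum>j\<in>?K. C * exp \<delta> * exp (- \<delta> * \<bar>real_of_int j\<bar>))" by (rule alternating_sum_norm[OF x])
  also have "\<dots> \<le> (\<Sum>j\<in>?K. C * exp \<delta> * (exp (- (\<delta> / 2) * ?m) * exp (- (\<delta> / 2) * \<bar>real_of_int j - 0\<bar>)))"
  proof (rule sum_mono)
    fix j assume j: "j \<in> ?K"
    have "\<bar>\<bar>l\<bar> - int N\<bar> - int J \<le> \<bar>j\<bar>" using j l by auto
    then have "?m \<le> \<bar>real_of_int j\<bar>" by linarith
    from mult_left_mono[OF exp_half_split[OF this] D]
    show "C * exp \<delta> * exp (- \<delta> * \<bar>real_of_int j\<bar>) \<le> C * exp \<delta> * (exp (- (\<delta> / 2) * ?m) * exp (- (\<delta> / 2) * \<bar>real_of_int j - 0\<bar>))" by simp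
  qed
  also have "\<dots> = C * exp \<delta> * exp (- (\<delta> / 2) * ?m) * (\<Sum>j\<in>?K. exp (- (\<delta> / 2) * \<bar>real_of_int j - 0\<bar>))"
    by (simp only: sum_distrib_left mult.assoc)
  also have "\<dots> \<le> C * exp \<delta> * exp (- (\<delta> / 2) * ?m) * tail_const 1 (\<delta> / 2)"
    using \<delta>_pos D by (intro mult_left_mono int_sum_exp) auto
  also have "exp (- (\<delta> / 2) * ?m) = exp (\<delta> / 2 * J) * exp (- (\<delta> / 2) * \<bar>\<bar>real_of_int l\<bar> - real N\<bar>)"
    unfolding exp_add[symmetric] by (rule arg_cong[of _ _ exp]) (simp add: algebra_simps)
  finally show ?thesis by (simp only: mult_ac)
qed

lemma alternating_sum_row_bound:
  assumes small: "\<And>K x. finite K \<Longrightarrow> {- int J..int J - 1} \<subseteq> K \<Longrightarrow> \<bar>x - 1/2\<bar> \<le> \<epsilon> \<Longrightarrow> norm (alternating_sum K x) \<le> \<eta>"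
    and x: "\<bar>x - 1/2\<bar> \<le> \<epsilon>" "0 \<le> x" "x \<le> 1" and K: "finite K"
  shows "(\<Sum>l\<in>K. (norm (alternating_sum {- int N - l..int N - l} x))\<^sup>2)
     \<le> (2 * real N + 1) * \<eta>\<^sup>2 + (C * exp \<delta> * tail_const 1 (\<delta> / 2) * exp (\<delta> / 2 * J))\<^sup>2 * (2 * tail_const 1 \<delta>)"
proof -
  let ?B = "C * exp \<delta> * tail_const 1 (\<delta> / 2) * exp (\<delta> / 2 * J)"
  let ?a = "\<lambda>l. (if l \<in> {- int N..int N} then \<eta>\<^sup>2 else 0)"
  \<comment> \<open>Adding ?e to the interior bound ?a avoids a case distinction in the sum; the sum of ?e over l is bounded independently of N.\<close>
  let ?e = "\<lambda>l. exp (- \<delta> * \<bar>real_of_int l - real N\<bar>) + exp (- \<delta> * \<bar>real_of_int l - (- real N)\<bar>)"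
  have t: "(norm (alternating_sum {- int N - l..int N - l} x))\<^sup>2 \<le> ?a l + ?B\<^sup>2 * ?e l" for l
  proof (cases "\<bar>l\<bar> > int N - int J")
    case True
    have "(norm (alternating_sum {- int N - l..int N - l} x))\<^sup>2 \<le> (?B * exp (- (\<delta> / 2) * \<bar>\<bar>real_of_int l\<bar> - real N\<bar>))\<^sup>2"
      by (intro power_mono alternating_sum_edge x True) auto
    also have "\<dots> = ?B\<^sup>2 * exp (- \<delta> * \<bar>\<bar>real_of_int l\<bar> - real N\<bar>)"
    proof -
      have "(exp (- (\<delta> / 2) * t))\<^sup>2 = exp (- \<delta> * t)" for t by (simp add: power2_eq_square exp_add[symmetric])
      then show ?thesis by (simp only: power_mult_distrib)
    qed
    also have "\<dots> \<le> ?B\<^sup>2 * ?e l"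
    proof (intro mult_left_mono)
      show "exp (- \<delta> * \<bar>\<bar>real_of_int l\<bar> - real N\<bar>) \<le> ?e l"
      proof (cases "l \<ge> 0")
        case False
        then have "\<bar>\<bar>real_of_int l\<bar> - real N\<bar> = \<bar>real_of_int l - (- real N)\<bar>" by linarith
        then show ?thesis by simp
      qed simp
    qed simp
    also have "\<dots> \<le> ?a l + ?B\<^sup>2 * ?e l" by simp
    finally show ?thesis .
  next
    case False
    then have "norm (alternating_sum {- int N - l..int N - l} x) \<le> \<eta>"
      by (intro small x(1)) auto
    then have "(norm (alternating_sum {- int N - l..int N - l} x))\<^sup>2 \<le> \<eta>\<^sup>2" by (intro power_mono) auto
    also have "\<dots> = ?a l" using False by auto
    also have "\<dots> \<le> ?a l + ?B\<^sup>2 * ?e l" by simp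
    finally show ?thesis .
  qed
  have "(\<Sum>l\<in>K. (norm (alternating_sum {- int N - l..int N - l} x))\<^sup>2) \<le> (\<Sum>l\<in>K. ?a l + ?B\<^sup>2 * ?e l)"
    by (intro sum_mono t)
  also have "\<dots> = (\<Sum>l\<in>K. ?a l) + ?B\<^sup>2 * (\<Sum>l\<in>K. ?e l)"
    by (subst sum.distrib, subst sum_distrib_left[symmetric], rule refl)
  also have "(\<Sum>l\<in>K. ?a l) = (\<Sum>l\<in>K \<inter> {- int N..int N}. \<eta>\<^sup>2)" by (rule sum.inter_restrict[OF K, symmetric])
  also have "\<dots> \<le> (\<Sum>l\<in>{- int N..int N}. \<eta>\<^sup>2)" by (intro sum_mono2) auto
  also have "\<dots> = (2 * real N + 1) * \<eta>\<^sup>2" by simp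
  also have "?B\<^sup>2 * (\<Sum>l\<in>K. ?e l) \<le> ?B\<^sup>2 * (2 * tail_const 1 \<delta>)"
    unfolding sum.distrib
    using int_sum_exp[OF K \<delta>_pos, of "real N"] int_sum_exp[OF K \<delta>_pos, of "- real N"] by (intro mult_left_mono) auto
  finally show ?thesis by simp
qed

text \<open>A train of 2N + 1 alternating bumps has norm proportional to 2N + 1. Each of the 2N + 1 interior translates
contributes at most \<eta>^2 times the same constant, and the two ends contribute a bounded amount. Choosing \<eta>^2 as
half of a lower frame bound gives a contradiction for large N.\<close>

theorem even_generator_not_frame:
  assumes even: "\<And>x. g (- x) = g x"
  shows "\<not> gabor_frame g (\<int> \<times> \<int>)"
proof
  assume "gabor_frame g (\<int> \<times> \<int>)"
  then obtain a where a: "a > 0" and low: "\<And>f. f \<in> L2_functions \<Longrightarrow> a * (L2_norm f)\<^sup>2 \<le> infsum (gabor_energy f) (\<int> \<times> \<int>)"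
    unfolding gabor_frame_def gabor_energy_def[symmetric] by blast
  define \<eta> where "\<eta> = sqrt (a / 2)"
  have \<eta>: "\<eta> > 0" "\<eta>\<^sup>2 = a / 2" using a by (auto simp: \<eta>_def)
  obtain J :: nat and \<epsilon> where \<epsilon>: "0 < \<epsilon>" "\<epsilon> < 1/2" and small:
    "\<And>K x. finite K \<Longrightarrow> {- int J..int J - 1} \<subseteq> K \<Longrightarrow> \<bar>x - 1/2\<bar> \<le> \<epsilon> \<Longrightarrow> norm (alternating_sum K x) \<le> \<eta>"
    using alternating_sum_small[OF even \<eta>(1)] by metis
  let ?c = "(C * exp \<delta> * tail_const 1 (\<delta> / 2) * exp (\<delta> / 2 * J))\<^sup>2 * (2 * tail_const 1 \<delta>)"
  have bound: "a / 2 * (2 * real N + 1) \<le> ?c" for N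
  proof -
    let ?T = "(2 * real N + 1) * \<eta>\<^sup>2 + ?c"
    have "a * (2 * \<epsilon> * (2 * real N + 1)) = a * (L2_norm (bumps N \<epsilon>))\<^sup>2" by (simp only: bumps_norm[OF \<epsilon> refl])
    also have "\<dots> \<le> infsum (gabor_energy (bumps N \<epsilon>)) (\<int> \<times> \<int>)" by (rule low[OF bumps_L2[OF \<epsilon> refl]])
    also have "\<dots> \<le> 2 * \<epsilon> * ?T"
    proof (rule bumps_energy[OF \<epsilon> refl])
      fix x :: real and K :: "int set" assume x: "x \<in> {1/2 - \<epsilon>..1/2 + \<epsilon>}" and K: "finite K"
      have "\<bar>x - 1/2\<bar> \<le> \<epsilon>" "0 \<le> x" "x \<le> 1" using x \<epsilon> by (auto simp: abs_le_iff)
      then show "(\<Sum>l\<in>K. (norm (alternating_sum {- int N - l..int N - l} x))\<^sup>2) \<le> ?T"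
        by (intro alternating_sum_row_bound[of J \<epsilon>] K small)
    qed
    finally have "2 * \<epsilon> * (a * (2 * real N + 1)) \<le> 2 * \<epsilon> * ?T" by (simp only: mult_ac)
    then have "a * (2 * real N + 1) \<le> ?T" using \<epsilon> by (subst (asm) mult_le_cancel_left_pos) auto
    moreover have "(2 * real N + 1) * \<eta>\<^sup>2 = a / 2 * (2 * real N + 1)" unfolding \<eta>(2) by simp
    moreover have "a * (2 * real N + 1) = a / 2 * (2 * real N + 1) + a / 2 * (2 * real N + 1)" by simp
    ultimately show ?thesis by linarith
  qed
  obtain N :: nat where N: "?c / a < N" using reals_Archimedean2 by blast
  have "?c < a * N" using N a by (simp only: pos_divide_less_eq mult.commute)
  also have "\<dots> \<le> a / 2 * (2 * real N + 1)" using a by (simp add: algebra_simps)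
  finally show False using bound[of N] by linarith
qed

end

section \<open>Sharpness of the density conditions\<close>

lemma fourier_rescale:
  fixes g :: "real \<Rightarrow> complex"
  assumes s: "s > 0"
  shows "fourier g (t / s) = of_real s * fourier (\<lambda>x. g (s * x)) t"
proof -
  have "fourier g (t / s) = \<bar>s\<bar> *\<^sub>R (LINT x|lborel. exp (- 2 * of_real pi * \<i> * of_real (0 + s * x) * of_real (t / s)) * g (0 + s * x))"
    unfolding fourier_def by (rule lborel_integral_real_affine) (use s in simp)
  moreover have "exp (- 2 * of_real pi * \<i> * of_real (0 + s * x) * of_real (t / s)) = exp (- 2 * of_real pi * \<i> * of_real x * of_real t)" for x :: real
  proof -
    have e: "complex_of_real (0 + s * x) * of_real (t / s) = of_real x * of_real t" using s by simp
    show ?thesis by (simp only: mult.assoc e)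
  qed
  ultimately show ?thesis using s by (simp add: fourier_def scaleR_conv_of_real)
qed

text \<open>Compressing g dilates its Fourier transform, which is continuous and nonzero at 0. At a large scale it therefore
has no zero in [0,1), so that n = 0 serves for every coset.\<close>

lemma fourier_nonvanishing_of_large_scale:
  fixes g :: "real \<Rightarrow> complex"
  assumes g: "integrable lborel g" and nz: "(LINT x|lborel. g x) \<noteq> 0"
  obtains s0 where "s0 > 0" "\<And>s. s \<ge> s0 \<Longrightarrow> fourier_nonvanishing (\<lambda>x. g (s * x))"
proof -
  have gm: "g \<in> borel_measurable borel" using borel_measurable_integrable[OF g] by simp
  have "\<exists>r>0. \<forall>t. \<bar>t\<bar> < r \<longrightarrow> fourier g t \<noteq> 0"
  proof (rule ccontr)
    assume "\<not> ?thesis"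
    then have neg: "\<exists>t. \<bar>t\<bar> < r \<and> fourier g t = 0" if "r > 0" for r using that by blast
    have "\<exists>t. \<bar>t\<bar> < 1 / real (Suc n) \<and> fourier g t = 0" for n by (rule neg) simp
    then obtain t where t: "\<And>n. \<bar>t n\<bar> < 1 / real (Suc n)" "\<And>n. fourier g (t n) = 0" by metis
    have t0: "t \<longlonglongrightarrow> 0" by (rule LIMSEQ_norm_0) (simp only: real_norm_def t(1))
    have "(\<lambda>n. fourier g (t n)) \<longlonglongrightarrow> (LINT x|lborel. g x)"
      unfolding fourier_def
    proof (rule integral_dominated_convergence)
      show "g \<in> borel_measurable lborel" using gm by simp
      show "(\<lambda>x. exp (- 2 * of_real pi * \<i> * of_real x * of_real (t n)) * g x) \<in> borel_measurable lborel" for n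
      proof -
        have "(\<lambda>x. exp (- 2 * of_real pi * \<i> * of_real x * of_real (t n))) \<in> borel_measurable borel"
          by (intro borel_measurable_continuous_onI continuous_intros)
        then show ?thesis using gm by simp
      qed
      show "integrable lborel (\<lambda>x. norm (g x))" using g by (rule integrable_norm)
      show "AE x in lborel. (\<lambda>n. exp (- 2 * of_real pi * \<i> * of_real x * of_real (t n)) * g x) \<longlonglongrightarrow> g x"
      proof (rule AE_I2)
        fix x :: real
        have "(\<lambda>n. exp (- 2 * of_real pi * \<i> * of_real x * of_real (t n)) * g x) \<longlonglongrightarrow> exp (- 2 * of_real pi * \<i> * of_real x * of_real 0) * g x"
          by (intro tendsto_intros t0)
        then show "(\<lambda>n. exp (- 2 * of_real pi * \<i> * of_real x * of_real (t n)) * g x) \<longlonglongrightarrow> g x" by simp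
      qed
      show "AE x in lborel. norm (exp (- 2 * of_real pi * \<i> * of_real x * of_real (t n)) * g x) \<le> norm (g x)" for n
        by (intro AE_I2) (simp add: norm_mult)
    qed
    then have "(\<lambda>n::nat. 0) \<longlonglongrightarrow> (LINT x|lborel. g x)" by (simp only: t(2))
    then have "(LINT x|lborel. g x) = 0" by (rule LIMSEQ_unique[OF _ tendsto_const])
    then show False using nz by simp
  qed
  then obtain r where r: "r > 0" "\<And>t. \<bar>t\<bar> < r \<Longrightarrow> fourier g t \<noteq> 0" by blast
  have "fourier_nonvanishing (\<lambda>x. g (s * x))" if s: "s \<ge> 1 / r" for s
    unfolding fourier_nonvanishing_def
  proof (intro allI impI exI[of _ "0::int"])
    fix b :: real assume b: "0 \<le> b \<and> b < 1"
    have s0: "s > 0" using s r(1) by (meson less_le_trans zero_less_divide_1_iff)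
    have "1 \<le> s * r" using s r(1) by (simp add: pos_divide_le_eq)
    then have "b < r * s" using b by (simp add: mult.commute)
    then have "b / s < r" using s0 by (simp add: pos_divide_less_eq)
    then have "\<bar>b / s\<bar> < r" using b s0 by simp
    from r(2)[OF this] show "fourier (\<lambda>x. g (s * x)) (of_int 0 + b) \<noteq> 0"
      unfolding fourier_rescale[OF s0] by simp
  qed
  then show ?thesis using that[of "1 / r"] r(1) by simp
qed

lemma integral_positive:
  fixes u :: "real \<Rightarrow> real"
  assumes "integrable lborel u" "\<And>x. u x > 0"
  shows "(LINT x|lborel. complex_of_real (u x)) \<noteq> 0"
proof
  assume "(LINT x|lborel. complex_of_real (u x)) = 0"
  then have "(LINT x|lborel. u x) = 0" by simp
  then have "AE x in lborel. u x = 0"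
    using integral_nonneg_eq_0_iff_AE[OF assms(1)] assms(2) by (simp add: less_imp_le)
  then have "AE x in (lborel :: real measure). False"
    by (rule AE_mp) (intro AE_I2, use assms(2) in \<open>metis less_irrefl\<close>)
  then have "emeasure (lborel :: real measure) UNIV = 0"
    by (simp add: AE_iff_null null_sets_def)
  then show False by simp
qed

lemma even_bell_curve:
  fixes u :: "real \<Rightarrow> real"
  assumes cont: "continuous_on UNIV u" and pos: "\<And>x. u x > 0" and dec: "\<And>x. u x \<le> C * exp (- \<bar>x\<bar>)" and even: "\<And>x. u (- x) = u x"
  obtains s0 where "s0 > 0" "\<And>s. s \<ge> s0 \<Longrightarrow> fourier_nonvanishing (\<lambda>x. of_real (u (s * x)))"
    "\<And>s. s > 0 \<Longrightarrow> \<not> gabor_frame (\<lambda>x. of_real (u (s * x))) (\<int> \<times> \<int>)"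
proof -
  have dg: "decaying_generator (\<lambda>x. complex_of_real (u (s * x))) C s" if s: "s > 0" for s
  proof
    show "continuous_on UNIV (\<lambda>x. complex_of_real (u (s * x)))"
      by (intro continuous_intros continuous_on_compose2[OF cont]) auto
    show "norm (complex_of_real (u (s * x))) \<le> C * exp (- s * \<bar>x\<bar>)" for x
      using dec[of "s * x"] pos[of "s * x"] s by (simp add: abs_mult)
  qed (rule s)
  have int: "integrable lborel (\<lambda>x. complex_of_real (u x))"
    using decaying_generator.g_integrable[OF dg[of 1]] by simp
  from Bochner_Integration.integrable_Re[OF this] have "integrable lborel u" by simp
  then have nz: "(LINT x|lborel. complex_of_real (u x)) \<noteq> 0" by (rule integral_positive[OF _ pos])
  obtain s0 where s0: "s0 > 0" "\<And>s. s \<ge> s0 \<Longrightarrow> fourier_nonvanishing (\<lambda>x. complex_of_real (u (s * x)))"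
    using fourier_nonvanishing_of_large_scale[OF int nz] by blast
  have "\<not> gabor_frame (\<lambda>x. complex_of_real (u (s * x))) (\<int> \<times> \<int>)" if s: "s > 0" for s
    by (rule decaying_generator.even_generator_not_frame[OF dg[OF s]]) (simp add: even)
  then show ?thesis using that s0 by blast
qed

lemma sech_bounds:
  fixes x :: real
  shows "exp x / (1 + exp (2 * x)) > 0" "exp x / (1 + exp (2 * x)) \<le> 1 * exp (- \<bar>x\<bar>)"
    "exp (- x) / (1 + exp (2 * (- x))) = exp x / (1 + exp (2 * x))"
proof -
  have d: "1 + exp (2 * y) > 0" for y :: real by (intro add_pos_pos) auto
  show "exp x / (1 + exp (2 * x)) > 0" using d by simp
  show "exp x / (1 + exp (2 * x)) \<le> 1 * exp (- \<bar>x\<bar>)"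
  proof -
    have "exp x \<le> exp (- \<bar>x\<bar>) * (1 + exp (2 * x))"
    proof (cases "x \<ge> 0")
      case True
      have "exp (- x) * (1 + exp (2 * x)) = exp (- x) + exp x" by (simp add: distrib_left exp_add[symmetric])
      then show ?thesis using True by simp
    next
      case False
      then show ?thesis by (simp add: distrib_left)
    qed
    then show ?thesis using d[of x] by (simp add: pos_divide_le_eq)
  qed
  have "exp (- x) * (1 + exp (2 * x)) = exp x * (1 + exp (2 * (- x)))"
    by (simp add: distrib_left exp_add[symmetric])
  then show "exp (- x) / (1 + exp (2 * (- x))) = exp x / (1 + exp (2 * x))"
    using d[of x] d[of "- x"] by (subst frac_eq_eq) auto
qed

text \<open>The hyperbolic secant u/(1+u^2) is odd in u, which gives symmetry order 2, equal to the degree of the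
denominator.\<close>

theorem class_K_sharp:
  "\<exists>(\<alpha>::real) G \<Lambda>. \<alpha> > 0 \<and> G \<in> class_K \<alpha> \<and> fourier_nonvanishing (on_reals G) \<and> separated_set \<Lambda> \<and>
     lower_density \<Lambda> = real (K_degree \<alpha> G) / real (K_symmetry \<alpha> G) \<and> \<not> gabor_frame (on_reals G) (\<Lambda> \<times> \<int>)"
proof -
  define u where "u = (\<lambda>x::real. exp x / (1 + exp (2 * x)))"
  have d0: "1 + exp (2 * x) \<noteq> 0" for x :: real using exp_gt_zero[of "2 * x"] by linarith
  have "continuous_on UNIV u" unfolding u_def using d0 by (intro continuous_intros) auto
  moreover have "u x > 0" "u x \<le> 1 * exp (- \<bar>x\<bar>)" "u (- x) = u x" for x
    unfolding u_def by (rule sech_bounds)+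
  ultimately obtain s where s: "s > 0" "\<And>t. t \<ge> s \<Longrightarrow> fourier_nonvanishing (\<lambda>x. of_real (u (t * x)))"
    "\<And>t. t > 0 \<Longrightarrow> \<not> gabor_frame (\<lambda>x. of_real (u (t * x))) (\<int> \<times> \<int>)"
    using even_bell_curve[of u 1] by metis
  define P where "P = [:0, 1:: complex:]"
  define Q where "Q = [:1, 0, 1:: complex:]"
  define G where "G = (\<lambda>z. poly P (exp (of_real s * z)) / poly Q (exp (of_real s * z)))"
  have PQ: "poly P w = w" "poly Q w = 1 + w * w" for w by (simp_all add: P_def Q_def)
  have G: "K_repr s G P Q"
    unfolding K_repr_def
  proof (intro conjI)
    show "P \<noteq> 0" "Q \<noteq> 0" "1 \<le> degree P" "degree P < degree Q" "poly P 0 = 0" by (simp_all add: P_def Q_def)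
    show "\<forall>z. \<not> (poly P z = 0 \<and> poly Q z = 0)" by (auto simp: PQ)
    show "\<forall>x\<ge>0. poly Q (complex_of_real x) \<noteq> 0"
    proof (intro allI impI)
      fix x :: real
      have "1 + x * x \<noteq> 0" using zero_le_square[of x] by linarith
      then have "complex_of_real (1 + x * x) \<noteq> 0" unfolding of_real_eq_0_iff .
      then show "poly Q (complex_of_real x) \<noteq> 0" by (simp add: PQ)
    qed
  qed (rule G_def)
  have r: "on_reals G = (\<lambda>x. of_real (u (s * x)))"
  proof
    fix x
    have "exp (complex_of_real s * complex_of_real x) = of_real (exp (s * x))" by (simp add: exp_of_real[symmetric])
    moreover have "exp (2 * (s * x)) = exp (s * x) * exp (s * x)" by (simp add: exp_add[symmetric])
    ultimately show "on_reals G x = of_real (u (s * x))" by (simp add: on_reals_def G_def PQ u_def)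
  qed
  have sym: "K_symmetry s G = 2"
    unfolding K_symmetry_def
  proof (rule Greatest_equality)
    have "G (z + 2 * of_real pi * \<i> / (of_nat 2 * of_real s)) = - 1 * G z" for z
    proof -
      have "complex_of_real s * (z + 2 * of_real pi * \<i> / (of_nat 2 * of_real s)) = of_real s * z + of_real pi * \<i>"
        using s by (simp add: distrib_left)
      then have "exp (complex_of_real s * (z + 2 * of_real pi * \<i> / (of_nat 2 * of_real s))) = - exp (of_real s * z)"
        by (simp add: exp_add)
      then show ?thesis unfolding G_def PQ by (simp only:) simp
    qed
    then show "1 \<le> (2::nat) \<and> (\<exists>c. \<forall>z. G (z + 2 * of_real pi * \<i> / (of_nat 2 * of_real s)) = c * G z)" by (intro conjI exI[of _ "- 1"] allI) simp_all
  next
    fix k assume k: "1 \<le> k \<and> (\<exists>c. \<forall>z. G (z + 2 * of_real pi * \<i> / (of_nat k * of_real s)) = c * G z)"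
    then obtain c where c: "\<And>z. G (z + 2 * of_real pi * \<i> / (of_nat k * of_real s)) = c * G z" by blast
    have "coeff Q 2 \<noteq> 0" by (simp add: Q_def numeral_2_eq_2)
    \<comment> \<open>Any symmetry order divides the exponent 2 that occurs in Q.\<close>
    then have "k dvd 2" using symmetry_structure(1)[OF s(1) G _ c] k by blast
    then show "k \<le> 2" by (rule dvd_imp_le) simp
  qed
  have deg: "K_degree s G = 2" by (simp add: K_degree_eq[OF s(1) G] Q_def)
  show ?thesis
  proof (rule exI[of _ s], rule exI[of _ G], rule exI[of _ \<int>], intro conjI)
    show "s > 0" by (rule s)
    show "G \<in> class_K s" using G by (auto simp: class_K_def)
    show "fourier_nonvanishing (on_reals G)" unfolding r by (rule s) simp
    show "separated_set \<int>" by (rule separated_set_Ints)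
    show "lower_density \<int> = real (K_degree s G) / real (K_symmetry s G)" by (simp add: lower_density_Ints sym deg)
    show "\<not> gabor_frame (on_reals G) (\<int> \<times> \<int>)" unfolding r by (rule s(3)[OF s(1)])
  qed
qed

text \<open>At scale s the Gaussian is the member of the class for \<alpha> = s^2 with constant P and Q.\<close>

theorem class_C_sharp:
  "\<exists>(\<alpha>::real) G \<Lambda>. \<alpha> > 0 \<and> G \<in> class_C \<alpha> \<and> fourier_nonvanishing (on_reals G) \<and> separated_set \<Lambda> \<and>
     lower_density \<Lambda> = real (C_degree \<alpha> G) + 1 \<and> \<not> gabor_frame (on_reals G) (\<Lambda> \<times> \<int>)"
proof -
  define u where "u = (\<lambda>x::real. exp (- x\<^sup>2 / 2))"
  have "continuous_on UNIV u" unfolding u_def by (intro continuous_intros) auto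
  moreover have "u x > 0" "u (- x) = u x" for x by (simp_all add: u_def)
  moreover have "u x \<le> exp (1/2) * exp (- \<bar>x\<bar>)" for x
  proof -
    have "0 \<le> (\<bar>x\<bar> - 1)\<^sup>2" by simp
    then have "- x\<^sup>2 / 2 \<le> 1/2 + - \<bar>x\<bar>" by (simp add: power2_diff)
    then show ?thesis unfolding u_def exp_add[symmetric] by simp
  qed
  ultimately obtain s where s: "s > 0" "\<And>t. t \<ge> s \<Longrightarrow> fourier_nonvanishing (\<lambda>x. of_real (u (t * x)))"
    "\<And>t. t > 0 \<Longrightarrow> \<not> gabor_frame (\<lambda>x. of_real (u (t * x))) (\<int> \<times> \<int>)"
    using even_bell_curve[of u "exp (1/2)"] by metis
  let ?\<alpha> = "s\<^sup>2"
  define G where "G = (\<lambda>z. exp (- of_real ?\<alpha> * z\<^sup>2 / 2) * (poly [:1::complex:] (exp (of_real ?\<alpha> * z)) / poly [:1::complex:] (exp (of_real ?\<alpha> * z))))"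
  have G: "C_repr ?\<alpha> G [:1:] [:1:]"
    unfolding C_repr_def by (intro conjI) (simp_all add: G_def)
  have a0: "?\<alpha> > 0" using s(1) by simp
  have r: "on_reals G = (\<lambda>x. of_real (u (s * x)))"
  proof
    fix x
    have "- complex_of_real ?\<alpha> * (complex_of_real x)\<^sup>2 / 2 = complex_of_real (- (s * x)\<^sup>2 / 2)"
      by (simp add: power_mult_distrib)
    then show "on_reals G x = of_real (u (s * x))"
      unfolding on_reals_def G_def u_def by (simp only: exp_of_real) simp
  qed
  have deg: "C_degree ?\<alpha> G = 0" by (simp add: C_degree_eq[OF a0 G])
  show ?thesis
  proof (rule exI[of _ ?\<alpha>], rule exI[of _ G], rule exI[of _ \<int>], intro conjI)
    show "?\<alpha> > 0" by (rule a0)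
    show "G \<in> class_C ?\<alpha>" using G by (auto simp: class_C_def)
    show "fourier_nonvanishing (on_reals G)" unfolding r by (rule s) simp
    show "separated_set \<int>" by (rule separated_set_Ints)
    show "lower_density \<int> = real (C_degree ?\<alpha> G) + 1" by (simp add: lower_density_Ints deg)
    show "\<not> gabor_frame (on_reals G) (\<int> \<times> \<int>)" unfolding r by (rule s(3)[OF s(1)])
  qed
qed

theorem theorem1p13:
  shows
    "(\<forall>(\<alpha>::real) G \<Lambda>.
        \<alpha> > 0 \<longrightarrow> G \<in> class_K \<alpha> \<longrightarrow> fourier_nonvanishing (on_reals G) \<longrightarrow>
        separated_set \<Lambda> \<longrightarrow>
        lower_density \<Lambda> > real (K_degree \<alpha> G) / real (K_symmetry \<alpha> G) \<longrightarrow>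
        gabor_frame (on_reals G) (\<Lambda> \<times> \<int>)) \<and>
     (\<exists>(\<alpha>::real) G \<Lambda>.
        \<alpha> > 0 \<and> G \<in> class_K \<alpha> \<and> fourier_nonvanishing (on_reals G) \<and>
        separated_set \<Lambda> \<and>
        lower_density \<Lambda> = real (K_degree \<alpha> G) / real (K_symmetry \<alpha> G) \<and>
        \<not> gabor_frame (on_reals G) (\<Lambda> \<times> \<int>)) \<and>
     (\<forall>(\<alpha>::real) G \<Lambda>.
        \<alpha> > 0 \<longrightarrow> G \<in> class_C \<alpha> \<longrightarrow> fourier_nonvanishing (on_reals G) \<longrightarrow>
        separated_set \<Lambda> \<longrightarrow>
        lower_density \<Lambda> > real (C_degree \<alpha> G) + 1 \<longrightarrow>
        gabor_frame (on_reals G) (\<Lambda> \<times> \<int>)) \<and>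
     (\<exists>(\<alpha>::real) G \<Lambda>.
        \<alpha> > 0 \<and> G \<in> class_C \<alpha> \<and> fourier_nonvanishing (on_reals G) \<and>
        separated_set \<Lambda> \<and>
        lower_density \<Lambda> = real (C_degree \<alpha> G) + 1 \<and>
        \<not> gabor_frame (on_reals G) (\<Lambda> \<times> \<int>))"
  by (intro conjI allI impI class_K_frame class_K_sharp class_C_frame class_C_sharp)

end
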